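(* Let $k$ be a field, $n\ge 1$, and let $H=\{\langle p_1,D_1\rangle,\ldots,\langle p_t,D_t\rangle\}$ be a finite set of points of $k^n$ with multiplicity structures. Let $I(H)\subseteq k[X_1,\ldots,X_n]$ be its vanishing ideal, and let $D(H)\subset\mathbb{N}_0^n$ and $poly(H)\subset k[X_1,\ldots,X_n]$ be the set of exponents and the set of polynomials associated to $H$ by the recursive constructions given in the context. Then $poly(H)$ is the reduced Gröbner basis of $I(H)$ with respect to the lexicographic ordering with $X_1\succ X_2\succ\cdots\succ X_n$, and $D(H)$ is the quotient basis of $I(H)$ with respect to this ordering.
   Context: **Lower sets.** A set $D\subseteq\mathbb{N}_0^n$ is a lower set if for all $d\in D$ and all $i$ with $d_i\neq 0$ we have $d-e_i\in D$ ($e_i$ the $i$-th unit vector). Its limiting set $E(D)$ is the set of all $\beta\in\mathbb{N}_0^n\setminus D$ such that $\beta-e_i\in D$ whenever $\beta_i\neq0$. Exponents $d\in\mathbb{N}_0^n$ are identified with monomials $X^d=X_1^{d_1}\cdots X_n^{d_n}$. **Points with multiplicity structures.** $\langle p,D\rangle$ denotes a point $p\in k^n$ with a finite nonempty lower set $D\subset\mathbb{N}_0^n$. In a finite set $H=\{\langle p_1,D_1\rangle,\ldots,\langle p_t,D_t\rangle\}$ ($t\ge1$) the points $p_1,\dots,p_t$ are pairwise distinct. $H$ defines the functionals $f\mapsto \frac{\partial^{d_1+\cdots+d_n}f}{\partial X_1^{d_1}\cdots\partial X_n^{d_n}}(p_u)$, $1\le u\le t$, $d\in D_u$. A polynomial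 vanishes on $H$ if all these functionals are zero on it, and the vanishing ideal is $I(H)=\{f\in k[X_1,\ldots,X_n]: f\text{ vanishes on }H\}$. Leading terms are always with respect to the lexicographic ordering with $X_1\succ\cdots\succ X_n$. The quotient basis of an ideal $I$ is the set of monomials (equivalently exponents) that are not leading monomials of elements of $I$; their classes form a $k$-basis of $k[X_1,\ldots,X_n]/I$. **Notation.** For $d\in\mathbb{N}_0^n$: $proj(d)=d_n$, $\widehat{proj}(d)=(d_1,\ldots,d_{n-1})$ (also used for points of $k^n$ and applied elementwise to sets); $embed_c(d_1,\ldots,d_{n-1})=(d_1,\ldots,d_{n-1},c)$ (applied elementwise to sets). **Addition of lower sets.** For finite lower sets $D_1,D_2\subset\mathbb{N}_0^n$, $D_1+D_2$ is obtained as follows: start with $D:=D_1$; for each $a\in D_2$ in turn, increase the last coordinate of $a$ by $1$ until $a\notin D$, then put $a$ into $D$. Equivalently, $(d',j)\in D_1+D_2$ iff $j<h_1(d')+h_2(d')$, where $h_i(d')=\#\{j:(d',j)\in D_i\}$. This operation is commutative and associative. **GLT and GLP.** For a finite lower set $D\subset\mathbb{N}_0^n$ and $a\in\mathbb{N}_0^n\setminus D$, $GLT(a,D)$ is the $r\in\mathbb{N}_0^n\setminus D$ with $\widehat{proj}(r)=\widehat{proj}(a)$ and $r_n$ minimal. If $G$ is a set of polynomials containing for each $e\in E(D)$ an element $f_e$ with leading term $X^e$, then $GLP(a,D,G)=f_{c'}\cdot X^{c-c'}$, where $c=GLT(a,D)$ and $c'\in E(D)$ is any chosen element such that $X^{c'}$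 divides $X^c$. **Construction of $D(H)$ and $poly(H)$, by recursion on $n$.** *Univariate case ($n=1$).* $D(H)=\{0,1,\ldots,\sum_{i=1}^t\#D_i-1\}$, $poly(H)=\{\prod_{i=1}^t(X_1-p_i)^{\#D_i}\}$. *Special case ($n\ge2$, all points of $H$ have the same $X_n$-coordinate $c$).* Let $w$ be the maximum of $proj(d)$ over all $d\in D_1\cup\cdots\cup D_t$. For $0\le i\le w$ let $F_i(D_u)=\{d\in D_u:proj(d)=i\}$ and let $H^{(i)}=\{\langle\widehat{proj}(p_u),\widehat{proj}(F_i(D_u))\rangle: F_i(D_u)\ne\varnothing\}$, a finite set of points of $k^{n-1}$ with multiplicity structures. Put $\tilde D_i=D(H^{(i)})$, $\tilde G_i=poly(H^{(i)})$ (recursively). Then $D(H)=\bigcup_{i=0}^w embed_i(\tilde D_i)$. Let $G_i=\{(X_n-c)^i g: g\in\tilde G_i\}$ and $\tilde G=\bigcup_{i=0}^wG_i\cup\{(X_n-c)^{w+1}\}$; $poly(H)$ is the set of elements of $\tilde G$ whose leading term lies in $E(D(H))$. *General case ($n\ge2$).* Write $H=H_1\cup\cdots\cup H_s$, where $H_i$ consists of the points of $H$ with $X_n$-coordinate $c_i$, and $c_1,\ldots,c_s$ are the distinct $X_n$-coordinates occurring. By the special case let $D'_i=D(H_i)$, $G_i=poly(H_i)$, and let $w_i$ be the maximum last coordinate of elements of the multiplicity structures in $H_i$. Then $D(H)=D'_1+\cdots+D'_s$. To get $poly(H)$: set $G:=G_1$. For $i=2,\ldots,s$ in turn, let $D_{\rm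 old}=D'_1+\cdots+D'_{i-1}$, $D=D'_1+\cdots+D'_i$, $\hat G:=\varnothing$, and for each $LT\in E(D)$, taken in increasing lexicographic order: - $f_1:=GLP(LT,D_{\rm old},G)$, $f_2:=GLP(LT,D'_i,G_i)$, and $v_j:=proj(GLT(LT,D'_j))$ for $j=1,\ldots,i$; - $q_1:=f_1(X_n-c_i)^{w_i+1}$, $q_2:=f_2\prod_{j=1}^{i-1}(X_n-c_j)^{w_j+1}$, $pp_1:=(X_n-c_i)^{w_i+1-v_i}$, $pp_2:=\prod_{j=1}^{i-1}(X_n-c_j)^{w_j+1-v_j}$; - compute by the Extended Euclidean Algorithm $r_1,r_2\in k[X_n]$ with $r_1pp_1+r_2pp_2=1$; - $f:=r_1q_1+r_2q_2$; reduce $f$ (fully) by the elements of $\hat G$ to get $f'$, and add $f'$ to $\hat G$. After all $LT\in E(D)$ are processed set $G:=\hat G$. After $i=s$ (immediately if $s=1$), $poly(H):=G$.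
   Formalization: The field k is assumed to have characteristic 0, or characteristic p > 0 exceeding every coordinate d_i of every exponent in the D_u; otherwise some derivative functional is identically zero and the claim fails (e.g. k = F_p, n = 1, H = {⟨0,{0,…,p}⟩}, where X^p lies in I(H)). *)

theory Defs
  imports "HOL-Library.Poly_Mapping"
begin

text \<open>
  Exponent vectors, points and polynomials are finitely supported maps. The variables are
  \<open>X\<^sub>1, \<dots>, X\<^sub>n\<close>: coordinate \<open>i\<close> lives at index \<open>i\<close>, and \<open>coords n\<close> models both the exponents
  (\<open>'b = nat\<close>) and the points of \<open>k\<^sup>n\<close> (\<open>'b = k\<close>). Since vectors are zero outside of \<open>{1..n}\<close>,
  dropping the last coordinate means setting it to zero.

  The order \<open><\<close> on \<open>nat \<Rightarrow>\<^sub>0 nat\<close> provided by the library compares at the smallest index where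
  the two arguments differ; it is the lexicographic order with \<open>X\<^sub>1 \<succ> X\<^sub>2 \<succ> \<dots> \<succ> X\<^sub>n\<close>.
\<close>

type_synonym exps = "nat \<Rightarrow>\<^sub>0 nat"
type_synonym 'a mpoly = "(nat \<Rightarrow>\<^sub>0 nat) \<Rightarrow>\<^sub>0 'a"
type_synonym 'a mult_points = "((nat \<Rightarrow>\<^sub>0 'a) \<times> exps set) set"

definition coords :: "nat \<Rightarrow> (nat \<Rightarrow>\<^sub>0 'b::zero) set" where
  "coords n = {d. Poly_Mapping.keys d \<subseteq> {1..n}}"

definition embed_at :: "nat \<Rightarrow> 'b::zero \<Rightarrow> (nat \<Rightarrow>\<^sub>0 'b) \<Rightarrow> (nat \<Rightarrow>\<^sub>0 'b)" where
  "embed_at n c d = Poly_Mapping.update n c d"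

definition proj :: "nat \<Rightarrow> (nat \<Rightarrow>\<^sub>0 'b::zero) \<Rightarrow> 'b" where
  "proj n d = Poly_Mapping.lookup d n"

definition proj_hat :: "nat \<Rightarrow> (nat \<Rightarrow>\<^sub>0 'b::zero) \<Rightarrow> (nat \<Rightarrow>\<^sub>0 'b)" where
  "proj_hat n d = Poly_Mapping.update n 0 d"


section \<open>Polynomials\<close>

definition polys :: "nat \<Rightarrow> 'a::field mpoly set" where
  "polys n = {f. Poly_Mapping.keys f \<subseteq> coords n}"

definition Const :: "'a::field \<Rightarrow> 'a mpoly" where
  "Const c = Poly_Mapping.single 0 c"

definition Var :: "nat \<Rightarrow> 'a::field mpoly" where
  "Var i = Poly_Mapping.single (Poly_Mapping.single i 1) 1"

definition polys_in_var :: "nat \<Rightarrow> 'a::field mpoly set" where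
  "polys_in_var i = {f. \<forall>m\<in>Poly_Mapping.keys f. Poly_Mapping.keys m \<subseteq> {i}}"

definition eval_at :: "(nat \<Rightarrow>\<^sub>0 'a::field) \<Rightarrow> 'a mpoly \<Rightarrow> 'a" where
  "eval_at p f = (\<Sum>m\<in>Poly_Mapping.keys f. Poly_Mapping.lookup f m * (\<Prod>i\<in>Poly_Mapping.keys m. Poly_Mapping.lookup p i ^ Poly_Mapping.lookup m i))"

definition partial_deriv :: "nat \<Rightarrow> 'a::field mpoly \<Rightarrow> 'a mpoly" where
  "partial_deriv i f =
     (\<Sum>m\<in>Poly_Mapping.keys f. Poly_Mapping.single (m - Poly_Mapping.single i 1) (of_nat (Poly_Mapping.lookup m i) * Poly_Mapping.lookup f m))"

definition mixed_deriv :: "nat \<Rightarrow> exps \<Rightarrow> 'a::field mpoly \<Rightarrow> 'a mpoly" where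
  "mixed_deriv n d f = fold (\<lambda>i. partial_deriv i ^^ Poly_Mapping.lookup d i) [1..<Suc n] f"

text \<open>Leading exponent, coefficient and term; meaningful for nonzero polynomials only.\<close>

definition lm :: "'a::field mpoly \<Rightarrow> exps" where
  "lm f = Max (Poly_Mapping.keys f)"

definition lc :: "'a::field mpoly \<Rightarrow> 'a" where
  "lc f = Poly_Mapping.lookup f (lm f)"

definition lt :: "'a::field mpoly \<Rightarrow> 'a mpoly" where
  "lt f = Poly_Mapping.single (lm f) (lc f)"

text \<open>The ideal of \<open>k[X\<^sub>1,\<dots>,X\<^sub>n]\<close> (not of the ambient ring in all variables) generated by \<open>S\<close>.\<close>

definition ideal_gen :: "nat \<Rightarrow> 'a::field mpoly set \<Rightarrow> 'a mpoly set" where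
  "ideal_gen n S = {\<Sum>s\<in>F. q s * s | F q. finite F \<and> F \<subseteq> S \<and> q ` F \<subseteq> polys n}"

definition is_Groebner_basis :: "nat \<Rightarrow> 'a::field mpoly set \<Rightarrow> 'a mpoly set \<Rightarrow> bool" where
  "is_Groebner_basis n I G \<longleftrightarrow>
     finite G \<and> G \<subseteq> I \<and> ideal_gen n (lt ` (G - {0})) = ideal_gen n (lt ` (I - {0}))"

definition is_reduced_Groebner_basis :: "nat \<Rightarrow> 'a::field mpoly set \<Rightarrow> 'a mpoly set \<Rightarrow> bool" where
  "is_reduced_Groebner_basis n I G \<longleftrightarrow>
     is_Groebner_basis n I G \<and>
     (\<forall>g\<in>G. g \<noteq> 0 \<and> lc g = 1 \<and>
        (\<forall>m\<in>Poly_Mapping.keys g. Poly_Mapping.single m 1 \<notin> ideal_gen n (lt ` (G - {g}))))"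

definition quotient_basis :: "nat \<Rightarrow> 'a::field mpoly set \<Rightarrow> exps set" where
  "quotient_basis n I = {d \<in> coords n. \<not> (\<exists>f\<in>I. f \<noteq> 0 \<and> lm f = d)}"

definition red_step :: "'a::field mpoly set \<Rightarrow> 'a mpoly \<Rightarrow> 'a mpoly \<Rightarrow> bool" where
  "red_step G f f' \<longleftrightarrow>
     (\<exists>g\<in>G. \<exists>u. g \<noteq> 0 \<and> lm g + u \<in> Poly_Mapping.keys f \<and>
        f' = f - Poly_Mapping.single u (Poly_Mapping.lookup f (lm g + u) / lc g) * g)"

definition fully_reduces_to :: "'a::field mpoly set \<Rightarrow> 'a mpoly \<Rightarrow> 'a mpoly \<Rightarrow> bool" where
  "fully_reduces_to G f f' \<longleftrightarrow> (red_step G)\<^sup>*\<^sup>* f f' \<and> (\<nexists>f''. red_step G f' f'')"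


section \<open>Lower sets and points with multiplicity structures\<close>

definition lower_set :: "nat \<Rightarrow> exps set \<Rightarrow> bool" where
  "lower_set n D \<longleftrightarrow> D \<subseteq> coords n \<and>
     (\<forall>d\<in>D. \<forall>i\<in>{1..n}. Poly_Mapping.lookup d i \<noteq> 0 \<longrightarrow> d - Poly_Mapping.single i 1 \<in> D)"

definition limiting_set :: "nat \<Rightarrow> exps set \<Rightarrow> exps set" where
  "limiting_set n D = {b \<in> coords n - D.
     \<forall>i\<in>{1..n}. Poly_Mapping.lookup b i \<noteq> 0 \<longrightarrow> b - Poly_Mapping.single i 1 \<in> D}"

definition points_with_mult :: "nat \<Rightarrow> 'a::field mult_points \<Rightarrow> bool" where
  "points_with_mult n H \<longleftrightarrow> finite H \<and> H \<noteq> {} \<and> inj_on fst H \<and>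
     (\<forall>(p, D)\<in>H. p \<in> coords n \<and> finite D \<and> D \<noteq> {} \<and> lower_set n D)"

text \<open>
  The functionals are the iterated formal partial derivatives without division by factorials. In
  characteristic \<open>p > 0\<close> such a functional is identically zero as soon as some \<open>d\<^sub>i \<ge> p\<close>.
\<close>

definition vanishing_ideal :: "nat \<Rightarrow> 'a::field mult_points \<Rightarrow> 'a mpoly set" where
  "vanishing_ideal n H =
     {f \<in> polys n. \<forall>(p, D)\<in>H. \<forall>d\<in>D. eval_at p (mixed_deriv n d f) = 0}"

definition raise :: "nat \<Rightarrow> exps \<Rightarrow> exps set \<Rightarrow> exps" where
  "raise n a D = embed_at n (LEAST j. proj n a \<le> j \<and> embed_at n j a \<notin> D) a"

text \<open>
  The elements of the second summand are inserted in increasing order; the lemma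
  \<open>lower_add_any_order\<close> below shows that every other order gives the same result, which is
  moreover the set obtained by adding up the heights of the columns.
\<close>

definition lower_add :: "nat \<Rightarrow> exps set \<Rightarrow> exps set \<Rightarrow> exps set" where
  "lower_add n D1 D2 = fold (\<lambda>a D. insert (raise n a D) D) (sorted_list_of_set D2) D1"

definition height :: "nat \<Rightarrow> exps set \<Rightarrow> exps \<Rightarrow> nat" where
  "height n D d = card {j. embed_at n j d \<in> D}"


abbreviation column :: "nat \<Rightarrow> exps set \<Rightarrow> exps \<Rightarrow> nat set" where
  "column n D d \<equiv> {j. embed_at n j d \<in> D}"

lemma embed_embed: "embed_at n j (embed_at n k d) = embed_at n j d"
  unfolding embed_at_def by (rule poly_mapping_eqI) (simp add: lookup_update)

lemma embed_eq_iff: "embed_at n j d = embed_at n k e \<longleftrightarrow> j = k \<and> proj_hat n d = proj_hat n e"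
proof -
  have "embed_at n j d = embed_at n k e \<longleftrightarrow>
      (\<forall>i. (if n = i then j else Poly_Mapping.lookup d i) = (if n = i then k else Poly_Mapping.lookup e i))"
    by (simp add: embed_at_def poly_mapping_eq_iff fun_eq_iff lookup_update)
  also have "\<dots> \<longleftrightarrow> j = k \<and> (\<forall>i. n \<noteq> i \<longrightarrow> Poly_Mapping.lookup d i = Poly_Mapping.lookup e i)"
    by auto
  also have "(\<forall>i. n \<noteq> i \<longrightarrow> Poly_Mapping.lookup d i = Poly_Mapping.lookup e i) \<longleftrightarrow>
      proj_hat n d = proj_hat n e"
    by (auto simp: proj_hat_def poly_mapping_eq_iff fun_eq_iff lookup_update)
  finally show ?thesis .
qed

lemma embed_proj: "embed_at n (proj n a) a = a"
  unfolding embed_at_def proj_def by (rule poly_mapping_eqI) (simp add: lookup_update)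

lemma proj_embed: "proj n (embed_at n j a) = j"
  unfolding embed_at_def proj_def by (simp add: lookup_update)

lemma embed_proj_hat: "embed_at n j (proj_hat n a) = embed_at n j a"
  unfolding proj_hat_def embed_at_def[symmetric] by (rule embed_embed)

lemma inj_embed: "inj (\<lambda>j. embed_at n j d)"
  by (simp add: inj_def embed_eq_iff)

lemma finite_column: "finite D \<Longrightarrow> finite (column n D d)"
  using finite_vimageI[OF _ inj_embed, of D n d] by (simp add: vimage_def)

lemma column_insert:
  "column n (insert (embed_at n j x) A) d =
     (if proj_hat n d = proj_hat n x then insert j (column n A d) else column n A d)"
  by (auto simp: embed_eq_iff)

lemma embed_in_coords: "1 \<le> n \<Longrightarrow> a \<in> coords n \<Longrightarrow> embed_at n j a \<in> coords n"
  unfolding coords_def embed_at_def by (auto simp: in_keys_iff lookup_update split: if_splits)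

lemma insertion_invariant:
  assumes "finite A" "A \<subseteq> coords n" "set xs \<subseteq> coords n" "1 \<le> n"
  defines "B \<equiv> fold (\<lambda>a D. insert (raise n a D) D) xs A"
  shows "finite B \<and> B \<subseteq> coords n \<and> A \<union> set xs \<subseteq> B \<and>
    (\<forall>d. \<forall>s\<in>column n B d. \<exists>a\<in>column n (A \<union> set xs) d. a \<le> s \<and> {a..s} \<subseteq> column n B d) \<and>
    (\<forall>d. height n B d = height n A d + length (filter (\<lambda>a. proj_hat n a = proj_hat n d) xs))"
  using assms(3) unfolding B_def
proof (induction xs rule: rev_induct)
  case Nil
  then show ?case using assms(1,2) by (auto intro!: bexI)
next
  case (snoc x xs)
  define B where "B = fold (\<lambda>a D. insert (raise n a D) D) xs A"
  have IH: "finite B" "B \<subseteq> coords n" "A \<union> set xs \<subseteq> B"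
    "\<And>d s. s \<in> column n B d \<Longrightarrow>
       \<exists>a\<in>column n (A \<union> set xs) d. a \<le> s \<and> {a..s} \<subseteq> column n B d"
    "\<And>d. height n B d = height n A d + length (filter (\<lambda>a. proj_hat n a = proj_hat n d) xs)"
    using snoc unfolding B_def by auto
  have x: "x \<in> coords n" using snoc.prems by simp
  define P where "P = (\<lambda>j. proj n x \<le> j \<and> embed_at n j x \<notin> B)"
  define r where "r = (LEAST j. P j)"
  have "\<exists>j. P j"
  proof (rule ccontr)
    assume "\<nexists>j. P j"
    then have "{proj n x..} \<subseteq> column n B x" by (auto simp: P_def)
    then show False
      using finite_column[OF IH(1)] infinite_Ici finite_subset by blast
  qed
  then have Pr: "P r" unfolding r_def by (metis LeastI)
  have minr: "embed_at n j x \<in> B" if "proj n x \<le> j" "j < r" for j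
    using that not_less_Least[of j P] unfolding r_def P_def by blast
  have fold: "fold (\<lambda>a D. insert (raise n a D) D) (xs @ [x]) A = insert (embed_at n r x) B"
    by (simp add: B_def raise_def r_def P_def)
  define B' where "B' = insert (embed_at n r x) B"
  have xB': "x \<in> B'"
  proof (cases "r = proj n x")
    case True
    then show ?thesis by (simp add: B'_def embed_proj)
  next
    case False
    then have "embed_at n (proj n x) x \<in> B" using Pr by (intro minr) (auto simp: P_def)
    then show ?thesis by (simp add: B'_def embed_proj)
  qed
  have gaps: "\<exists>a\<in>column n (A \<union> set (xs @ [x])) d. a \<le> s \<and> {a..s} \<subseteq> column n B' d"
    if "s \<in> column n B' d" for d s
  proof (cases "s \<in> column n B d")
    case True
    from IH(4)[OF this] show ?thesis unfolding B'_def by fastforce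
  next
    case False
    then have s: "s = r" and d: "proj_hat n d = proj_hat n x"
      using that by (auto simp: B'_def embed_eq_iff)
    have e: "embed_at n j d = embed_at n j x" for j using d by (simp add: embed_eq_iff)
    show ?thesis
    proof (intro bexI[of _ "proj n x"] conjI subsetI)
      show "proj n x \<le> s" using Pr s by (simp add: P_def)
      show "proj n x \<in> column n (A \<union> set (xs @ [x])) d" by (simp add: e embed_proj)
      fix j assume "j \<in> {proj n x..s}"
      then show "j \<in> column n B' d"
        using minr[of j] s by (cases "j = r") (auto simp: e B'_def)
    qed
  qed
  have "height n B' d = height n A d + length (filter (\<lambda>a. proj_hat n a = proj_hat n d) (xs @ [x]))" for d
  proof (cases "proj_hat n d = proj_hat n x")
    case True
    then have e: "embed_at n j d = embed_at n j x" for j by (simp add: embed_eq_iff)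
    have "r \<notin> column n B d" using Pr by (simp add: P_def e)
    then have "height n B' d = Suc (height n B d)"
      unfolding height_def B'_def column_insert using True finite_column[OF IH(1), of n d] by simp
    then show ?thesis using True IH(5)[of d] by simp
  next
    case False
    then have "height n B' d = height n B d"
      unfolding height_def B'_def column_insert by simp
    then show ?thesis using False IH(5)[of d] by simp
  qed
  moreover have "finite B'" "B' \<subseteq> coords n" "A \<union> set (xs @ [x]) \<subseteq> B'"
    using IH(1-3) xB' embed_in_coords[OF assms(4) x] by (auto simp: B'_def)
  ultimately show ?case unfolding fold B'_def[symmetric] using gaps by blast
qed

lemma lower_set_column:
  assumes "1 \<le> n" "lower_set n D" "j \<in> column n D d" "i \<le> j"
  shows "i \<in> column n D d"
  using assms(4,3)
proof (induction rule: dec_induct)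
  case base
  then show ?case .
next
  case (step m)
  have "Poly_Mapping.lookup (embed_at n (Suc m) d) n \<noteq> 0" by (simp add: embed_at_def lookup_update)
  moreover have "embed_at n (Suc m) d \<in> D" using step by simp
  ultimately have "embed_at n (Suc m) d - Poly_Mapping.single n 1 \<in> D"
    using assms(1,2) unfolding lower_set_def by auto
  moreover have "embed_at n (Suc m) d - Poly_Mapping.single n 1 = embed_at n m d"
    by (rule poly_mapping_eqI) (simp add: embed_at_def lookup_update lookup_minus lookup_single when_def)
  ultimately show ?case using step.IH by simp
qed

lemma insertion_heights:
  assumes n: "1 \<le> n" and D1: "finite D1" "lower_set n D1" and D2: "lower_set n D2"
    and xs: "distinct xs" "set xs = D2"
  shows "fold (\<lambda>a D. insert (raise n a D) D) xs D1 =
    {a \<in> coords n. proj n a < height n D1 (proj_hat n a) + height n D2 (proj_hat n a)}"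
proof -
  define B where "B = fold (\<lambda>a D. insert (raise n a D) D) xs D1"
  have co: "D1 \<subseteq> coords n" "set xs \<subseteq> coords n"
    using D1 D2 xs by (auto simp: lower_set_def)
  note inv = insertion_invariant[OF D1(1) co n, folded B_def]
  note fin_B = inv[THEN conjunct1]
  note B_coords = inv[THEN conjunct2, THEN conjunct1]
  note B_sup = inv[THEN conjunct2, THEN conjunct2, THEN conjunct1, unfolded xs(2)]
  note B_gaps = inv[THEN conjunct2, THEN conjunct2, THEN conjunct2, THEN conjunct1,
      unfolded xs(2), THEN spec, THEN bspec]
  note B_height = inv[THEN conjunct2, THEN conjunct2, THEN conjunct2, THEN conjunct2, THEN spec]
  have closed: "i \<in> column n B d" if j: "j \<in> column n B d" "i \<le> j" for i j d
  proof -
    obtain a where a: "a \<in> column n (D1 \<union> D2) d" "a \<le> j" "{a..j} \<subseteq> column n B d"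
      using B_gaps[OF j(1)] by (elim bexE conjE)
    show ?thesis
    proof (cases "a \<le> i")
      case True
      then show ?thesis using a j by auto
    next
      case False
      then have "i \<in> column n (D1 \<union> D2) d"
        using a(1) lower_set_column[OF n D1(2), of a d i] lower_set_column[OF n D2, of a d i] by auto
      then show ?thesis using B_sup by auto
    qed
  qed
  have col: "column n B d = {..<height n B d}" for d
  proof -
    have fin: "finite (column n B d)" by (rule finite_column[OF fin_B])
    show ?thesis
    proof (cases "column n B d = {}")
      case False
      define M where "M = Max (column n B d)"
      have "column n B d = {..M}"
      proof (intro equalityI subsetI)
        fix x assume "x \<in> column n B d"
        then show "x \<in> {..M}" unfolding M_def atMost_iff by (rule Max_ge[OF fin])
      next
        fix x assume "x \<in> {..M}"
        then show "x \<in> column n B d"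
          unfolding M_def atMost_iff by (rule closed[OF Max_in[OF fin False]])
      qed
      then show ?thesis unfolding height_def by (simp only: card_atMost lessThan_Suc_atMost)
    qed (simp add: height_def)
  qed
  have h2: "length (filter (\<lambda>a. proj_hat n a = proj_hat n d) xs) = height n D2 d" for d
  proof -
    have "{a \<in> D2. proj_hat n a = proj_hat n d} = (\<lambda>j. embed_at n j d) ` column n D2 d" (is "?L = ?R")
    proof (intro equalityI subsetI)
      fix a assume a: "a \<in> ?L"
      then have "embed_at n (proj n a) a = embed_at n (proj n a) d" unfolding embed_eq_iff by simp
      then have e: "a = embed_at n (proj n a) d" unfolding embed_proj .
      moreover have "proj n a \<in> column n D2 d" unfolding mem_Collect_eq e[symmetric] using a by simp
      ultimately show "a \<in> ?R" by (rule image_eqI)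
    next
      fix a assume "a \<in> ?R"
      then obtain j where j: "a = embed_at n j d" "a \<in> D2" by auto
      have "embed_at n (proj n a) a = embed_at n j d" unfolding embed_proj by (rule j(1))
      then show "a \<in> ?L" using j(2) unfolding embed_eq_iff by simp
    qed
    then have "card {a \<in> D2. proj_hat n a = proj_hat n d} = height n D2 d"
      unfolding height_def by (simp add: card_image inj_on_subset[OF inj_embed])
    moreover have "length (filter (\<lambda>a. proj_hat n a = proj_hat n d) xs) =
        card {a \<in> D2. proj_hat n a = proj_hat n d}"
      using distinct_card[OF distinct_filter[OF xs(1)], of "\<lambda>a. proj_hat n a = proj_hat n d"] xs(2) by simp
    ultimately show ?thesis by simp
  qed
  have "a \<in> B \<longleftrightarrow> a \<in> coords n \<and> proj n a < height n D1 (proj_hat n a) + height n D2 (proj_hat n a)" for a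
  proof -
    have "a \<in> B \<longleftrightarrow> proj n a \<in> column n B a" by (simp add: embed_proj)
    also have "\<dots> \<longleftrightarrow> proj n a < height n D1 a + height n D2 a"
      unfolding col[of a] B_height[of a] h2[of a] by simp
    also have "height n D1 a = height n D1 (proj_hat n a)" by (simp add: height_def embed_proj_hat)
    also have "height n D2 a = height n D2 (proj_hat n a)" by (simp add: height_def embed_proj_hat)
    finally show ?thesis using B_coords by blast
  qed
  then show ?thesis unfolding B_def by blast
qed

lemma lower_add_heights:
  assumes "1 \<le> n" "finite D1" "lower_set n D1" "finite D2" "lower_set n D2"
  shows "lower_add n D1 D2 =
    {a \<in> coords n. proj n a < height n D1 (proj_hat n a) + height n D2 (proj_hat n a)}"
  unfolding lower_add_def using assms by (intro insertion_heights) auto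

lemma lower_add_any_order:
  assumes "1 \<le> n" "finite D1" "lower_set n D1" "finite D2" "lower_set n D2"
    and "distinct xs" "set xs = D2"
  shows "lower_add n D1 D2 = fold (\<lambda>a D. insert (raise n a D) D) xs D1"
  unfolding lower_add_heights[OF assms(1-5)]
  using insertion_heights[OF assms(1-3,5-7)] by (rule sym)


section \<open>The construction\<close>

definition GLT :: "nat \<Rightarrow> exps \<Rightarrow> exps set \<Rightarrow> exps" where
  "GLT n a D = embed_at n (LEAST j. embed_at n j (proj_hat n a) \<notin> D) (proj_hat n a)"

text \<open>
  The construction leaves open the enumeration of the last coordinates, the divisor chosen in
  \<open>GLP\<close>, the Bezout coefficients and the order of the reduction steps. It is modelled as a
  relation between the input and its possible outputs.
\<close>

definition is_GLP :: "nat \<Rightarrow> exps \<Rightarrow> exps set \<Rightarrow> 'a::field mpoly set \<Rightarrow> 'a mpoly \<Rightarrow> bool" where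
  "is_GLP n a D G f \<longleftrightarrow>
     (\<exists>g\<in>G. \<exists>u. g \<noteq> 0 \<and> lm g \<in> limiting_set n D \<and> GLT n a D = lm g + u \<and>
        f = g * Poly_Mapping.single u 1)"

definition max_last :: "nat \<Rightarrow> 'a::field mult_points \<Rightarrow> nat" where
  "max_last n H = Max (\<Union>(p, D)\<in>H. proj n ` D)"

definition slice :: "nat \<Rightarrow> nat \<Rightarrow> 'a::field mult_points \<Rightarrow> 'a mult_points" where
  "slice n i H = {(proj_hat n p, proj_hat n ` {d \<in> D. proj n d = i}) | p D.
     (p, D) \<in> H \<and> {d \<in> D. proj n d = i} \<noteq> {}}"

definition level :: "nat \<Rightarrow> 'a \<Rightarrow> 'a::field mult_points \<Rightarrow> 'a mult_points" where
  "level n c H = {(p, D) \<in> H. proj n p = c}"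

text \<open>
  \<open>merge_basis n w D' G' cs c D\<^sub>o\<^sub>l\<^sub>d G lts G\<^sub>h\<^sub>a\<^sub>t\<close>: after the exponents \<open>lts\<close> have been processed, the
  new basis under construction is \<open>G\<^sub>h\<^sub>a\<^sub>t\<close>. Here \<open>cs\<close> are the last coordinates already merged
  (with the results \<open>D\<^sub>o\<^sub>l\<^sub>d\<close> and \<open>G\<close>), and \<open>c\<close> is the one being merged.
\<close>

inductive merge_basis ::
    "nat \<Rightarrow> ('a::field \<Rightarrow> nat) \<Rightarrow> ('a \<Rightarrow> exps set) \<Rightarrow> ('a \<Rightarrow> 'a mpoly set) \<Rightarrow> 'a list \<Rightarrow> 'a \<Rightarrow>
     exps set \<Rightarrow> 'a mpoly set \<Rightarrow> exps list \<Rightarrow> 'a mpoly set \<Rightarrow> bool"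
  for n w D' G' cs c D\<^sub>o\<^sub>l\<^sub>d G where
  start: "merge_basis n w D' G' cs c D\<^sub>o\<^sub>l\<^sub>d G [] {}"
| step: "\<lbrakk> merge_basis n w D' G' cs c D\<^sub>o\<^sub>l\<^sub>d G lts G\<^sub>h\<^sub>a\<^sub>t;
      is_GLP n t D\<^sub>o\<^sub>l\<^sub>d G f1; is_GLP n t (D' c) (G' c) f2;
      v = (\<lambda>x. proj n (GLT n t (D' x)));
      q1 = f1 * (Var n - Const c) ^ (w c + 1);
      q2 = f2 * (\<Prod>x\<in>set cs. (Var n - Const x) ^ (w x + 1));
      pp1 = (Var n - Const c) ^ (w c + 1 - v c);
      pp2 = (\<Prod>x\<in>set cs. (Var n - Const x) ^ (w x + 1 - v x));
      r1 \<in> polys_in_var n; r2 \<in> polys_in_var n; r1 * pp1 + r2 * pp2 = 1;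
      fully_reduces_to G\<^sub>h\<^sub>a\<^sub>t (r1 * q1 + r2 * q2) f' \<rbrakk>
    \<Longrightarrow> merge_basis n w D' G' cs c D\<^sub>o\<^sub>l\<^sub>d G (lts @ [t]) (insert f' G\<^sub>h\<^sub>a\<^sub>t)"

inductive merge_levels ::
    "nat \<Rightarrow> ('a::field \<Rightarrow> nat) \<Rightarrow> ('a \<Rightarrow> exps set) \<Rightarrow> ('a \<Rightarrow> 'a mpoly set) \<Rightarrow>
     'a list \<Rightarrow> exps set \<Rightarrow> 'a mpoly set \<Rightarrow> bool"
  for n w D' G' where
  first: "merge_levels n w D' G' [c] (D' c) (G' c)"
| "next": "\<lbrakk> merge_levels n w D' G' cs D\<^sub>o\<^sub>l\<^sub>d G; D = lower_add n D\<^sub>o\<^sub>l\<^sub>d (D' c);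
      merge_basis n w D' G' cs c D\<^sub>o\<^sub>l\<^sub>d G (sorted_list_of_set (limiting_set n D)) G\<^sub>h\<^sub>a\<^sub>t \<rbrakk>
    \<Longrightarrow> merge_levels n w D' G' (cs @ [c]) D G\<^sub>h\<^sub>a\<^sub>t"

text \<open>
  \<open>construction n H D G\<close>: the recursion may return \<open>D(H) = D\<close> and \<open>poly(H) = G\<close>;
  \<open>special_case\<close> is its restriction to inputs with a single last coordinate.
\<close>

inductive construction :: "nat \<Rightarrow> 'a::field mult_points \<Rightarrow> exps set \<Rightarrow> 'a mpoly set \<Rightarrow> bool"
  and special_case :: "nat \<Rightarrow> 'a mult_points \<Rightarrow> exps set \<Rightarrow> 'a mpoly set \<Rightarrow> bool" where
  univariate:
    "construction 1 H
       (Poly_Mapping.single 1 ` {..<\<Sum>(p, D)\<in>H. card D})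
       {\<Prod>(p, D)\<in>H. (Var 1 - Const (Poly_Mapping.lookup p 1)) ^ card D}"
| special:
    "\<lbrakk> 2 \<le> n; \<forall>(p, D)\<in>H. proj n p = c; w = max_last n H;
       \<And>i. i \<le> w \<Longrightarrow> construction (n - 1) (slice n i H) (Dt i) (Gt i);
       D = (\<Union>i\<le>w. embed_at n i ` Dt i);
       Gs = (\<Union>i\<le>w. (\<lambda>g. (Var n - Const c) ^ i * g) ` Gt i) \<union> {(Var n - Const c) ^ (w + 1)} \<rbrakk>
     \<Longrightarrow> special_case n H D {g \<in> Gs. lm g \<in> limiting_set n D}"
| general:
    "\<lbrakk> 2 \<le> n; distinct cs; set cs = (\<lambda>(p, D). proj n p) ` H;
       \<And>c. c \<in> set cs \<Longrightarrow> special_case n (level n c H) (D' c) (G' c);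
       merge_levels n (\<lambda>c. max_last n (level n c H)) D' G' cs D G \<rbrakk>
     \<Longrightarrow> construction n H D G"

end

theory Submission
  imports Defs "HOL-Computational_Algebra.Polynomial"
begin

text \<open>
  Up to nonzero factorials the functionals are Taylor coefficients, and these factor through the
  expansion in powers of \<open>X\<^sub>n - c\<close>; so for points with a common last coordinate \<open>c\<close> a polynomial
  lies in the vanishing ideal iff its \<open>i\<close>-th coefficient lies in the vanishing ideal of the \<open>i\<close>-th
  slice for all \<open>i \<le> w\<close>.

  Since \<open>X\<^sub>n\<close> is the smallest variable, the leading monomial of \<open>f\<close> is read off its leading
  coefficient in \<open>k[X\<^sub>n][X\<^sub>1, \<dots>, X\<^sub>n\<^sub>-\<^sub>1]\<close>. For a polynomial that vanishes on the points with last
  coordinate \<open>c\<close> and has leading exponent \<open>d\<close> over \<open>k[X\<^sub>n]\<close>, this leading coefficient is divisible by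
  \<open>(X\<^sub>n - c)^v\<close>, where \<open>v\<close> is the height of the column of \<open>D(H\<^sub>c)\<close> above \<open>d\<close>. For distinct \<open>c\<close>
  these powers are comaximal, hence for all of \<open>H\<close> their product divides the leading coefficient, and
  no leading monomial lies in the set obtained by adding up the heights. The Bezout combination of
  the construction has exactly this product as its leading coefficient, so each limiting exponent
  is a leading monomial; full reduction by the elements with smaller leading monomials moves the
  remaining terms into \<open>D(H)\<close>.
\<close>

text \<open>Knowing the leading monomials of two ideals says little about those of their
  intersection.

  The exponent w + 1 is that of the first power of X_n - c all of whose multiples satisfy every
  condition at level c. It puts \<open>q1\<close> and \<open>q2\<close> into both ideals being
  intersected, at the price of surplus factors \<open>pp1\<close> and \<open>pp2\<close> in their
  leading coefficients; the Bezout coefficients remove these again.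

  The hypothesis on the characteristic is forced by the undivided derivatives. Over a field of
  characteristic p take one point of the line with D = {0,...,p}: the p-th derivative is identically
  zero, so the quotient has dimension p, while D(H) has p + 1 elements.

  Since the construction is a relation with open choices, it must also be shown to have an output.
  Termination of reduction needs care: the order on exponents in infinitely many variables is not
  well-founded.\<close>

abbreviation "lookup \<equiv> Poly_Mapping.lookup"
abbreviation "keys \<equiv> Poly_Mapping.keys"
abbreviation "single \<equiv> Poly_Mapping.single"

section \<open>Exponents and lower sets\<close>

lemma in_coords_iff: "d \<in> coords n \<longleftrightarrow> (\<forall>i. lookup d i \<noteq> 0 \<longrightarrow> 1 \<le> i \<and> i \<le> n)"
  by (auto simp: coords_def in_keys_iff)

lemma coords_zero [simp]: "0 \<in> coords n"
  by (simp add: in_coords_iff)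

lemma coords_add_iff [simp]: "(a :: exps) + b \<in> coords n \<longleftrightarrow> a \<in> coords n \<and> b \<in> coords n"
  by (auto simp: in_coords_iff lookup_add)

lemma coords_diff: "(a :: exps) \<in> coords n \<Longrightarrow> a - b \<in> coords n"
  by (auto simp: in_coords_iff lookup_minus)

lemma coords_single: "1 \<le> i \<Longrightarrow> i \<le> n \<Longrightarrow> single i c \<in> coords n"
  by (auto simp: in_coords_iff lookup_single when_def)

lemma coords_hat: "d \<in> coords n \<Longrightarrow> proj_hat n d \<in> coords (n - 1)"
  by (fastforce simp: in_coords_iff proj_hat_def lookup_update)

lemma coords_pred: "d \<in> coords (n - 1) \<Longrightarrow> d \<in> coords n"
  by (fastforce simp: in_coords_iff)

lemma lookup_embed: "lookup (embed_at n c d) i = (if i = n then c else lookup d i)"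
  by (auto simp: embed_at_def lookup_update)

lemma lookup_hat: "lookup (proj_hat n d) i = (if i = n then 0 else lookup d i)"
  by (auto simp: proj_hat_def lookup_update)

lemma hat_embed: "proj_hat n (embed_at n c d) = proj_hat n d"
  by (rule poly_mapping_eqI) (simp add: lookup_embed lookup_hat)

lemma hat_pred: "1 \<le> n \<Longrightarrow> d \<in> coords (n - 1) \<Longrightarrow> proj_hat n d = d"
  by (rule poly_mapping_eqI) (auto simp: lookup_hat in_coords_iff)

lemma lookup_pred: "1 \<le> n \<Longrightarrow> d \<in> coords (n - 1) \<Longrightarrow> lookup d n = 0"
  by (auto simp: in_coords_iff)

lemma exps_eqI: "proj_hat n a = proj_hat n b \<Longrightarrow> lookup a n = lookup b n \<Longrightarrow> a = b"
  by (metis embed_eq_iff embed_proj proj_def)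

lemma embed_hat_eq: "proj_hat n a = proj_hat n b \<Longrightarrow> embed_at n j a = embed_at n j b"
  by (simp add: embed_eq_iff)

lemma embed_lookup: "embed_at n (lookup a n) a = a"
  using embed_proj[of n a] by (simp add: proj_def)

section \<open>The lexicographic order and the last coordinate\<close>

lemma exps_less_iff:
  "(a :: exps) < b \<longleftrightarrow> (\<exists>k. lookup a k < lookup b k \<and> (\<forall>k'<k. lookup a k' = lookup b k'))"
  by transfer (simp add: less_fun_def)

lemma exps_zero_le [simp]: "0 \<le> (a :: exps)"
  by (rule leI) (auto simp: exps_less_iff)

lemma exps_le_add: "(a :: exps) \<le> a + b"
  using add_left_mono[OF exps_zero_le, of a b] by simp

text \<open>Zeroing entry \<open>n\<close> leaves the entries before it alone, so the comparison is
  unaffected if it is decided before \<open>n\<close>. Supports inside {1..n} guarantee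
  that.\<close>

lemma less_if_hat_less:
  assumes "a \<in> coords n" "b \<in> coords n" "proj_hat n a < proj_hat n (b :: exps)"
  shows "a < b"
proof -
  from assms(3) obtain k where k: "lookup (proj_hat n a) k < lookup (proj_hat n b) k"
    "\<forall>k'<k. lookup (proj_hat n a) k' = lookup (proj_hat n b) k'"
    by (auto simp: exps_less_iff)
  have "k \<le> n" using k(1) assms(2) by (auto simp: lookup_hat in_coords_iff split: if_splits)
  then show ?thesis
    unfolding exps_less_iff using k
    by (intro exI[of _ k]) (auto simp: lookup_hat split: if_splits)
qed

lemma less_if_hat_eq:
  assumes "proj_hat n a = proj_hat n b" "lookup a n < lookup (b :: exps) n"
  shows "a < b"
proof -
  have "lookup a k' = lookup b k'" if "k' < n" for k'
    using arg_cong[OF assms(1), of "\<lambda>d. lookup d k'"] that by (simp add: lookup_hat)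
  then show ?thesis using assms(2) unfolding exps_less_iff by blast
qed

lemma hat_mono:
  assumes "a \<in> coords n" "b \<in> coords n" "a \<le> (b :: exps)"
  shows "proj_hat n a \<le> proj_hat n b"
  using less_if_hat_less[OF assms(2,1)] assms(3) by (meson leD leI)

text \<open>Passes from the unit steps of the definition to arbitrary divisors, by induction on the
  total degree of \<open>u\<close>.\<close>

lemma lower_set_subtract:
  assumes "lower_set n D" "a + u \<in> D"
  shows "a \<in> D"
  using assms(2)
proof (induction "\<Sum>i\<in>{1..n}. lookup u i" arbitrary: u rule: less_induct)
  case less
  have co: "u \<in> coords n" using less.prems assms(1) by (auto simp: lower_set_def)
  show ?case
  proof (cases "u = 0")
    case True
    then show ?thesis using less.prems by simp
  next
    case False
    then obtain i where i: "lookup u i \<noteq> 0" by (auto simp: poly_mapping_eq_iff fun_eq_iff)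
    then have i': "i \<in> {1..n}" using co by (auto simp: in_coords_iff)
    have "a + u - single i 1 \<in> D"
      using assms(1) less.prems i i' by (auto simp: lower_set_def lookup_add)
    moreover have "a + u - single i 1 = a + (u - single i 1)"
      using i by (intro poly_mapping_eqI) (auto simp: lookup_add lookup_minus lookup_single when_def)
    moreover have "(\<Sum>j\<in>{1..n}. lookup (u - single i 1) j) < (\<Sum>j\<in>{1..n}. lookup u j)"
      using i i' by (intro sum_strict_mono_ex1)
        (auto simp: lookup_minus lookup_single when_def intro!: bexI[of _ i])
    ultimately show ?thesis using less.hyps by metis
  qed
qed

text \<open>Descend by unit vectors while staying outside \<open>D\<close>; the total degree drops,
  and where no further step is possible a limiting exponent has been reached.\<close>

lemma limiting_set_divides:
  assumes "d \<in> coords n" "d \<notin> D"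
  shows "\<exists>e\<in>limiting_set n D. \<exists>u\<in>coords n. d = e + u"
  using assms
proof (induction "\<Sum>i\<in>{1..n}. lookup d i" arbitrary: d rule: less_induct)
  case less
  show ?case
  proof (cases "d \<in> limiting_set n D")
    case True
    then show ?thesis by (intro bexI[of _ d] bexI[of _ 0]) auto
  next
    case False
    then obtain i where i: "i \<in> {1..n}" "lookup d i \<noteq> 0" "d - single i 1 \<notin> D"
      using less.prems by (auto simp: limiting_set_def)
    have "(\<Sum>j\<in>{1..n}. lookup (d - single i 1) j) < (\<Sum>j\<in>{1..n}. lookup d j)"
      using i by (intro sum_strict_mono_ex1)
        (auto simp: lookup_minus lookup_single when_def intro!: bexI[of _ i])
    then obtain e u where eu: "e \<in> limiting_set n D" "u \<in> coords n" "d - single i 1 = e + u"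
      using less.hyps[of "d - single i 1"] less.prems i coords_diff by blast
    have "d = (d - single i 1) + single i 1"
      using i by (intro poly_mapping_eqI) (auto simp: lookup_add lookup_minus lookup_single when_def)
    then have "d = e + (u + single i 1)" using eu(3) by (metis add.assoc)
    then show ?thesis using eu i coords_single[of i n "1 :: nat"]
      by (intro bexI[of _ e] bexI[of _ "u + single i 1"]) auto
  qed
qed

text \<open>A nonzero \<open>u\<close> allows a unit step from \<open>e + u\<close> into
  \<open>D\<close> that still stays above \<open>e\<close>, so \<open>e\<close> would be in
  \<open>D\<close>. This antichain property is what makes the final basis reduced.\<close>

lemma limiting_set_antichain:
  assumes "lower_set n D" "e \<in> limiting_set n D" "e + u \<in> limiting_set n D"
  shows "u = 0"
proof (rule ccontr)
  assume "u \<noteq> 0"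
  then obtain i where i: "lookup u i \<noteq> 0" by (auto simp: poly_mapping_eq_iff fun_eq_iff)
  moreover have "e + u \<in> coords n" using assms(3) by (simp add: limiting_set_def)
  ultimately have "i \<in> {1..n}" by (auto simp: in_coords_iff lookup_add)
  then have "e + u - single i 1 \<in> D"
    using assms(3) i by (auto simp: limiting_set_def lookup_add)
  moreover have "e + u - single i 1 = e + (u - single i 1)"
    using i by (intro poly_mapping_eqI) (auto simp: lookup_add lookup_minus lookup_single when_def)
  ultimately have "e \<in> D" using lower_set_subtract[OF assms(1)] by metis
  then show False using assms(2) by (simp add: limiting_set_def)
qed

text \<open>A nonzero limiting exponent lies one unit step above an element of
  \<open>D\<close>.\<close>

lemma finite_limiting_set:
  assumes "finite D"
  shows "finite (limiting_set n D)"
proof (rule finite_subset)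
  show "limiting_set n D \<subseteq> insert 0 (\<Union>i\<in>{1..n}. (\<lambda>d. d + single i 1) ` D)"
  proof
    fix e assume e: "e \<in> limiting_set n D"
    show "e \<in> insert 0 (\<Union>i\<in>{1..n}. (\<lambda>d. d + single i 1) ` D)"
    proof (cases "e = 0")
      case False
      then obtain i where i: "lookup e i \<noteq> 0" by (auto simp: poly_mapping_eq_iff fun_eq_iff)
      moreover from this have "i \<in> {1..n}" using e by (auto simp: limiting_set_def in_coords_iff)
      ultimately have "e - single i 1 \<in> D" using e by (auto simp: limiting_set_def)
      moreover have "e = (e - single i 1) + single i 1"
        using i by (intro poly_mapping_eqI) (auto simp: lookup_add lookup_minus lookup_single when_def)
      ultimately show ?thesis using \<open>i \<in> {1..n}\<close> by blast
    qed simp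
  qed
qed (use assms in auto)

text \<open>Columns are closed downwards, hence initial segments, so the cardinality
  \<open>height\<close> is also the first missing index.\<close>

lemma column_height:
  assumes "1 \<le> n" "finite D" "lower_set n D"
  shows "column n D d = {..<height n D d}"
proof (cases "column n D d = {}")
  case False
  have fin: "finite (column n D d)" by (rule finite_column[OF assms(2)])
  have "column n D d = {..Max (column n D d)}"
    using Max_ge[OF fin] lower_set_column[OF assms(1,3) Max_in[OF fin False]] by fast
  then show ?thesis unfolding height_def by (metis card_atMost lessThan_Suc_atMost)
qed (simp add: height_def)

lemma embed_in_iff:
  assumes "1 \<le> n" "finite D" "lower_set n D"
  shows "embed_at n j d \<in> D \<longleftrightarrow> j < height n D d"
  using column_height[OF assms, of d] by auto

lemma in_iff_height:
  assumes "1 \<le> n" "finite D" "lower_set n D"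
  shows "d \<in> D \<longleftrightarrow> lookup d n < height n D d"
  using embed_in_iff[OF assms, of "lookup d n" d] by (simp add: embed_lookup)

lemma height_hat: "proj_hat n a = proj_hat n b \<Longrightarrow> height n D a = height n D b"
  unfolding height_def using embed_hat_eq[of n a b] by simp

lemma hat_hat: "proj_hat n (proj_hat n a) = proj_hat n a"
  by (rule poly_mapping_eqI) (simp add: lookup_hat)

lemma GLT_height:
  assumes "1 \<le> n" "finite D" "lower_set n D"
  shows "GLT n a D = embed_at n (height n D a) a"
proof -
  have "(LEAST j. embed_at n j a \<notin> D) = height n D a"
    unfolding embed_in_iff[OF assms] by (rule Least_equality) auto
  then show ?thesis by (simp add: GLT_def embed_proj_hat)
qed

lemma height_antimono:
  assumes "1 \<le> n" "finite D" "lower_set n D" "lookup u n = 0"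
  shows "height n D (d + u) \<le> height n D d"
proof -
  have e: "embed_at n j (d + u) = embed_at n j d + u" for j
    using assms(4) by (intro poly_mapping_eqI) (auto simp: lookup_embed lookup_add)
  have "column n D (d + u) \<subseteq> column n D d"
    using lower_set_subtract[OF assms(3)] by (auto simp: e)
  then show ?thesis unfolding column_height[OF assms(1-3)] by simp
qed

text \<open>The unit step in direction \<open>n\<close> leads into \<open>D\<close>, so a limiting
  exponent sits directly on top of its column.\<close>

lemma height_limiting_set:
  assumes "1 \<le> n" "finite D" "lower_set n D" "t \<in> limiting_set n D"
  shows "height n D t = lookup t n"
proof (cases "lookup t n")
  case 0
  then show ?thesis
    using assms(4) in_iff_height[OF assms(1-3), of t] by (simp add: limiting_set_def)
next
  case (Suc k)
  have "t - single n 1 \<in> D" using assms(1,4) Suc by (auto simp: limiting_set_def)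
  moreover have "t - single n 1 = embed_at n k t"
    using Suc by (intro poly_mapping_eqI) (auto simp: lookup_embed lookup_minus lookup_single when_def)
  ultimately have "k < height n D t" using embed_in_iff[OF assms(1-3)] by simp
  moreover have "\<not> lookup t n < height n D t"
    using assms(4) in_iff_height[OF assms(1-3), of t] by (simp add: limiting_set_def)
  ultimately show ?thesis using Suc by simp
qed

lemma lower_add_lower:
  assumes "1 \<le> n" "finite D1" "lower_set n D1" "finite D2" "lower_set n D2"
  shows "finite (lower_add n D1 D2)" "lower_set n (lower_add n D1 D2)"
    "d \<in> coords n \<Longrightarrow> height n (lower_add n D1 D2) d = height n D1 d + height n D2 d"
proof -
  have in_iff: "a \<in> lower_add n D1 D2 \<longleftrightarrow>
      a \<in> coords n \<and> lookup a n < height n D1 a + height n D2 a" for a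
    unfolding lower_add_heights[OF assms] using height_hat[OF hat_hat] by (simp add: proj_def)
  have "D1 \<subseteq> coords n" "D2 \<subseteq> coords n" using assms(3,5) by (auto simp: lower_set_def)
  then show fin: "finite (lower_add n D1 D2)"
    using insertion_invariant[of D1 n "sorted_list_of_set D2"] assms by (simp add: lower_add_def)
  show low: "lower_set n (lower_add n D1 D2)"
    unfolding lower_set_def
  proof (intro conjI ballI impI)
    show "lower_add n D1 D2 \<subseteq> coords n" using in_iff by auto
    fix d i assume d: "d \<in> lower_add n D1 D2" and i: "i \<in> {1..n}" "lookup d i \<noteq> 0"
    have s: "d = (d - single i 1) + single i 1"
      using i by (intro poly_mapping_eqI) (auto simp: lookup_add lookup_minus lookup_single when_def)
    \<comment> \<open>For i = n the column stays the same and the last entry drops; for any other i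
      the column can only get higher and the last entry stays.\<close>
    have "height n D d \<le> height n D (d - single i 1)" if "finite D" "lower_set n D" for D
    proof (cases "i = n")
      case True
      have "proj_hat n d = proj_hat n (d - single i 1)"
        using True by (intro poly_mapping_eqI) (auto simp: lookup_hat lookup_minus lookup_single when_def)
      then show ?thesis using height_hat by (metis order_refl)
    next
      case False
      then show ?thesis
        using height_antimono[OF assms(1) that, of "single i 1" "d - single i 1"] s
        by (simp add: lookup_single)
    qed
    from this[OF assms(2,3)] this[OF assms(4,5)] show "d - single i 1 \<in> lower_add n D1 D2"
      using d unfolding in_iff by (auto simp: coords_diff lookup_minus)
  qed
  assume d: "d \<in> coords n"
  have "column n (lower_add n D1 D2) d = {..<height n D1 d + height n D2 d}"
    using height_hat[OF hat_embed, of n] embed_in_coords[OF assms(1) d] by (auto simp: in_iff lookup_embed)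
  then show "height n (lower_add n D1 D2) d = height n D1 d + height n D2 d"
    unfolding column_height[OF assms(1) fin low] by simp
qed

text \<open>On all of \<open>exps\<close> the order has the infinite descent
  \<open>single i 1\<close> for growing i. With n variables it embeds into the lexicographic order
  on lists of length n.\<close>

lemma wf_coords: "wf {(a, b :: exps). a \<in> coords n \<and> b \<in> coords n \<and> a < b}"
proof (rule wf_subset)
  let ?l = "\<lambda>a :: exps. map (lookup a) [1..<Suc n]"
  show "wf (inv_image (lexn less_than n) ?l)" by (intro wf_inv_image wf_lexn wf_less_than)
  show "{(a, b). a \<in> coords n \<and> b \<in> coords n \<and> a < b} \<subseteq> inv_image (lexn less_than n) ?l"
  proof (rule subrelI)
    fix a b :: exps assume "(a, b) \<in> {(a, b). a \<in> coords n \<and> b \<in> coords n \<and> a < b}"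
    then have ab: "a \<in> coords n" "b \<in> coords n" "a < b" by auto
    then obtain k where k: "lookup a k < lookup b k" "\<forall>k'<k. lookup a k' = lookup b k'"
      by (auto simp: exps_less_iff)
    then have kn: "1 \<le> k" "k \<le> n" using ab(2) by (auto simp: in_coords_iff)
    then have s: "[1..<Suc n] = [1..<k] @ k # [Suc k..<Suc n]"
      by (metis le_imp_less_Suc le_less_Suc_eq less_or_eq_imp_le upt_add_eq_append upt_conv_Cons le_Suc_ex)
    have "map (lookup a) [1..<k] = map (lookup b) [1..<k]" using k by simp
    then show "(a, b) \<in> inv_image (lexn less_than n) ?l"
      unfolding lexn_conv s map_append list.map in_inv_image using k(1) kn
      by (intro CollectI case_prodI conjI exI[of _ "map (lookup a) [1..<k]"]
          exI[of _ "lookup a k"] exI[of _ "lookup b k"] exI) auto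
  qed
qed

section \<open>Polynomials as coefficient families\<close>

text \<open>A nonempty \<open>S\<close> yields the zero map as \<open>single m 0\<close>, which
  saves a separate base case.\<close>

lemma keys_induct [consumes 1, case_names single add]:
  fixes f :: "'b \<Rightarrow>\<^sub>0 'c :: comm_monoid_add"
  assumes "keys f \<subseteq> S"
    and s: "\<And>m a. m \<in> S \<Longrightarrow> P (single m a)"
    and a: "\<And>f g. P f \<Longrightarrow> P g \<Longrightarrow> P (f + g)"
    and "S \<noteq> {}"
  shows "P f"
proof -
  have e: "f = (\<Sum>m\<in>keys f. single m (lookup f m))"
    by (rule poly_mapping_eqI) (simp add: lookup_sum lookup_single when_def in_keys_iff)
  have "P (\<Sum>m\<in>A. single m (lookup f m))" if "A \<subseteq> keys f" for A
    using finite_subset[OF that finite_keys] that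
  proof (induction A rule: finite_induct)
    case empty
    obtain m where "m \<in> S" using assms(4) by blast
    then show ?case using s[of m 0] by simp
  next
    case (insert x A)
    then show ?case using assms(1) by (auto intro!: a s)
  qed
  then show ?thesis using e by (metis order_refl)
qed

lemma mpoly_induct [case_names single add]:
  fixes f :: "'b \<Rightarrow>\<^sub>0 'c :: comm_monoid_add"
  assumes "\<And>m a. P (single m a)" "\<And>f g. P f \<Longrightarrow> P g \<Longrightarrow> P (f + g)"
  shows "P f"
  using subset_UNIV by (rule keys_induct) (use assms in auto)

lemma polys_iff: "f \<in> polys n \<longleftrightarrow> (\<forall>m. lookup f m \<noteq> 0 \<longrightarrow> m \<in> coords n)"
  by (auto simp: polys_def in_keys_iff)

lemma polys_keys: "f \<in> polys n \<Longrightarrow> m \<in> keys f \<Longrightarrow> m \<in> coords n"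
  by (auto simp: polys_def)

lemma polys_induct [consumes 1, case_names single add]:
  assumes "f \<in> polys n" "\<And>m a. m \<in> coords n \<Longrightarrow> P (single m a)" "\<And>f g. P f \<Longrightarrow> P g \<Longrightarrow> P (f + g)"
  shows "P f"
proof -
  have "(coords n :: exps set) \<noteq> {}" using coords_zero by blast
  moreover have "keys f \<subseteq> coords n" using assms(1) by (simp add: polys_def)
  ultimately show ?thesis by (rule keys_induct[rotated -1]) (use assms in auto)
qed

lemma polys_zero [simp]: "0 \<in> polys n"
  by (simp add: polys_def)

lemma polys_one [simp]: "1 \<in> polys n"
  by (simp add: polys_def)

lemma polys_single: "m \<in> coords n \<Longrightarrow> single m a \<in> polys n"
  by (simp add: polys_def)

lemma polys_Const [simp]: "Const a \<in> polys n"
  by (simp add: Const_def polys_single)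

lemma polys_Var: "1 \<le> i \<Longrightarrow> i \<le> n \<Longrightarrow> Var i \<in> polys n"
  by (simp add: Var_def polys_single coords_single)

lemma polys_add: "f \<in> polys n \<Longrightarrow> g \<in> polys n \<Longrightarrow> f + g \<in> polys n"
  unfolding polys_def using keys_add[of f g] by blast

lemma polys_diff: "f \<in> polys n \<Longrightarrow> g \<in> polys n \<Longrightarrow> f - g \<in> polys n"
  by (auto simp: polys_iff lookup_minus) (metis diff_zero)+

lemma polys_mult: "f \<in> polys n \<Longrightarrow> g \<in> polys n \<Longrightarrow> f * g \<in> polys n"
  unfolding polys_def using keys_mult[of f g] by fastforce

lemma polys_pred: "f \<in> polys (n - 1) \<Longrightarrow> f \<in> polys n"
  by (auto simp: polys_iff coords_pred)

text \<open>Cancellation can make the support of \<open>f + g\<close> smaller; this does no harm to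
  summands that vanish at coefficient 0. Additivity of \<open>colpoly\<close>,
  \<open>taylor\<close>, \<open>tau\<close>, evaluation and derivatives all comes from here.\<close>

lemma sum_keys_add:
  assumes "\<And>m. \<psi> m 0 = 0" "\<And>m a b. \<psi> m (a + b) = \<psi> m a + \<psi> m b"
  shows "(\<Sum>m\<in>keys (f + g). \<psi> m (lookup (f + g) m)) =
    (\<Sum>m\<in>keys f. \<psi> m (lookup f m)) + (\<Sum>m\<in>keys g. \<psi> m (lookup g m))"
  by (rule setsum_keys_plus_distrib) (simp_all add: assms)

lemma lookup_mult_single:
  fixes f :: "'a :: field mpoly"
  shows "lookup (f * single u c) (m + u) = lookup f m * c"
proof (induction f rule: mpoly_induct)
  case (single k a)
  then show ?case by (simp add: mult_single lookup_single when_def)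
qed (simp add: lookup_add algebra_simps)

lemma keys_mult_single:
  fixes f :: "'a :: field mpoly"
  assumes "c \<noteq> 0"
  shows "keys (f * single u c) = (\<lambda>m. m + u) ` keys f"
proof
  show "keys (f * single u c) \<subseteq> (\<lambda>m. m + u) ` keys f"
    using keys_mult[of f "single u c"] assms by fastforce
  show "(\<lambda>m. m + u) ` keys f \<subseteq> keys (f * single u c)"
    using assms by (auto simp: in_keys_iff lookup_mult_single)
qed

lemma lookup_Const_mult: "lookup (Const c * f) m = c * lookup (f :: 'a :: field mpoly) m"
  using lookup_mult_single[of f 0 c m] by (simp add: Const_def mult.commute)

lemma lookup_Var_mult:
  "lookup (Var n * f) m = (if lookup m n = 0 then 0 else lookup (f :: 'a :: field mpoly) (m - single n 1))"
proof (cases "lookup m n = 0")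
  case True
  have "m \<noteq> k + single n 1" for k
    using arg_cong[of m "k + single n 1" "\<lambda>d. lookup d n"] True by (auto simp: lookup_add)
  then have "m \<notin> keys (f * single (single n 1) 1)"
    by (subst keys_mult_single) auto
  then show ?thesis using True by (simp add: Var_def in_keys_iff mult.commute)
next
  case False
  then have "m = (m - single n 1) + single n 1"
    by (intro poly_mapping_eqI) (auto simp: lookup_add lookup_minus lookup_single when_def)
  then show ?thesis
    using lookup_mult_single[of f "single n 1" 1 "m - single n 1"] False
    by (simp add: Var_def mult.commute)
qed

section \<open>Leading monomials and leading coefficients\<close>

lemma keys_le_lm: "m \<in> keys f \<Longrightarrow> m \<le> lm f"
  by (simp add: lm_def)

lemma lm_in_keys: "f \<noteq> 0 \<Longrightarrow> lm f \<in> keys f"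
  unfolding lm_def by (rule Max_in) (auto simp: poly_mapping_eq_iff in_keys_iff fun_eq_iff)

lemma lm_eqI: "t \<in> keys f \<Longrightarrow> (\<And>m. m \<in> keys f \<Longrightarrow> m \<le> t) \<Longrightarrow> lm f = t"
  unfolding lm_def by (rule Max_eqI) auto

lemma lc_nonzero: "f \<noteq> 0 \<Longrightarrow> lc f \<noteq> 0"
  using lm_in_keys[of f] by (simp add: lc_def in_keys_iff)

lemma lm_mult_single:
  fixes f :: "'a :: field mpoly"
  assumes "f \<noteq> 0" "c \<noteq> 0"
  shows "lm (f * single u c) = lm f + u" "lc (f * single u c) = lc f * c" "f * single u c \<noteq> 0"
proof -
  show l: "lm (f * single u c) = lm f + u"
    by (rule lm_eqI) (use assms keys_mult_single[OF assms(2), of f u] in \<open>auto simp: lm_in_keys keys_le_lm\<close>)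
  then show e: "lc (f * single u c) = lc f * c" by (simp add: lc_def lookup_mult_single)
  show "f * single u c \<noteq> 0" using keys_mult_single[OF assms(2), of f u] lm_in_keys[OF assms(1)] by auto
qed

text \<open>
  The coefficient of \<open>f\<close>, as a polynomial over \<open>k[X\<^sub>n]\<close>, at the exponent \<open>proj_hat n d\<close>; the last
  entry of \<open>d\<close> is irrelevant.
\<close>

definition colpoly :: "nat \<Rightarrow> 'a::field mpoly \<Rightarrow> exps \<Rightarrow> 'a poly" where
  "colpoly n f d = (\<Sum>m\<in>keys f. if proj_hat n m = proj_hat n d then monom (lookup f m) (lookup m n) else 0)"

lemma colpoly_add: "colpoly n (f + g) d = colpoly n f d + colpoly n g d"
  unfolding colpoly_def by (rule sum_keys_add) (auto simp: add_monom)

lemma colpoly_single: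
  "colpoly n (single m a) d = (if proj_hat n m = proj_hat n d then monom a (lookup m n) else 0)"
  by (simp add: colpoly_def)

lemma coeff_colpoly: "coeff (colpoly n f d) j = lookup f (embed_at n j d)"
proof (induction f rule: mpoly_induct)
  case (single m a)
  have "m = embed_at n j d \<longleftrightarrow> proj_hat n m = proj_hat n d \<and> lookup m n = j"
    by (metis embed_eq_iff embed_lookup)
  then show ?case by (auto simp: colpoly_single lookup_single when_def)
qed (simp add: colpoly_add lookup_add)

lemma lookup_eq_coeff_colpoly: "lookup f m = coeff (colpoly n f m) (lookup m n)"
  by (simp add: coeff_colpoly embed_lookup)

lemma colpoly_Const_mult: "colpoly n (Const c * f) d = smult c (colpoly n f d)"
  by (rule poly_eqI) (simp add: coeff_colpoly lookup_Const_mult)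

lemma colpoly_Var_mult: "colpoly n (Var n * f) d = pCons 0 (colpoly n f d)"
proof (rule poly_eqI)
  fix j
  have "embed_at n (Suc k) d - single n 1 = embed_at n k d" for k
    by (rule poly_mapping_eqI) (simp add: lookup_embed lookup_minus lookup_single when_def)
  then show "coeff (colpoly n (Var n * f) d) j = coeff (pCons 0 (colpoly n f d)) j"
    by (cases j) (auto simp: coeff_colpoly lookup_Var_mult lookup_embed)
qed

lemma colpoly_hat: "proj_hat n a = proj_hat n b \<Longrightarrow> colpoly n f a = colpoly n f b"
  by (simp add: colpoly_def)

text \<open>The ring embedding of k[X_n], so that divisibility and Bezout identities can be handled
  in the library type \<open>poly\<close>.\<close>

definition univ_poly :: "nat \<Rightarrow> 'a::field poly \<Rightarrow> 'a mpoly" where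
  "univ_poly n q = poly (map_poly Const q) (Var n)"

lemma Const_0 [simp]: "Const 0 = 0"
  by (simp add: Const_def)

lemma Const_1 [simp]: "Const 1 = 1"
  by (simp add: Const_def)

lemma Const_add: "Const (a + b) = Const a + Const b"
  by (simp add: Const_def single_add)

lemma Const_mult: "Const (a * b) = Const a * Const b"
  by (simp add: Const_def mult_single)

lemma univ_poly_0 [simp]: "univ_poly n 0 = 0"
  by (simp add: univ_poly_def)

lemma univ_poly_1 [simp]: "univ_poly n 1 = 1"
  by (simp add: univ_poly_def)

lemma univ_poly_pCons: "univ_poly n (pCons a q) = Const a + Var n * univ_poly n q"
  by (simp add: univ_poly_def map_poly_pCons)

lemma univ_poly_add: "univ_poly n (p + q) = univ_poly n p + univ_poly n q"
proof -
  have "map_poly Const (p + q) = map_poly Const p + map_poly Const q"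
    by (rule poly_eqI) (simp add: coeff_map_poly Const_add)
  then show ?thesis by (simp add: univ_poly_def)
qed

lemma univ_poly_smult: "univ_poly n (smult a q) = Const a * univ_poly n q"
  by (induction q) (simp_all add: univ_poly_pCons Const_mult algebra_simps)

lemma univ_poly_mult: "univ_poly n (p * q) = univ_poly n p * univ_poly n q"
  by (induction p) (simp_all add: univ_poly_pCons univ_poly_add univ_poly_smult algebra_simps)

lemma univ_poly_power: "univ_poly n (p ^ k) = univ_poly n p ^ k"
  by (induction k) (simp_all add: univ_poly_mult)

lemma univ_poly_prod: "univ_poly n (\<Prod>x\<in>A. p x) = (\<Prod>x\<in>A. univ_poly n (p x))"
  by (induction A rule: infinite_finite_induct) (simp_all add: univ_poly_mult)

lemma univ_poly_linear: "univ_poly n [:- c, 1:] = Var n - Const c"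
proof -
  have "Const (- c) = - Const c" by (simp add: Const_def single_uminus)
  then show ?thesis by (simp add: univ_poly_pCons)
qed

lemma colpoly_univ: "colpoly n (univ_poly n q * f) d = q * colpoly n f d"
proof (induction q)
  case 0
  then show ?case by (simp add: colpoly_def)
next
  case (pCons a q)
  have "univ_poly n (pCons a q) * f = Const a * f + Var n * (univ_poly n q * f)"
    by (simp add: univ_poly_pCons algebra_simps)
  then show ?case using pCons by (simp add: colpoly_add colpoly_Const_mult colpoly_Var_mult)
qed

lemma colpoly_1: "colpoly n 1 0 = 1"
  using colpoly_single[of n 0 1 0] by (simp add: monom_0 one_pCons)

text \<open>\<open>colpoly\<close> at exponent 0 is a left inverse. Bezout identities stated for
  multivariate polynomials can thus be pulled back to univariate ones.\<close>

lemma univ_poly_inject: "univ_poly n p = univ_poly n q \<longleftrightarrow> p = q"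
  by (metis colpoly_univ colpoly_1 mult.right_neutral)

lemma polys_univ: "1 \<le> n \<Longrightarrow> univ_poly n q \<in> polys n"
  by (induction q) (auto simp: univ_poly_pCons intro!: polys_add polys_mult polys_Var)

text \<open>Makes the Bezout coefficients \<open>r1\<close> and \<open>r2\<close> of the merge,
  specified only by their supports, accessible as univariate polynomials.\<close>

lemma polys_in_var_eq: "polys_in_var n = range (univ_poly n)"
proof (intro equalityI subsetI)
  fix f :: "'a mpoly" assume "f \<in> polys_in_var n"
  then have "keys f \<subseteq> {m. keys m \<subseteq> {n}}" by (auto simp: polys_in_var_def)
  then show "f \<in> range (univ_poly n)"
  proof (induction f rule: keys_induct)
    case (single m a)
    have m: "m = single n (lookup m n)"
      using single by (intro poly_mapping_eqI) (auto simp: lookup_single when_def in_keys_iff)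
    have "univ_poly n (monom a j) = single (single n j) a" for j
    proof (induction j)
      case (Suc j)
      then show ?case
        by (simp add: monom_Suc univ_poly_pCons Var_def mult_single flip: single_add)
    qed (simp add: monom_0 univ_poly_pCons Const_def)
    then show ?case using m by (metis rangeI)
  next
    case (add f g)
    then show ?case by (auto simp flip: univ_poly_add)
  next
    show "{m. keys m \<subseteq> {n}} \<noteq> {}" by (auto intro: exI[of _ 0])
  qed
next
  fix f :: "'a mpoly" assume "f \<in> range (univ_poly n)"
  then obtain q where "f = univ_poly n q" by auto
  then show "f \<in> polys_in_var n"
  proof (induction q arbitrary: f)
    case (pCons a q)
    have "keys (univ_poly n q) \<subseteq> {m. keys m \<subseteq> {n}}" using pCons by (auto simp: polys_in_var_def)
    moreover have "keys (single n 1 + b) \<subseteq> {n}" if "keys b \<subseteq> {n}" for b :: exps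
      using keys_add[of "single n 1" b] that by auto
    ultimately have "keys (Var n * univ_poly n q) \<subseteq> {m. keys m \<subseteq> {n}}"
      using keys_mult[of "Var n" "univ_poly n q"] by (fastforce simp: Var_def)
    then have "keys (univ_poly n (pCons a q)) \<subseteq> {m. keys m \<subseteq> {n}}"
      using keys_add[of "Const a" "Var n * univ_poly n q"] by (force simp: univ_poly_pCons Const_def split: if_splits)
    then show ?case using pCons(3) by (auto simp: polys_in_var_def)
  qed (simp add: polys_in_var_def)
qed

text \<open>Monomials over smaller columns are smaller whatever their last exponent is; inside the
  top column the last exponent decides, and its maximum is a degree. The last entry of
  \<open>t\<close> is arbitrary.\<close>

lemma lm_by_colpoly:
  assumes "t \<in> coords n" "1 \<le> n" "f \<in> polys n"
    and le: "\<And>m. m \<in> keys f \<Longrightarrow> proj_hat n m \<le> proj_hat n t"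
    and nz: "colpoly n f t \<noteq> 0"
  shows "f \<noteq> 0" "lm f = embed_at n (degree (colpoly n f t)) t" "lc f = lead_coeff (colpoly n f t)"
proof -
  let ?t = "embed_at n (degree (colpoly n f t)) t"
  have k: "?t \<in> keys f"
    using nz by (simp add: in_keys_iff flip: coeff_colpoly)
  then show "f \<noteq> 0" by auto
  show lm: "lm f = ?t"
  proof (rule lm_eqI[OF k])
    fix m assume m: "m \<in> keys f"
    have co: "m \<in> coords n" "?t \<in> coords n" using m k assms(3) by (auto simp: polys_def)
    show "m \<le> ?t"
    proof (cases "proj_hat n m = proj_hat n t")
      case True
      have "coeff (colpoly n f t) (lookup m n) \<noteq> 0"
        using m True by (metis lookup_eq_coeff_colpoly in_keys_iff colpoly_hat)
      then have "lookup m n \<le> lookup ?t n" by (simp add: lookup_embed le_degree)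
      then show ?thesis
        using True less_if_hat_eq[of n m ?t] exps_eqI[of n m ?t] by (fastforce simp: hat_embed)
    next
      case False
      then have "proj_hat n m < proj_hat n ?t" using le[OF m] by (simp add: hat_embed)
      then show ?thesis using less_if_hat_less[OF co] by simp
    qed
  qed
  show "lc f = lead_coeff (colpoly n f t)" by (simp add: lc_def lm coeff_colpoly)
qed

lemma colpoly_lm:
  assumes "1 \<le> n" "f \<in> polys n" "f \<noteq> 0"
  shows "degree (colpoly n f (lm f)) = lookup (lm f) n" "lead_coeff (colpoly n f (lm f)) = lc f"
    "m \<in> keys f \<Longrightarrow> proj_hat n m \<le> proj_hat n (lm f)"
proof -
  have co: "m \<in> coords n" if "m \<in> keys f" for m using that assms(2) by (auto simp: polys_def)
  show le: "proj_hat n m \<le> proj_hat n (lm f)" if "m \<in> keys f" for m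
    using that assms(3) by (intro hat_mono co lm_in_keys keys_le_lm)
  have nz: "colpoly n f (lm f) \<noteq> 0"
    using lookup_eq_coeff_colpoly[of f "lm f" n] lc_nonzero[OF assms(3)] by (auto simp: lc_def)
  have co': "lm f \<in> coords n" using assms(3) by (intro co lm_in_keys)
  note * = lm_by_colpoly[OF co' assms(1,2) le nz]
  show "degree (colpoly n f (lm f)) = lookup (lm f) n"
    using *(2) by (metis lookup_embed)
  show "lead_coeff (colpoly n f (lm f)) = lc f"
    using *(3) by simp
qed

section \<open>The functionals as Taylor coefficients\<close>

lemma coeff_shift_power:
  "coeff ([:c, 1:] ^ k) i = of_nat (k choose i) * (c :: 'a :: field) ^ (k - i)"
proof (cases "i \<le> k")
  case True
  then show ?thesis by (simp add: coeff_linear_poly_power)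
next
  case False
  then show ?thesis by (simp add: coeff_eq_0 degree_linear_power binomial_eq_0)
qed

text \<open>The coefficient of Y^d in f(p + Y): the factor for i is the coefficient of Y_i^(d_i) in
  (p_i + Y_i)^(m_i). No factorial is divided by, so this makes sense in every
  characteristic.\<close>

definition taylor :: "nat \<Rightarrow> (nat \<Rightarrow>\<^sub>0 'a::field) \<Rightarrow> exps \<Rightarrow> 'a mpoly \<Rightarrow> 'a" where
  "taylor n p d f =
     (\<Sum>m\<in>keys f. lookup f m * (\<Prod>i\<in>{1..n}. coeff ([:lookup p i, 1:] ^ lookup m i) (lookup d i)))"

lemma taylor_add: "taylor n p d (f + g) = taylor n p d f + taylor n p d g"
  unfolding taylor_def by (rule sum_keys_add) (auto simp: algebra_simps)

lemma taylor_zero [simp]: "taylor n p d 0 = 0"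
  by (simp add: taylor_def)

lemma taylor_single:
  "taylor n p d (single m a) = a * (\<Prod>i\<in>{1..n}. coeff ([:lookup p i, 1:] ^ lookup m i) (lookup d i))"
  by (simp add: taylor_def)

lemma taylor_Const_mult: "taylor n p d (Const c * f) = c * taylor n p d f"
proof (induction f rule: mpoly_induct)
  case (single m a)
  then show ?case by (simp add: Const_def mult_single taylor_single)
qed (simp add: algebra_simps taylor_add)

text \<open>Write X_j as p_j + Y_j: the constant rescales, and Y_j shifts the index one step down.
  Closure under this shift is the reason why lower sets define ideals.\<close>

lemma taylor_Var_mult:
  assumes "j \<in> {1..n}"
  shows "taylor n p d (Var j * f) = lookup p j * taylor n p d f +
    (if lookup d j = 0 then 0 else taylor n p (d - single j 1) f)"
proof (induction f rule: mpoly_induct)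
  case (single m a)
  define B where "B = (\<lambda>m d i. coeff ([:lookup p i, 1:] ^ lookup m i) (lookup d i))"
  have split: "(\<Prod>i\<in>{1..n}. h i) = h j * (\<Prod>i\<in>{1..n} - {j}. h i)" for h :: "nat \<Rightarrow> 'a"
    using assms by (simp add: prod.remove)
  have T: "taylor n p d' (single m' a) = a * (B m' d' j * (\<Prod>i\<in>{1..n} - {j}. B m' d' i))" for m' d'
    unfolding taylor_single split B_def ..
  have 1: "(\<Prod>i\<in>{1..n} - {j}. B (single j 1 + m) d i) = (\<Prod>i\<in>{1..n} - {j}. B m d i)"
    by (rule prod.cong) (auto simp: B_def lookup_add lookup_single)
  have 2: "(\<Prod>i\<in>{1..n} - {j}. B m (d - single j 1) i) = (\<Prod>i\<in>{1..n} - {j}. B m d i)"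
    by (rule prod.cong) (auto simp: B_def lookup_minus lookup_single)
  have 3: "B (single j 1 + m) d j =
      lookup p j * B m d j + (if lookup d j = 0 then 0 else B m (d - single j 1) j)"
    by (cases "lookup d j") (auto simp: B_def lookup_add lookup_minus algebra_simps)
  have 4: "Var j * single m a = single (single j 1 + m) a" by (simp add: Var_def mult_single)
  show ?case unfolding 4 T 1 2 3 by (auto simp: algebra_simps)
qed (auto simp: algebra_simps taylor_add)

section \<open>Iterated partial derivatives\<close>

lemma partial_deriv_add: "partial_deriv i (f + g) = partial_deriv i f + partial_deriv i g"
  unfolding partial_deriv_def by (rule sum_keys_add) (auto simp: algebra_simps single_add)

lemma partial_deriv_single:
  "partial_deriv i (single m a) = single (m - single i 1) (of_nat (lookup m i) * a)"
  by (simp add: partial_deriv_def)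

lemma partial_deriv_funpow_add:
  "(partial_deriv i ^^ k) (f + g) = (partial_deriv i ^^ k) f + (partial_deriv i ^^ k) g"
  by (induction k) (simp_all add: partial_deriv_add)

lemma partial_deriv_funpow_single:
  "(partial_deriv i ^^ k) (single m a) =
    single (m - single i k) (of_nat (fact k * (lookup m i choose k)) * a)"
proof (induction k)
  case (Suc k)
  have m: "m - single i k - single i 1 = m - single i (Suc k)"
    by (rule poly_mapping_eqI) (simp add: lookup_minus lookup_single when_def)
  \<comment> \<open>Differentiating once more brings down the current exponent
    \<open>lookup m i - k\<close>; absorption turns it into the next binomial. If \<open>k\<close>
    is at least \<open>lookup m i\<close>, both sides are 0, so truncated subtraction is
    harmless.\<close>
  have "Suc k * (lookup m i choose Suc k) = (lookup m i - k) * (lookup m i choose k)"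
    by (simp only: binomial_absorption binomial_absorb_comp)
  then have "fact k * ((lookup m i - k) * (lookup m i choose k)) =
      fact k * (Suc k * (lookup m i choose Suc k))" by (simp only:)
  then have "(lookup m i - k) * (fact k * (lookup m i choose k)) = fact (Suc k) * (lookup m i choose Suc k)"
    by (simp only: fact_Suc of_nat_id ac_simps)
  then show ?case
    using Suc
    by (simp add: partial_deriv_single m lookup_minus del: One_nat_def fact_Suc flip: mult.assoc of_nat_mult)
qed simp

lemma mixed_deriv_add: "mixed_deriv n d (f + g) = mixed_deriv n d f + mixed_deriv n d g"
proof -
  have "fold (\<lambda>i. partial_deriv i ^^ lookup d i) xs (f + g) =
      fold (\<lambda>i. partial_deriv i ^^ lookup d i) xs f + fold (\<lambda>i. partial_deriv i ^^ lookup d i) xs g" for xs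
    by (induction xs arbitrary: f g) (simp_all add: partial_deriv_funpow_add)
  then show ?thesis unfolding mixed_deriv_def .
qed

lemma fold_deriv_single:
  assumes "distinct xs"
  shows "\<exists>m'. (\<forall>i. lookup m' i = (if i \<in> set xs then lookup m i - lookup d i else lookup m i)) \<and>
    fold (\<lambda>i. partial_deriv i ^^ lookup d i) xs (single m a) =
    single m' (of_nat (\<Prod>i\<in>set xs. fact (lookup d i) * (lookup m i choose lookup d i)) * a)"
  using assms
proof (induction xs arbitrary: m a)
  case (Cons x xs)
  define m1 where "m1 = m - single x (lookup d x)"
  have lm1: "lookup m1 i = (if i = x then lookup m x - lookup d x else lookup m i)" for i
    by (simp add: m1_def lookup_minus lookup_single when_def)
  have P: "(\<Prod>i\<in>set xs. fact (lookup d i) * (lookup m1 i choose lookup d i)) =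
      (\<Prod>i\<in>set xs. fact (lookup d i) * (lookup m i choose lookup d i) :: nat)"
    using Cons.prems by (intro prod.cong) (auto simp: lm1)
  let ?b = "of_nat (fact (lookup d x) * (lookup m x choose lookup d x)) * a"
  obtain m' where m': "\<forall>i. lookup m' i = (if i \<in> set xs then lookup m1 i - lookup d i else lookup m1 i)"
    "fold (\<lambda>i. partial_deriv i ^^ lookup d i) xs (single m1 ?b) =
      single m' (of_nat (\<Prod>i\<in>set xs. fact (lookup d i) * (lookup m1 i choose lookup d i)) * ?b)"
    using Cons.IH[of m1 ?b] Cons.prems by auto
  have "fold (\<lambda>i. partial_deriv i ^^ lookup d i) (x # xs) (single m a) =
      single m' (of_nat (\<Prod>i\<in>set (x # xs). fact (lookup d i) * (lookup m i choose lookup d i)) * a)"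
    using Cons.prems m'(2) unfolding P
    by (simp add: partial_deriv_funpow_single ac_simps del: of_nat_fact flip: m1_def)
  moreover have "\<forall>i. lookup m' i = (if i \<in> set (x # xs) then lookup m i - lookup d i else lookup m i)"
    using m'(1) Cons.prems by (auto simp: lm1)
  ultimately show ?case by blast
qed auto

lemma eval_at_add: "eval_at p (f + g) = eval_at p f + eval_at p g"
  unfolding eval_at_def by (rule sum_keys_add) (auto simp: algebra_simps)

lemma eval_at_single:
  assumes "m \<in> coords n"
  shows "eval_at p (single m a) = a * (\<Prod>i\<in>{1..n}. lookup p i ^ lookup m i)"
proof -
  have "(\<Prod>i\<in>keys m. lookup p i ^ lookup m i) = (\<Prod>i\<in>{1..n}. lookup p i ^ lookup m i)"
    using assms by (intro prod.mono_neutral_left) (auto simp: coords_def in_keys_iff)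
  then show ?thesis by (simp add: eval_at_def)
qed

text \<open>Differentiation leaves a factorial times a binomial, evaluation leaves p_i^(m_i - d_i);
  apart from the factorial, this is the coefficient in (p_i + Y_i)^(m_i).\<close>

lemma eval_mixed_deriv:
  assumes "f \<in> polys n"
  shows "eval_at p (mixed_deriv n d f) = (\<Prod>i\<in>{1..n}. of_nat (fact (lookup d i))) * taylor n p d f"
  using assms
proof (induction f rule: polys_induct)
  case (single m a)
  have s: "set [1..<Suc n] = {1..n}" by auto
  obtain m' where m': "\<And>i. lookup m' i = (if i \<in> {1..n} then lookup m i - lookup d i else lookup m i)"
    "mixed_deriv n d (single m a) =
       single m' (of_nat (\<Prod>i\<in>{1..n}. fact (lookup d i) * (lookup m i choose lookup d i)) * a)"
    using fold_deriv_single[OF distinct_upt[of 1 "Suc n"], of m d a] unfolding mixed_deriv_def s by blast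
  have "m' \<in> coords n" using single by (auto simp: in_coords_iff m'(1))
  then have "eval_at p (mixed_deriv n d (single m a)) =
      of_nat (\<Prod>i\<in>{1..n}. fact (lookup d i) * (lookup m i choose lookup d i)) * a *
      (\<Prod>i\<in>{1..n}. lookup p i ^ lookup m' i)"
    unfolding m'(2) by (rule eval_at_single)
  also have "(\<Prod>i\<in>{1..n}. lookup p i ^ lookup m' i) = (\<Prod>i\<in>{1..n}. lookup p i ^ (lookup m i - lookup d i))"
    by (rule prod.cong) (auto simp: m'(1))
  finally show ?case
    by (simp add: taylor_single coeff_shift_power of_nat_prod prod.distrib algebra_simps del: of_nat_fact)
qed (simp add: mixed_deriv_add eval_at_add taylor_add algebra_simps)

text \<open>Exactly the condition that no factorial in the functionals vanishes in k. It passes to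
  slices and levels, as the recursion requires.\<close>

definition char_admissible :: "nat \<Rightarrow> 'a::field mult_points \<Rightarrow> bool" where
  "char_admissible n H \<longleftrightarrow>
     CHAR('a) = 0 \<or> (\<forall>(p, D)\<in>H. \<forall>d\<in>D. \<forall>i\<in>{1..n}. lookup d i < CHAR('a))"

lemma of_nat_fact_nonzero:
  assumes "CHAR('a::field) = 0 \<or> k < CHAR('a)"
  shows "of_nat (fact k) \<noteq> (0 :: 'a)"
  using assms
proof (induction k)
  case (Suc k)
  have "of_nat (Suc k) \<noteq> (0 :: 'a)"
    unfolding of_nat_eq_0_iff_char_dvd using Suc.prems by (auto dest: dvd_imp_le)
  moreover have "of_nat (fact k) \<noteq> (0 :: 'a)" using Suc by auto
  ultimately show ?case by (simp only: fact_Suc of_nat_id of_nat_mult mult_eq_0_iff) simp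
qed simp

lemma vanishing_ideal_iff:
  assumes "char_admissible n H"
  shows "f \<in> vanishing_ideal n H \<longleftrightarrow> f \<in> polys n \<and> (\<forall>(p, D)\<in>H. \<forall>d\<in>D. taylor n p d f = 0)"
proof -
  have "eval_at p (mixed_deriv n d f) = 0 \<longleftrightarrow> taylor n p d f = 0"
    if "f \<in> polys n" "(p, D) \<in> H" "d \<in> D" for p D d
  proof -
    have "of_nat (fact (lookup d i)) \<noteq> (0 :: 'a)" if "i \<in> {1..n}" for i
      using assms \<open>(p, D) \<in> H\<close> \<open>d \<in> D\<close> that
      by (intro of_nat_fact_nonzero) (auto simp: char_admissible_def)
    then have "(\<Prod>i\<in>{1..n}. of_nat (fact (lookup d i))) \<noteq> (0 :: 'a)"
      by (simp add: prod_zero_iff del: of_nat_fact)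
    then show ?thesis using eval_mixed_deriv[OF that(1), of p d] by simp
  qed
  then show ?thesis unfolding vanishing_ideal_def by fastforce
qed

section \<open>Ideals of k[X_1,...,X_n]\<close>

definition poly_ideal :: "nat \<Rightarrow> 'a::field mpoly set \<Rightarrow> bool" where
  "poly_ideal n I \<longleftrightarrow> I \<subseteq> polys n \<and> 0 \<in> I \<and> (\<forall>f\<in>I. \<forall>g\<in>I. f + g \<in> I) \<and>
     (\<forall>q\<in>polys n. \<forall>f\<in>I. q * f \<in> I)"

lemma poly_ideal_add: "poly_ideal n I \<Longrightarrow> f \<in> I \<Longrightarrow> g \<in> I \<Longrightarrow> f + g \<in> I"
  by (simp add: poly_ideal_def)

lemma poly_ideal_mult: "poly_ideal n I \<Longrightarrow> q \<in> polys n \<Longrightarrow> f \<in> I \<Longrightarrow> q * f \<in> I"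
  by (simp add: poly_ideal_def)

lemma poly_ideal_polys: "poly_ideal n I \<Longrightarrow> f \<in> I \<Longrightarrow> f \<in> polys n"
  by (auto simp: poly_ideal_def)

lemma poly_ideal_diff:
  assumes "poly_ideal n I" "f \<in> I" "g \<in> I"
  shows "f - g \<in> I"
proof -
  have "Const (- 1) * g = - g"
    by (rule poly_mapping_eqI) (simp add: lookup_Const_mult)
  then have "- g \<in> I" using poly_ideal_mult[OF assms(1) polys_Const assms(3)] by metis
  then show ?thesis using poly_ideal_add[OF assms(1,2), of "- g"] by simp
qed

lemma poly_ideal_Int: "poly_ideal n I \<Longrightarrow> poly_ideal n J \<Longrightarrow> poly_ideal n (I \<inter> J)"
  by (auto simp: poly_ideal_def)

text \<open>Scalars and variables generate all multipliers, so for the vanishing ideal only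
  \<open>taylor_Var_mult\<close> has real content.\<close>

lemma poly_idealI:
  assumes "I \<subseteq> polys n" "0 \<in> I" "\<And>f g. f \<in> I \<Longrightarrow> g \<in> I \<Longrightarrow> f + g \<in> I"
    and c: "\<And>a f. f \<in> I \<Longrightarrow> Const a * f \<in> I"
    and v: "\<And>j f. j \<in> {1..n} \<Longrightarrow> f \<in> I \<Longrightarrow> Var j * f \<in> I"
  shows "poly_ideal n I"
proof -
  have "single m a * f \<in> I" if "m \<in> coords n" "f \<in> I" for m a f
    using that(1)
  proof (induction "\<Sum>i\<in>{1..n}. lookup m i" arbitrary: m rule: less_induct)
    case less
    show ?case
    proof (cases "m = 0")
      case True
      then show ?thesis using c[OF that(2), of a] by (simp add: Const_def)
    next
      case False
      then obtain i where i: "lookup m i \<noteq> 0" by (auto simp: poly_mapping_eq_iff fun_eq_iff)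
      then have i': "i \<in> {1..n}" using less.prems by (auto simp: in_coords_iff)
      have "(\<Sum>j\<in>{1..n}. lookup (m - single i 1) j) < (\<Sum>j\<in>{1..n}. lookup m j)"
        using i i' by (intro sum_strict_mono_ex1)
          (auto simp: lookup_minus lookup_single when_def intro!: bexI[of _ i])
      then have "single (m - single i 1) a * f \<in> I"
        using less coords_diff by blast
      then have "Var i * (single (m - single i 1) a * f) \<in> I" by (rule v[OF i'])
      moreover have "single i 1 + (m - single i 1) = m"
        using i by (intro poly_mapping_eqI) (auto simp: lookup_add lookup_minus lookup_single when_def)
      ultimately show ?thesis by (simp add: Var_def mult_single flip: mult.assoc)
    qed
  qed
  note s = this
  have "q * f \<in> I" if "q \<in> polys n" "f \<in> I" for q f
    using that(1)
    by (induction q rule: polys_induct) (use that(2) assms(3) s in \<open>auto simp: distrib_right\<close>)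
  then show ?thesis using assms by (auto simp: poly_ideal_def)
qed

lemma vanishing_ideal_ideal:
  assumes "char_admissible n H" "\<And>p D. (p, D) \<in> H \<Longrightarrow> lower_set n D"
  shows "poly_ideal n (vanishing_ideal n H)"
proof (rule poly_idealI)
  fix j f assume j: "j \<in> {1..n}" and f: "f \<in> vanishing_ideal n H"
  have "taylor n p d (Var j * f) = 0" if "(p, D) \<in> H" "d \<in> D" for p D d
    using that f j assms(2)[OF that(1)]
    by (fastforce simp: taylor_Var_mult vanishing_ideal_iff[OF assms(1)] lower_set_def)
  then show "Var j * f \<in> vanishing_ideal n H"
    using f j by (auto simp: vanishing_ideal_iff[OF assms(1)] intro!: polys_mult polys_Var)
next
  fix f g assume "f \<in> vanishing_ideal n H" "g \<in> vanishing_ideal n H"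
  then show "f + g \<in> vanishing_ideal n H"
    by (fastforce simp: vanishing_ideal_iff[OF assms(1)] taylor_add polys_add)
qed (auto simp: vanishing_ideal_iff[OF assms(1)] taylor_Const_mult polys_mult)

section \<open>Expansion in powers of the last variable minus a constant\<close>

text \<open>The coefficient of \<open>(X\<^sub>n - c)^i\<close>, a polynomial in the remaining variables.\<close>

definition tau :: "nat \<Rightarrow> 'a::field \<Rightarrow> nat \<Rightarrow> 'a mpoly \<Rightarrow> 'a mpoly" where
  "tau n c i f = (\<Sum>m\<in>keys f. single (proj_hat n m) (lookup f m * coeff ([:c, 1:] ^ lookup m n) i))"

lemma tau_add: "tau n c i (f + g) = tau n c i f + tau n c i g"
  unfolding tau_def by (rule sum_keys_add) (auto simp: algebra_simps single_add)

lemma tau_single: "tau n c i (single m a) = single (proj_hat n m) (a * coeff ([:c, 1:] ^ lookup m n) i)"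
  by (simp add: tau_def)

lemma tau_polys: "f \<in> polys n \<Longrightarrow> tau n c i f \<in> polys (n - 1)"
  by (induction f rule: polys_induct)
    (simp_all add: tau_single tau_add polys_single polys_add coords_hat del: One_nat_def)

lemma taylor_tau:
  assumes "1 \<le> n" "f \<in> polys n"
  shows "taylor n p d f =
    taylor (n - 1) (proj_hat n p) (proj_hat n d) (tau n (lookup p n) (lookup d n) f)"
  using assms(2)
proof (induction f rule: polys_induct)
  case (single m a)
  have s: "{1..n} = insert n {1..n - 1}" using assms(1) by auto
  have "(\<Prod>i\<in>{1..n - 1}. coeff ([:lookup (proj_hat n p) i, 1:] ^ lookup (proj_hat n m) i) (lookup (proj_hat n d) i))
      = (\<Prod>i\<in>{1..n - 1}. coeff ([:lookup p i, 1:] ^ lookup m i) (lookup d i))"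
    by (rule prod.cong) (use assms(1) in \<open>auto simp: lookup_hat\<close>)
  then show ?case
    using assms(1) unfolding tau_single taylor_single s by (simp add: algebra_simps)
qed (simp add: taylor_add tau_add)

lemma pcompose_monom: "pcompose (monom a k) q = smult a (q ^ k)"
  by (induction k) (simp_all add: monom_0 monom_Suc pcompose_pCons)

text \<open>Substituting X_n + c for X_n turns powers of X_n - c into powers of X_n. The value 0 at
  nonzero last entry reflects that X_n no longer occurs.\<close>

lemma lookup_tau:
  "lookup (tau n c i f) d = (if lookup d n = 0 then coeff (pcompose (colpoly n f d) [:c, 1:]) i else 0)"
proof (induction f rule: mpoly_induct)
  case (single m a)
  have "proj_hat n m = d \<longleftrightarrow> proj_hat n m = proj_hat n d \<and> lookup d n = 0"
  proof -
    have "proj_hat n d = d \<longleftrightarrow> lookup d n = 0"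
      by (auto simp: poly_mapping_eq_iff fun_eq_iff lookup_hat)
    then show ?thesis by (metis hat_hat)
  qed
  then show ?case
    by (auto simp: tau_single lookup_single when_def colpoly_single pcompose_monom)
qed (simp add: tau_add colpoly_add pcompose_add lookup_add)

lemma pcompose_linear_power: "pcompose ([:- c, 1:] ^ i) [:c, 1:] = monom (1 :: 'a :: field) i"
proof (induction i)
  case (Suc i)
  have "pcompose [:- c, 1:] [:c, 1:] = [:0, 1 :: 'a:]" by (simp add: pcompose_pCons)
  then show ?case using Suc unfolding power_Suc pcompose_mult by (simp add: monom_Suc)
qed (simp add: pcompose_1)

lemma tau_mult_power:
  "tau n c j (univ_poly n ([:- c, 1:] ^ i) * f) = (if j < i then 0 else tau n c (j - i) f)"
  by (rule poly_mapping_eqI)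
    (simp add: lookup_tau colpoly_univ pcompose_mult pcompose_linear_power coeff_monom_mult)

lemma colpoly_pred:
  assumes "1 \<le> n" "g \<in> polys (n - 1)"
  shows "colpoly n g d = [:lookup g (proj_hat n d):]"
proof (rule poly_eqI)
  fix j
  show "coeff (colpoly n g d) j = coeff [:lookup g (proj_hat n d):] j"
  proof (cases j)
    case 0
    have "embed_at n 0 d = proj_hat n d" by (rule poly_mapping_eqI) (simp add: lookup_hat lookup_embed)
    then show ?thesis using 0 by (simp add: coeff_colpoly)
  next
    case (Suc k)
    have "embed_at n j d \<notin> coords (n - 1)"
      using lookup_pred[OF assms(1), of "embed_at n j d"] Suc by (auto simp: lookup_embed)
    then show ?thesis using Suc assms(2) by (auto simp: coeff_colpoly polys_iff)
  qed
qed

lemma tau_pred: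
  assumes "1 \<le> n" "g \<in> polys (n - 1)"
  shows "tau n c j g = (if j = 0 then g else 0)"
proof (rule poly_mapping_eqI)
  fix d
  have "lookup g d = 0" if "lookup d n \<noteq> 0"
    using that assms lookup_pred[OF assms(1), of d] by (auto simp: polys_iff)
  moreover have "proj_hat n d = d" if "lookup d n = 0"
    using that by (auto simp: poly_mapping_eq_iff fun_eq_iff lookup_hat)
  ultimately show "lookup (tau n c j g) d = lookup (if j = 0 then g else 0) d"
    by (cases j) (auto simp: lookup_tau colpoly_pred[OF assms])
qed

text \<open>Translation by c moves the order of vanishing at c to the order of vanishing at 0, which
  is read off the coefficients.\<close>

lemma linear_power_dvd_iff:
  "[:- c, 1:] ^ v dvd u \<longleftrightarrow> (\<forall>j<v. coeff (pcompose u [:c, 1 :: 'a :: field:]) j = 0)"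
proof
  assume "[:- c, 1:] ^ v dvd u"
  then obtain h where "u = [:- c, 1:] ^ v * h" by (rule dvdE)
  then show "\<forall>j<v. coeff (pcompose u [:c, 1:]) j = 0"
    by (simp add: pcompose_mult pcompose_linear_power coeff_monom_mult)
next
  assume "\<forall>j<v. coeff (pcompose u [:c, 1:]) j = 0"
  then have "monom 1 v dvd pcompose u [:c, 1:]" by (simp add: monom_1_dvd_iff')
  then obtain h where h: "pcompose u [:c, 1:] = monom 1 v * h" by (rule dvdE)
  have "u = pcompose (pcompose u [:c, 1:]) [:- c, 1:]"
    by (simp add: pcompose_pCons flip: pcompose_assoc)
  also have "\<dots> = [:- c, 1:] ^ v * pcompose h [:- c, 1:]"
    by (simp add: h pcompose_mult pcompose_monom)
  finally show "[:- c, 1:] ^ v dvd u" by (metis dvd_triv_left)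
qed

section \<open>A certificate for reduced bases\<close>

text \<open>\<open>D\<close> contains no leading monomial, while every minimal exponent outside
  \<open>D\<close> is one; as leading monomials are closed under multiples, this pins them down
  completely. The tail condition is what reducedness needs.\<close>

definition standard_pair :: "nat \<Rightarrow> 'a::field mpoly set \<Rightarrow> exps set \<Rightarrow> 'a mpoly set \<Rightarrow> bool" where
  "standard_pair n I D G \<longleftrightarrow> finite D \<and> lower_set n D \<and> (\<forall>f\<in>I. f \<noteq> 0 \<longrightarrow> lm f \<notin> D) \<and>
     G \<subseteq> I \<and> lm ` G = limiting_set n D \<and> (\<forall>g\<in>G. g \<noteq> 0 \<and> lc g = 1 \<and> keys g - {lm g} \<subseteq> D)"

lemma standard_pairD:
  assumes "standard_pair n I D G"
  shows "finite D" "lower_set n D" "f \<in> I \<Longrightarrow> f \<noteq> 0 \<Longrightarrow> lm f \<notin> D" "G \<subseteq> I"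
    "lm ` G = limiting_set n D" "g \<in> G \<Longrightarrow> g \<noteq> 0" "g \<in> G \<Longrightarrow> lc g = 1"
    "g \<in> G \<Longrightarrow> m \<in> keys g \<Longrightarrow> m \<noteq> lm g \<Longrightarrow> m \<in> D"
  using assms unfolding standard_pair_def by blast+

lemma lower_set_coords: "lower_set n D \<Longrightarrow> d \<in> D \<Longrightarrow> d \<in> coords n"
  by (auto simp: lower_set_def)

lemma standard_pair_multiple:
  assumes I: "poly_ideal n I" and P: "standard_pair n I D G" and d: "d \<in> coords n" "d \<notin> D"
  shows "\<exists>g\<in>G. \<exists>u\<in>coords n. d = lm g + u"
  using limiting_set_divides[OF d] standard_pairD(5)[OF P] by (metis imageE)

text \<open>An exponent outside \<open>D\<close> is a multiple of some \<open>lm g\<close>, hence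
  the leading monomial of a multiple of \<open>g\<close>.\<close>

lemma standard_pair_quotient_basis:
  assumes I: "poly_ideal n I" and P: "standard_pair n I D G"
  shows "D = quotient_basis n I"
proof (intro equalityI subsetI)
  fix d assume d: "d \<in> D"
  then show "d \<in> quotient_basis n I"
    using standard_pairD(3)[OF P] lower_set_coords[OF standard_pairD(2)[OF P]] by (auto simp: quotient_basis_def)
next
  fix d assume d: "d \<in> quotient_basis n I"
  show "d \<in> D"
  proof (rule ccontr)
    assume "d \<notin> D"
    moreover have "d \<in> coords n" using d by (simp add: quotient_basis_def)
    ultimately obtain g u where g: "g \<in> G" "u \<in> coords n" "d = lm g + u"
      using standard_pair_multiple[OF I P] by blast
    note l = lm_mult_single[OF standard_pairD(6)[OF P g(1)], of 1 u]
    have "g \<in> I" using standard_pairD(4)[OF P] g(1) by blast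
    then have "g * single u 1 \<in> I"
      using poly_ideal_mult[OF I polys_single[OF g(2)]] by (simp add: mult.commute)
    then show False using d l g(3) by (auto simp: quotient_basis_def)
  qed
qed

text \<open>For two monic elements with equal leading monomial the leading terms cancel, so their
  difference would have its leading monomial among the tails, that is in \<open>D\<close>.\<close>

lemma standard_pair_inj:
  assumes I: "poly_ideal n I" and P: "standard_pair n I D G"
  shows "inj_on lm G"
proof (rule inj_onI, rule ccontr)
  fix g h assume gh: "g \<in> G" "h \<in> G" "lm g = lm h" "g \<noteq> h"
  then have "g - h \<in> I" using poly_ideal_diff[OF I] standard_pairD(4)[OF P] by blast
  moreover have "g - h \<noteq> 0" using gh by simp
  ultimately have nD: "lm (g - h) \<notin> D" by (rule standard_pairD(3)[OF P])
  have k: "lookup g (lm (g - h)) \<noteq> lookup h (lm (g - h))"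
    using lm_in_keys[OF \<open>g - h \<noteq> 0\<close>] by (auto simp: in_keys_iff lookup_minus)
  then have "lm (g - h) \<noteq> lm g" using standard_pairD(7)[OF P gh(1)] standard_pairD(7)[OF P gh(2)] gh(3) by (auto simp: lc_def)
  moreover have "lm (g - h) \<in> keys g \<or> lm (g - h) \<in> keys h" using k by (auto simp: in_keys_iff)
  ultimately show False using nD gh standard_pairD(8)[OF P] by metis
qed

lemma ideal_gen_ideal:
  assumes "S \<subseteq> polys n"
  shows "poly_ideal n (ideal_gen n S)"
  unfolding poly_ideal_def
proof (intro conjI ballI)
  show "ideal_gen n S \<subseteq> polys n"
  proof
    fix f assume "f \<in> ideal_gen n S"
    then obtain F q where F: "f = (\<Sum>s\<in>F. q s * s)" "finite F" "F \<subseteq> S" "q ` F \<subseteq> polys n"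
      by (auto simp: ideal_gen_def)
    show "f \<in> polys n" unfolding F(1) using F(2,3,4)
    proof (induction F rule: finite_induct)
      case (insert x F)
      then show ?case using assms by (auto intro!: polys_add polys_mult)
    qed simp
  qed
  show "0 \<in> ideal_gen n S" unfolding ideal_gen_def by (auto intro!: exI[of _ "{}"])
next
  fix f g assume "f \<in> ideal_gen n S" "g \<in> ideal_gen n S"
  then obtain F q F' q' where F: "f = (\<Sum>s\<in>F. q s * s)" "finite F" "F \<subseteq> S" "q ` F \<subseteq> polys n"
    and F': "g = (\<Sum>s\<in>F'. q' s * s)" "finite F'" "F' \<subseteq> S" "q' ` F' \<subseteq> polys n"
    unfolding ideal_gen_def by blast
  \<comment> \<open>The two sums run over different generators; extending both coefficient families
    by 0 brings them to a common index set.\<close>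
  define r where "r = (\<lambda>s. (if s \<in> F then q s else 0) + (if s \<in> F' then q' s else 0))"
  have "f = (\<Sum>s\<in>F \<union> F'. (if s \<in> F then q s else 0) * s)"
    unfolding F(1) using F(2) F'(2) by (intro sum.mono_neutral_cong_left) auto
  moreover have "g = (\<Sum>s\<in>F \<union> F'. (if s \<in> F' then q' s else 0) * s)"
    unfolding F'(1) using F(2) F'(2) by (intro sum.mono_neutral_cong_left) auto
  ultimately have "f + g = (\<Sum>s\<in>F \<union> F'. r s * s)"
    by (simp add: r_def distrib_right sum.distrib)
  moreover have "r ` (F \<union> F') \<subseteq> polys n"
    using F(4) F'(4) unfolding image_subset_iff by (auto simp: r_def intro!: polys_add)
  ultimately show "f + g \<in> ideal_gen n S"
    unfolding ideal_gen_def using F(2,3) F'(2,3)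
    by (intro CollectI exI[of _ "F \<union> F'"] exI[of _ r]) auto
next
  fix p f :: "'a mpoly" assume p: "p \<in> polys n" and "f \<in> ideal_gen n S"
  then obtain F q where F: "f = (\<Sum>s\<in>F. q s * s)" "finite F" "F \<subseteq> S" "q ` F \<subseteq> polys n"
    by (auto simp: ideal_gen_def)
  have "p * f = (\<Sum>s\<in>F. (p * q s) * s)" by (simp add: F(1) sum_distrib_left mult.assoc)
  moreover have "(\<lambda>s. p * q s) ` F \<subseteq> polys n" using F(4) p by (auto intro!: polys_mult)
  ultimately show "p * f \<in> ideal_gen n S"
    unfolding ideal_gen_def using F(2,3)
    by (intro CollectI exI[of _ F] exI[of _ "\<lambda>s. p * q s"]) auto
qed

lemma ideal_gen_superset: "S \<subseteq> ideal_gen n S"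
proof
  fix s assume "s \<in> S"
  moreover have "s = (\<Sum>s\<in>{s}. 1 * s)" by simp
  ultimately show "s \<in> ideal_gen n S"
    unfolding ideal_gen_def by (intro CollectI exI[of _ "{s}"] exI[of _ "\<lambda>_. 1"]) auto
qed

lemma ideal_gen_least:
  assumes "poly_ideal n J" "S \<subseteq> J"
  shows "ideal_gen n S \<subseteq> J"
proof
  fix f assume "f \<in> ideal_gen n S"
  then obtain F q where F: "f = (\<Sum>s\<in>F. q s * s)" "finite F" "F \<subseteq> S" "q ` F \<subseteq> polys n"
    by (auto simp: ideal_gen_def)
  show "f \<in> J" unfolding F(1) using F(2,3,4)
  proof (induction F rule: finite_induct)
    case empty
    then show ?case using assms by (simp add: poly_ideal_def)
  next
    case (insert x F)
    then show ?case using assms by (auto intro!: poly_ideal_add[OF assms(1)] poly_ideal_mult[OF assms(1)])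
  qed
qed

text \<open>Cancellation only removes monomials, so each one in the sum already occurs in a single
  product with a term.\<close>

lemma keys_ideal_gen_lt:
  assumes "f \<in> ideal_gen n (lt ` A)" "m \<in> keys f"
  shows "\<exists>a\<in>A. \<exists>u. m = lm a + u"
proof -
  obtain F q where F: "f = (\<Sum>s\<in>F. q s * s)" "finite F" "F \<subseteq> lt ` A"
    using assms(1) by (auto simp: ideal_gen_def)
  have "\<exists>s\<in>F. lookup (q s * s) m \<noteq> 0"
    using assms(2) unfolding F(1) in_keys_iff lookup_sum by (meson sum.not_neutral_contains_not_neutral)
  then obtain s where s: "s \<in> F" "m \<in> keys (q s * s)" by (auto simp: in_keys_iff)
  then obtain a where a: "a \<in> A" "s = single (lm a) (lc a)" using F(3) by (auto simp: lt_def)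
  have "\<exists>b. m = b + lm a"
    using s(2) keys_mult[of "q s" s] unfolding a(2) by (auto split: if_splits)
  then show ?thesis using a(1) by (auto simp: add.commute)
qed

text \<open>A leading monomial of the ideal is outside \<open>D\<close>, hence divisible by a
  limiting exponent. For reducedness, leading monomials form an antichain, and a tail monomial in
  the lower set \<open>D\<close> has no divisor outside \<open>D\<close>.\<close>

theorem standard_pair_reduced_Groebner_basis:
  assumes I: "poly_ideal n I" and P: "standard_pair n I D G"
  shows "is_reduced_Groebner_basis n I G"
proof -
  have lt_polys: "lt f \<in> polys n" if "f \<in> I - {0}" for f
    using that poly_ideal_polys[OF I, of f] lm_in_keys[of f]
    by (auto simp: lt_def polys_def)
  have GI: "G \<subseteq> I" and G0: "G - {0} = G" using standard_pairD(4,6)[OF P] by auto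
  have fin: "finite G"
    using finite_limiting_set[OF standard_pairD(1)[OF P], of n] standard_pair_inj[OF I P]
    by (metis standard_pairD(5)[OF P] finite_image_iff)
  have iG: "poly_ideal n (ideal_gen n (lt ` G))"
    by (rule ideal_gen_ideal) (use lt_polys GI G0 in blast)
  have iI: "poly_ideal n (ideal_gen n (lt ` (I - {0})))"
    by (rule ideal_gen_ideal) (use lt_polys in blast)
  have "lt f \<in> ideal_gen n (lt ` G)" if f: "f \<in> I - {0}" for f
  proof -
    have "lm f \<in> coords n" using f poly_ideal_polys[OF I] lm_in_keys polys_keys by blast
    then obtain g u where g: "g \<in> G" "u \<in> coords n" "lm f = lm g + u"
      using standard_pair_multiple[OF I P] standard_pairD(3)[OF P] f by blast
    have "lt f = single u (lc f) * lt g"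
      using standard_pairD(7)[OF P g(1)] by (simp add: lt_def mult_single g(3) add.commute)
    then show ?thesis
      using poly_ideal_mult[OF iG polys_single[OF g(2)]] ideal_gen_superset[of "lt ` G" n] g(1) by auto
  qed
  then have "ideal_gen n (lt ` (I - {0})) \<subseteq> ideal_gen n (lt ` G)"
    by (intro ideal_gen_least[OF iG]) blast
  moreover have "ideal_gen n (lt ` G) \<subseteq> ideal_gen n (lt ` (I - {0}))"
    using ideal_gen_superset[of "lt ` (I - {0})" n] GI G0 by (intro ideal_gen_least[OF iI]) blast
  ultimately have "is_Groebner_basis n I G"
    using fin GI by (simp add: is_Groebner_basis_def G0)
  moreover have "single m 1 \<notin> ideal_gen n (lt ` (G - {g}))" if g: "g \<in> G" "m \<in> keys g" for g m
  proof
    assume "single m 1 \<in> ideal_gen n (lt ` (G - {g}))"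
    then obtain a u where a: "a \<in> G" "a \<noteq> g" "m = lm a + u"
      using keys_ideal_gen_lt[of "single m 1" n "G - {g}" m] by auto
    have aE: "lm a \<in> limiting_set n D" and gE: "lm g \<in> limiting_set n D"
      using standard_pairD(5)[OF P] a(1) g(1) by auto
    show False
    proof (cases "m = lm g")
      case True
      then have "u = 0" using limiting_set_antichain[OF standard_pairD(2)[OF P] aE] gE a(3) by metis
      then show False using inj_onD[OF standard_pair_inj[OF I P]] a g(1) True by auto
    next
      case False
      then have "m \<in> D" using standard_pairD(8)[OF P] g by blast
      then have "lm a \<in> D" using lower_set_subtract[OF standard_pairD(2)[OF P]] a(3) by blast
      then show False using aE by (simp add: limiting_set_def)
    qed
  qed
  ultimately show ?thesis
    using standard_pairD(6,7)[OF P] by (auto simp: is_reduced_Groebner_basis_def)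
qed

text \<open>The condition on the keys says that \<open>colpoly n f d\<close> is the leading coefficient of \<open>f\<close> over \<open>k[X\<^sub>n]\<close>, or zero.\<close>

definition col_dvd :: "nat \<Rightarrow> 'a::field mpoly set \<Rightarrow> (exps \<Rightarrow> 'a poly) \<Rightarrow> bool" where
  "col_dvd n I q \<longleftrightarrow> (\<forall>f\<in>I. \<forall>d\<in>coords n.
     (\<forall>m\<in>keys f. proj_hat n m \<le> proj_hat n d) \<longrightarrow> q d dvd colpoly n f d)"

lemma col_dvdD:
  "col_dvd n I q \<Longrightarrow> f \<in> I \<Longrightarrow> d \<in> coords n \<Longrightarrow> (\<And>m. m \<in> keys f \<Longrightarrow> proj_hat n m \<le> proj_hat n d) \<Longrightarrow>
    q d dvd colpoly n f d"
  unfolding col_dvd_def by blast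

text \<open>The last entry of \<open>lm f\<close> is the degree of the leading coefficient over
  k[X_n]; a divisor whose degree is the column height pushes it beyond the column.\<close>

lemma col_dvd_lm:
  assumes "1 \<le> n" "poly_ideal n I" "finite D" "lower_set n D" "col_dvd n I q"
    and deg: "\<And>d. d \<in> coords n \<Longrightarrow> degree (q d) = height n D d"
    and f: "f \<in> I" "f \<noteq> 0"
  shows "lm f \<notin> D"
proof -
  have fp: "f \<in> polys n" using f assms(2) poly_ideal_polys by blast
  have co: "lm f \<in> coords n" using lm_in_keys[OF f(2)] polys_keys[OF fp] by blast
  note c = colpoly_lm[OF assms(1) fp f(2)]
  have "q (lm f) dvd colpoly n f (lm f)" by (rule col_dvdD[OF assms(5) f(1) co c(3)])
  moreover have "colpoly n f (lm f) \<noteq> 0" using c(2) lc_nonzero[OF f(2)] by auto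
  ultimately have "height n D (lm f) \<le> lookup (lm f) n"
    using dvd_imp_degree_le c(1) deg[OF co] by metis
  then show ?thesis by (simp add: in_iff_height[OF assms(1,3,4)])
qed

section \<open>Points with a common last coordinate\<close>

lemma univ_poly_mult_pred:
  fixes c :: "'a::field" and i :: nat
  assumes n: "1 \<le> n" and g: "g \<in> polys (n - 1)" "g \<noteq> 0" "lc g = 1"
  defines "f \<equiv> univ_poly n ([:- c, 1:] ^ i) * g"
  shows "f \<in> polys n" "f \<noteq> 0" "lm f = embed_at n i (lm g)" "lc f = 1"
    "m \<in> keys f \<Longrightarrow> lookup m n \<le> i \<and> proj_hat n m \<in> keys g"
proof -
  have col: "colpoly n f d = [:- c, 1:] ^ i * [:lookup g (proj_hat n d):]" for d
    by (simp add: f_def colpoly_univ colpoly_pred[OF n g(1)])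
  show fp: "f \<in> polys n" unfolding f_def by (rule polys_mult[OF polys_univ[OF n] polys_pred[OF g(1)]])
  have co: "lm g \<in> coords (n - 1)" using lm_in_keys[OF g(2)] polys_keys[OF g(1)] by blast
  have k: "lookup m n \<le> i \<and> proj_hat n m \<in> keys g" if "m \<in> keys f" for m
  proof -
    have nz: "coeff (colpoly n f m) (lookup m n) \<noteq> 0"
      using that unfolding coeff_colpoly embed_lookup by (simp add: in_keys_iff)
    then have "lookup m n \<le> degree (colpoly n f m)" by (rule le_degree)
    also have "\<dots> \<le> i"
      unfolding col using degree_mult_le[of "[:- c, 1:] ^ i" "[:lookup g (proj_hat n m):]"]
      by (simp add: degree_linear_power)
    finally show ?thesis using nz unfolding col by (auto simp: in_keys_iff)
  qed
  then show "m \<in> keys f \<Longrightarrow> lookup m n \<le> i \<and> proj_hat n m \<in> keys g" .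
  have h: "proj_hat n (lm g) = lm g" using hat_pred[OF n co] .
  have c1: "colpoly n f (lm g) = [:- c, 1:] ^ i"
    using g(3) by (simp add: col h lc_def)
  have le: "proj_hat n m \<le> proj_hat n (lm g)" if "m \<in> keys f" for m
    using k[OF that] keys_le_lm h by metis
  have nz: "colpoly n f (lm g) \<noteq> 0" by (simp add: c1)
  note l = lm_by_colpoly[OF coords_pred[OF co] n fp le nz]
  show "f \<noteq> 0" "lm f = embed_at n i (lm g)" "lc f = 1"
    using l by (simp_all add: c1 degree_linear_power coeff_linear_power)
qed

section \<open>Splitting the conditions into slices\<close>

context
  fixes n :: nat and H :: "'a::field mult_points" and c :: 'a
  assumes n: "1 \<le> n" and H: "points_with_mult n H" and ch: "char_admissible n H"
    and c: "\<And>p D. (p, D) \<in> H \<Longrightarrow> proj n p = c"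
begin

lemma max_last_ge: "(p, D) \<in> H \<Longrightarrow> d \<in> D \<Longrightarrow> lookup d n \<le> max_last n H"
  unfolding max_last_def using H
  by (intro Max_ge) (fastforce simp: points_with_mult_def proj_def)+

lemma max_last_attained: "\<exists>p D d. (p, D) \<in> H \<and> d \<in> D \<and> lookup d n = max_last n H"
proof -
  have "max_last n H \<in> (\<Union>(p, D)\<in>H. proj n ` D)"
    unfolding max_last_def using H by (intro Max_in) (fastforce simp: points_with_mult_def)+
  then show ?thesis by (fastforce simp: proj_def)
qed

lemma H_props:
  assumes "(p, D) \<in> H"
  shows "p \<in> coords n" "finite D" "D \<noteq> {}" "lower_set n D"
  using H assms by (auto simp: points_with_mult_def)

lemma embed_below: "(p, D) \<in> H \<Longrightarrow> d \<in> D \<Longrightarrow> i \<le> lookup d n \<Longrightarrow> embed_at n i d \<in> D"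
  using lower_set_column[OF n H_props(4), of p D "lookup d n" d i] by (simp add: embed_lookup)

lemma slice_points_with_mult:
  assumes "i \<le> max_last n H"
  shows "points_with_mult (n - 1) (slice n i H)"
  unfolding points_with_mult_def
proof (intro conjI)
  have fin: "finite H" using H by (simp add: points_with_mult_def)
  have "slice n i H \<subseteq> (\<lambda>(p, D). (proj_hat n p, proj_hat n ` {d \<in> D. proj n d = i})) ` H"
    by (auto simp: slice_def)
  then show "finite (slice n i H)" using fin finite_subset by blast
  \<comment> \<open>Below an element of maximal last coordinate the whole column belongs to the same
    lower set, so no slice up to that height is empty.\<close>
  obtain p D d where pd: "(p, D) \<in> H" "d \<in> D" "lookup d n = max_last n H"
    using max_last_attained by blast
  then have "embed_at n i d \<in> D" using embed_below assms by simp
  then have "{d \<in> D. proj n d = i} \<noteq> {}" using proj_embed by blast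
  then show "slice n i H \<noteq> {}" using pd(1) by (auto simp: slice_def)
  \<comment> \<open>Points stay distinct after dropping the last coordinate because they all share
    it.\<close>
  have "p = p'" if "(p, D) \<in> H" "(p', D') \<in> H" "proj_hat n p = proj_hat n p'" for p D p' D'
    using c[OF that(1)] c[OF that(2)] that(3) by (metis embed_proj embed_eq_iff)
  moreover have "D = D'" if "(p, D) \<in> H" "(p, D') \<in> H" for p D D'
    using H that inj_onD[of fst H "(p, D)" "(p, D')"] by (auto simp: points_with_mult_def)
  ultimately have "D = D'" if "(p, D) \<in> H" "(p', D') \<in> H" "proj_hat n p = proj_hat n p'" for p D p' D'
    using that by blast
  note eq = this
  show "inj_on fst (slice n i H)"
  proof (rule inj_onI)
    fix x y assume "x \<in> slice n i H" "y \<in> slice n i H" and xy: "fst x = fst y"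
    then obtain p D p' D' where "(p, D) \<in> H" "(p', D') \<in> H"
      "x = (proj_hat n p, proj_hat n ` {d \<in> D. proj n d = i})"
      "y = (proj_hat n p', proj_hat n ` {d \<in> D'. proj n d = i})"
      unfolding slice_def by blast
    moreover from this have "D = D'" using xy eq[of p D p' D'] by simp
    ultimately show "x = y" using xy by simp
  qed
  have "lower_set (n - 1) (proj_hat n ` {d \<in> D. proj n d = i})" if pD: "(p, D) \<in> H" for p D
    unfolding lower_set_def
  proof (intro conjI ballI impI)
    note low = H_props(4)[OF pD]
    show "proj_hat n ` {d \<in> D. proj n d = i} \<subseteq> coords (n - 1)"
      using lower_set_coords[OF low] by (auto simp del: One_nat_def intro!: coords_hat)
    fix x j assume x: "x \<in> proj_hat n ` {d \<in> D. proj n d = i}" and j: "j \<in> {1..n - 1}" "lookup x j \<noteq> 0"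
    then obtain d where d: "d \<in> D" "proj n d = i" "x = proj_hat n d" by blast
    have "d - single j 1 \<in> D" using low d j by (auto simp: lower_set_def lookup_hat split: if_splits)
    moreover have "proj n (d - single j 1) = i" using d j n by (auto simp: proj_def lookup_minus lookup_single when_def)
    moreover have "x - single j 1 = proj_hat n (d - single j 1)"
      using j by (intro poly_mapping_eqI) (auto simp: d lookup_hat lookup_minus lookup_single when_def)
    ultimately show "x - single j 1 \<in> proj_hat n ` {d \<in> D. proj n d = i}" by blast
  qed
  then show "\<forall>(p, D)\<in>slice n i H. p \<in> coords (n - 1) \<and> finite D \<and> D \<noteq> {} \<and> lower_set (n - 1) D"
    using coords_hat H_props(1,2) by (fastforce simp: slice_def)
qed

lemma slice_char_admissible: "char_admissible (n - 1) (slice n i H)"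
proof (cases "CHAR('a) = 0")
  case False
  have "lookup (proj_hat n d) j < CHAR('a)" if "(p, D) \<in> H" "d \<in> D" "j \<in> {1..n - 1}" for p D d j
    using ch False that by (fastforce simp: char_admissible_def lookup_hat)
  then show ?thesis by (auto simp: char_admissible_def slice_def)
qed (simp add: char_admissible_def)

lemma slice_ideal: "i \<le> max_last n H \<Longrightarrow> poly_ideal (n - 1) (vanishing_ideal (n - 1) (slice n i H))"
  by (rule vanishing_ideal_ideal[OF slice_char_admissible])
    (use slice_points_with_mult in \<open>auto simp: points_with_mult_def\<close>)

lemma vanishing_ideal_slice:
  "f \<in> vanishing_ideal n H \<longleftrightarrow>
    f \<in> polys n \<and> (\<forall>i\<le>max_last n H. tau n c i f \<in> vanishing_ideal (n - 1) (slice n i H))"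
proof (intro iffI conjI allI impI)
  assume f: "f \<in> vanishing_ideal n H"
  then show fp: "f \<in> polys n" by (simp add: vanishing_ideal_def)
  fix i
  have "taylor (n - 1) (proj_hat n p) (proj_hat n d) (tau n c i f) = 0"
    if "(p, D) \<in> H" "d \<in> D" "proj n d = i" for p D d
  proof -
    have "taylor n p d f = 0" using f that vanishing_ideal_iff[OF ch] by fastforce
    then show ?thesis using taylor_tau[OF n fp, of p d] c[OF that(1)] that(3) by (simp add: proj_def)
  qed
  then show "tau n c i f \<in> vanishing_ideal (n - 1) (slice n i H)"
    unfolding vanishing_ideal_iff[OF slice_char_admissible] using tau_polys[OF fp]
    by (fastforce simp: slice_def)
next
  assume f: "f \<in> polys n \<and> (\<forall>i\<le>max_last n H. tau n c i f \<in> vanishing_ideal (n - 1) (slice n i H))"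
  have "taylor n p d f = 0" if pd: "(p, D) \<in> H" "d \<in> D" for p D d
  proof -
    have "tau n c (lookup d n) f \<in> vanishing_ideal (n - 1) (slice n (lookup d n) H)"
      using f max_last_ge[OF pd] by blast
    moreover have "(proj_hat n p, proj_hat n ` {d' \<in> D. proj n d' = lookup d n}) \<in> slice n (lookup d n) H"
      using pd by (auto simp: slice_def proj_def)
    ultimately have "taylor (n - 1) (proj_hat n p) (proj_hat n d) (tau n c (lookup d n) f) = 0"
      unfolding vanishing_ideal_iff[OF slice_char_admissible] using pd(2) by (fastforce simp: proj_def)
    then show ?thesis using taylor_tau[OF n conjunct1[OF f], of p d] c[OF pd(1)] by (simp add: proj_def)
  qed
  then show "f \<in> vanishing_ideal n H" using f by (auto simp: vanishing_ideal_iff[OF ch])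
qed

text \<open>Columns are closed downwards, so higher slices impose fewer conditions.\<close>

lemma vanishing_ideal_slice_mono:
  assumes "i \<le> j"
  shows "vanishing_ideal (n - 1) (slice n i H) \<subseteq> vanishing_ideal (n - 1) (slice n j H)"
proof
  fix f assume f: "f \<in> vanishing_ideal (n - 1) (slice n i H)"
  have "taylor (n - 1) (proj_hat n p) (proj_hat n d) f = 0"
    if pd: "(p, D) \<in> H" "d \<in> D" "proj n d = j" for p D d
  proof -
    have e: "embed_at n i d \<in> {d \<in> D. proj n d = i}"
      using embed_below[OF pd(1,2)] pd(3) assms by (simp add: proj_embed) (simp add: proj_def)
    then have "(proj_hat n p, proj_hat n ` {d \<in> D. proj n d = i}) \<in> slice n i H"
      using pd(1) unfolding slice_def by blast
    moreover have "proj_hat n d \<in> proj_hat n ` {d \<in> D. proj n d = i}"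
      using e hat_embed by (metis image_eqI)
    ultimately show ?thesis using f vanishing_ideal_iff[OF slice_char_admissible] by fastforce
  qed
  moreover have "f \<in> polys (n - 1)" using f by (simp add: vanishing_ideal_def)
  ultimately show "f \<in> vanishing_ideal (n - 1) (slice n j H)"
    unfolding vanishing_ideal_iff[OF slice_char_admissible] by (fastforce simp: slice_def)
qed

text \<open>The expansion in powers of X_n - c has the single coefficient \<open>g\<close>, at
  position \<open>i\<close>. Beyond \<open>max_last n H\<close> no condition tests it, which covers
  the extra generator (X_n - c)^(w+1).\<close>

lemma vanishing_ideal_power_mult:
  assumes "g \<in> polys (n - 1)" "i \<le> max_last n H \<Longrightarrow> g \<in> vanishing_ideal (n - 1) (slice n i H)"
  shows "univ_poly n ([:- c, 1:] ^ i) * g \<in> vanishing_ideal n H"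
proof -
  have "tau n c j (univ_poly n ([:- c, 1:] ^ i) * g) \<in> vanishing_ideal (n - 1) (slice n j H)"
    if "j \<le> max_last n H" for j
    using assms(2) slice_ideal[OF that] that
    by (auto simp: tau_mult_power tau_pred[OF n assms(1)] poly_ideal_def dest: le_antisym)
  then show ?thesis
    unfolding vanishing_ideal_slice using polys_mult[OF polys_univ[OF n] polys_pred[OF assms(1)]] by blast
qed

section \<open>Stacking the quotient bases of the slices\<close>

context
  fixes Dt :: "nat \<Rightarrow> exps set" and Gt :: "nat \<Rightarrow> 'a mpoly set" and D :: "exps set"
  assumes St: "\<And>i. i \<le> max_last n H \<Longrightarrow> standard_pair (n - 1) (vanishing_ideal (n - 1) (slice n i H)) (Dt i) (Gt i)"
    and D: "D = (\<Union>i\<le>max_last n H. embed_at n i ` Dt i)"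
begin

text \<open>Larger ideals have smaller quotient bases. This nesting of the layers makes the stack a
  lower set.\<close>

lemma Dt_antimono:
  assumes "i \<le> j" "j \<le> max_last n H"
  shows "Dt j \<subseteq> Dt i"
proof -
  have i: "i \<le> max_last n H" using assms by simp
  show ?thesis
    unfolding standard_pair_quotient_basis[OF slice_ideal[OF i] St[OF i]]
      standard_pair_quotient_basis[OF slice_ideal[OF assms(2)] St[OF assms(2)]]
    using vanishing_ideal_slice_mono[OF assms(1)] unfolding quotient_basis_def by blast
qed

lemma in_stack_iff:
  "d \<in> D \<longleftrightarrow> d \<in> coords n \<and> lookup d n \<le> max_last n H \<and> proj_hat n d \<in> Dt (lookup d n)"
proof
  assume "d \<in> D"
  then obtain i x where x: "i \<le> max_last n H" "x \<in> Dt i" "d = embed_at n i x" using D by auto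
  have co: "x \<in> coords (n - 1)" using lower_set_coords[OF standard_pairD(2)[OF St[OF x(1)]] x(2)] .
  then have "proj_hat n d = x" using x(3) hat_pred[OF n co] by (simp add: hat_embed)
  then show "d \<in> coords n \<and> lookup d n \<le> max_last n H \<and> proj_hat n d \<in> Dt (lookup d n)"
    using x embed_in_coords[OF n coords_pred[OF co]] by (simp add: lookup_embed)
next
  assume "d \<in> coords n \<and> lookup d n \<le> max_last n H \<and> proj_hat n d \<in> Dt (lookup d n)"
  moreover have "d = embed_at n (lookup d n) (proj_hat n d)" by (simp add: embed_proj_hat embed_lookup)
  ultimately show "d \<in> D" using D by blast
qed

lemma stack_finite: "finite D"
  unfolding D using standard_pairD(1)[OF St] by auto

lemma stack_lower: "lower_set n D"
  unfolding lower_set_def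
proof (intro conjI ballI impI)
  show "D \<subseteq> coords n" using in_stack_iff by blast
  fix d i assume d: "d \<in> D" and i: "i \<in> {1..n}" "lookup d i \<noteq> 0"
  note d' = d[unfolded in_stack_iff]
  show "d - single i 1 \<in> D"
  proof (cases "i = n")
    case True
    have "proj_hat n (d - single i 1) = proj_hat n d"
      using True by (intro poly_mapping_eqI) (auto simp: lookup_hat lookup_minus lookup_single when_def)
    then show ?thesis
      using d' Dt_antimono[of "lookup d n - 1" "lookup d n"] True
      unfolding in_stack_iff by (auto simp: lookup_minus coords_diff)
  next
    case False
    have "proj_hat n (d - single i 1) = proj_hat n d - single i 1"
      using False by (intro poly_mapping_eqI) (auto simp: lookup_hat lookup_minus lookup_single when_def)
    moreover have "proj_hat n d - single i 1 \<in> Dt (lookup d n)"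
      using d' standard_pairD(2)[OF St, of "lookup d n"] i False
      by (auto simp: lower_set_def lookup_hat)
    ultimately show ?thesis
      using d' False unfolding in_stack_iff by (auto simp: lookup_minus lookup_single coords_diff)
  qed
qed

lemma stack_height: "height n D d \<le> max_last n H + 1"
proof (rule ccontr)
  assume "\<not> ?thesis"
  then have "embed_at n (max_last n H + 1) d \<in> D"
    using embed_in_iff[OF n stack_finite stack_lower] by simp
  then show False by (simp add: in_stack_iff lookup_embed)
qed

text \<open>Were the coefficient of (X_n - c)^j at \<open>d\<close> nonzero for some j below the
  height, \<open>tau n c j f\<close> would lie in the ideal of slice j with its leading monomial in
  \<open>Dt j\<close>.\<close>

lemma stack_col_dvd: "col_dvd n (vanishing_ideal n H) (\<lambda>d. [:- c, 1:] ^ height n D d)"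
  unfolding col_dvd_def linear_power_dvd_iff
proof (intro ballI impI allI, rule ccontr)
  fix f d j
  assume f: "f \<in> vanishing_ideal n H" and d: "d \<in> coords n"
    and le: "\<forall>m\<in>keys f. proj_hat n m \<le> proj_hat n d"
    and j: "j < height n D d" and nz: "coeff (pcompose (colpoly n f d) [:c, 1:]) j \<noteq> 0"
  have "embed_at n j d \<in> D" using j embed_in_iff[OF n stack_finite stack_lower] by blast
  then have dj: "proj_hat n d \<in> Dt j" "j \<le> max_last n H"
    unfolding in_stack_iff by (auto simp: lookup_embed hat_embed)
  let ?t = "tau n c j f"
  have t: "?t \<in> vanishing_ideal (n - 1) (slice n j H)"
    using f dj(2) vanishing_ideal_slice by blast
  have k: "proj_hat n d \<in> keys ?t"
    using nz colpoly_hat[OF hat_hat, of n f d] by (simp add: in_keys_iff lookup_tau lookup_hat)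
  have "lm ?t = proj_hat n d"
  proof (rule lm_eqI[OF k])
    fix m assume "m \<in> keys ?t"
    then have m: "lookup m n = 0" "colpoly n f m \<noteq> 0"
      by (auto simp: in_keys_iff lookup_tau split: if_splits)
    then obtain i where "embed_at n i m \<in> keys f"
      by (auto simp: poly_eq_iff coeff_colpoly in_keys_iff)
    then have "proj_hat n m \<le> proj_hat n d" using le hat_embed by metis
    moreover have "proj_hat n m = m" using m(1) by (auto simp: poly_mapping_eq_iff fun_eq_iff lookup_hat)
    ultimately show "m \<le> proj_hat n d" by simp
  qed
  moreover have "?t \<noteq> 0" using k by auto
  ultimately show False using standard_pairD(3)[OF St[OF dj(2)] t] dj(1) by simp
qed

lemma stack_std_pair:
  assumes Gs: "Gs = (\<Union>i\<le>max_last n H. (\<lambda>g. (Var n - Const c) ^ i * g) ` Gt i) \<union>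
    {(Var n - Const c) ^ (max_last n H + 1)}"
  shows "standard_pair n (vanishing_ideal n H) D {g \<in> Gs. lm g \<in> limiting_set n D}"
proof -
  let ?w = "max_last n H" and ?I = "vanishing_ideal n H"
  have I: "poly_ideal n ?I"
    by (rule vanishing_ideal_ideal[OF ch H_props(4)])
  \<comment> \<open>The extra generator is included as i = w + 1 with g = 1, so all of
    \<open>Gs\<close> has one form.\<close>
  have shape: "\<exists>i g. f = univ_poly n ([:- c, 1:] ^ i) * g \<and> g \<in> polys (n - 1) \<and> g \<noteq> 0 \<and> lc g = 1 \<and>
      (i \<le> ?w \<longrightarrow> g \<in> Gt i) \<and> (i > ?w \<longrightarrow> g = 1)" if f: "f \<in> Gs" for f
  proof -
    have lc1: "lc 1 = (1 :: 'a)" by (simp add: lc_def lm_def)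
    from f consider i g where "i \<le> ?w" "g \<in> Gt i" "f = univ_poly n ([:- c, 1:] ^ i) * g"
      | "f = univ_poly n ([:- c, 1:] ^ (?w + 1)) * 1"
      unfolding Gs univ_poly_power univ_poly_linear by auto
    then show ?thesis
    proof cases
      case 1
      then have "g \<in> polys (n - 1)"
        using standard_pairD(4)[OF St[OF 1(1)]] poly_ideal_polys[OF slice_ideal[OF 1(1)]] by blast
      then show ?thesis using 1 standard_pairD(6,7)[OF St[OF 1(1)]] by (metis leD)
    next
      case 2
      then show ?thesis using lc1 by (metis Suc_eq_plus1 not_less_eq_eq order_refl polys_one zero_neq_one)
    qed
  qed
  show ?thesis
    unfolding standard_pair_def
  proof (intro conjI ballI impI stack_finite stack_lower)
    show "lm f \<notin> D" if "f \<in> ?I" "f \<noteq> 0" for f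
      by (rule col_dvd_lm[OF n I stack_finite stack_lower stack_col_dvd _ that])
        (simp add: degree_linear_power)
  next
    show "{g \<in> Gs. lm g \<in> limiting_set n D} \<subseteq> ?I"
    proof clarify
      fix f assume "f \<in> Gs"
      then obtain i g where g: "f = univ_poly n ([:- c, 1:] ^ i) * g" "g \<in> polys (n - 1)" "i \<le> ?w \<longrightarrow> g \<in> Gt i"
        using shape by blast
      then show "f \<in> ?I"
        using standard_pairD(4)[OF St, of i] by (auto intro!: vanishing_ideal_power_mult)
    qed
  next
    fix f assume "f \<in> {g \<in> Gs. lm g \<in> limiting_set n D}"
    then have f: "f \<in> Gs" "lm f \<in> limiting_set n D" by auto
    then obtain i g where g: "f = univ_poly n ([:- c, 1:] ^ i) * g" "g \<in> polys (n - 1)" "g \<noteq> 0" "lc g = 1"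
      "i \<le> ?w \<longrightarrow> g \<in> Gt i" "i > ?w \<longrightarrow> g = 1" using shape by blast
    note u = univ_poly_mult_pred[OF n g(2,3,4), where i = i and c = c, folded g(1)]
    show "f \<noteq> 0" "lc f = 1" using u by auto
    \<comment> \<open>Selecting only limiting leading monomials ensures that the column below
      \<open>lm f\<close> is filled exactly up to \<open>i\<close>.\<close>
    have hi: "height n D (lm g) = i"
      using height_limiting_set[OF n stack_finite stack_lower f(2)] u(3) height_hat[OF hat_embed]
      by (metis lookup_embed)
    have co: "lm g \<in> coords (n - 1)" using lm_in_keys[OF g(3)] polys_keys[OF g(2)] by blast
    show "keys f - {lm f} \<subseteq> D"
    proof
      fix m assume m: "m \<in> keys f - {lm f}"
      then have mk: "lookup m n \<le> i" "proj_hat n m \<in> keys g" using u(5) by auto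
      show "m \<in> D"
      proof (cases "proj_hat n m = lm g")
        case True
        then have e: "m = embed_at n (lookup m n) (lm g)" by (metis embed_lookup embed_proj_hat)
        then have "lookup m n \<noteq> i" using m u(3) by auto
        then have "embed_at n (lookup m n) (lm g) \<in> D"
          unfolding embed_in_iff[OF n stack_finite stack_lower] hi using mk(1) by simp
        then show ?thesis using e by simp
      next
        case False
        \<comment> \<open>The extra generator lives over the column of 0 alone, so a term over
          another column comes from a slice; its hat is in \<open>Dt i\<close> and hence in all
          lower layers.\<close>
        have iw: "i \<le> ?w"
        proof (rule ccontr)
          assume "\<not> i \<le> ?w"
          then have "g = 1" using g(6) by simp
          then show False using mk(2) False by (simp add: lm_def)
        qed
        then have "proj_hat n m \<in> Dt i"
          using standard_pairD(8)[OF St[OF iw]] g(5) mk(2) False by blast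
        then show ?thesis
          using Dt_antimono[OF mk(1) iw] iw mk(1) m polys_keys[OF u(1)] unfolding in_stack_iff by auto
      qed
    qed
  next
    show "lm ` {g \<in> Gs. lm g \<in> limiting_set n D} = limiting_set n D"
    proof (intro equalityI subsetI)
      fix e assume e: "e \<in> limiting_set n D"
      then have eco: "e \<in> coords n" and eD: "e \<notin> D"
        and pred: "\<And>i. i \<in> {1..n} \<Longrightarrow> lookup e i \<noteq> 0 \<Longrightarrow> e - single i 1 \<in> D"
        by (auto simp: limiting_set_def)
      have "\<exists>f\<in>Gs. lm f = e"
      \<comment> \<open>Up to height w, dropping the last entry gives a limiting exponent of the
        slice; above w only (0,...,0,w+1) remains.\<close>
      proof (cases "lookup e n \<le> ?w")
        case True
        let ?i = "lookup e n"
        have "proj_hat n e \<in> limiting_set (n - 1) (Dt ?i)"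
          unfolding limiting_set_def
        proof (intro CollectI conjI ballI impI DiffI)
          show "proj_hat n e \<in> coords (n - 1)" by (rule coords_hat[OF eco])
          show "proj_hat n e \<notin> Dt ?i" using eD True eco by (simp add: in_stack_iff)
          fix j assume j: "j \<in> {1..n - 1}" "lookup (proj_hat n e) j \<noteq> 0"
          then have "e - single j 1 \<in> D" by (intro pred) (auto simp: lookup_hat split: if_splits)
          moreover have "proj_hat n (e - single j 1) = proj_hat n e - single j 1"
            using j by (intro poly_mapping_eqI) (auto simp: lookup_hat lookup_minus lookup_single when_def)
          moreover have "lookup (e - single j 1) n = ?i"
            using j by (auto simp: lookup_minus lookup_single)
          ultimately show "proj_hat n e - single j 1 \<in> Dt ?i" unfolding in_stack_iff by simp
        qed
        then obtain g where g: "g \<in> Gt ?i" "lm g = proj_hat n e"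
          using standard_pairD(5)[OF St[OF True]] by (metis imageE)
        then have "g \<in> polys (n - 1)"
          using standard_pairD(4)[OF St[OF True]] poly_ideal_polys[OF slice_ideal[OF True]] by blast
        then have "lm (univ_poly n ([:- c, 1:] ^ ?i) * g) = e"
          using univ_poly_mult_pred(3)[OF n _ standard_pairD(6,7)[OF St[OF True] g(1)]] g(2)
          by (simp add: embed_proj_hat embed_lookup)
        moreover have "univ_poly n ([:- c, 1:] ^ ?i) * g \<in> Gs"
          unfolding Gs univ_poly_power univ_poly_linear using True g(1) by blast
        ultimately show ?thesis by blast
      next
        case False
        have "e - single n 1 \<in> D" using False n by (intro pred) auto
        then have en: "lookup e n = ?w + 1"
          using False unfolding in_stack_iff by (auto simp: lookup_minus)
        \<comment> \<open>Lowering another nonzero entry would lead into \<open>D\<close> at height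
          w + 1, where \<open>D\<close> is empty.\<close>
        have "proj_hat n e = 0"
        proof (rule poly_mapping_eqI, rule ccontr)
          fix j assume "lookup (proj_hat n e) j \<noteq> lookup 0 j"
          then have j: "j \<noteq> n" "lookup e j \<noteq> 0" by (auto simp: lookup_hat split: if_splits)
          then have "e - single j 1 \<in> D" using eco by (intro pred) (auto simp: in_coords_iff)
          then show False using j en unfolding in_stack_iff by (auto simp: lookup_minus lookup_single)
        qed
        then have "e = embed_at n (?w + 1) 0"
          using en by (metis embed_lookup embed_proj_hat)
        moreover have "lm (univ_poly n ([:- c, 1:] ^ (?w + 1)) * 1) = embed_at n (?w + 1) (lm 1)"
          using univ_poly_mult_pred(3)[OF n polys_one _ _, of c "?w + 1"] by (simp add: lc_def lm_def)
        moreover have "univ_poly n ([:- c, 1:] ^ (?w + 1)) * 1 \<in> Gs"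
          unfolding Gs univ_poly_power univ_poly_linear by simp
        ultimately show ?thesis by (metis lm_def keys_one Max_singleton)
      qed
      then show "e \<in> lm ` {g \<in> Gs. lm g \<in> limiting_set n D}" using e by auto
    qed auto
  qed
qed

end

end

section \<open>Comaximal univariate polynomials\<close>

text \<open>Coprimality in Bezout form, as the coefficients \<open>r1\<close> and \<open>r2\<close>
  of the merge require it.\<close>

definition comax :: "'a::comm_ring_1 \<Rightarrow> 'a \<Rightarrow> bool" where
  "comax p q \<longleftrightarrow> (\<exists>r s. r * p + s * q = 1)"

lemma comax_sym: "comax p q \<Longrightarrow> comax q p"
  unfolding comax_def by (metis add.commute)

lemma comax_1: "comax p 1"
  unfolding comax_def by (intro exI[of _ 0] exI[of _ 1]) simp

lemma comax_mult:
  assumes "comax p q" "comax p q'"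
  shows "comax p (q * q')"
proof -
  obtain r s r' s' where e: "r * p + s * q = 1" "r' * p + s' * q' = 1"
    using assms by (auto simp: comax_def)
  have "(r * r' * p + r * s' * q' + s * q * r') * p + (s * s') * (q * q') =
      (r * p + s * q) * (r' * p + s' * q')" by (simp add: algebra_simps)
  then show ?thesis unfolding comax_def e by (metis mult_1)
qed

lemma comax_power: "comax p q \<Longrightarrow> comax p (q ^ k)"
  by (induction k) (simp_all add: comax_1 comax_mult)

lemma comax_prod: "(\<And>x. x \<in> A \<Longrightarrow> comax p (q x)) \<Longrightarrow> comax p (\<Prod>x\<in>A. q x)"
  by (induction A rule: infinite_finite_induct) (simp_all add: comax_1 comax_mult)

lemma comax_linear:
  assumes "a \<noteq> (b :: 'a :: field)"
  shows "comax [:- a, 1:] [:- b, 1:]"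
proof -
  define k where "k = inverse (b - a)"
  have "k * b - k * a = 1" using assms by (simp add: k_def flip: right_diff_distrib)
  then have "[:k:] * [:- a, 1:] + [:- k:] * [:- b, 1:] = 1" by (simp add: one_pCons mult.commute)
  then show ?thesis unfolding comax_def by blast
qed

lemma comax_linear_powers:
  assumes "c \<notin> A"
  shows "comax ([:- c, 1:] ^ i) (\<Prod>x\<in>A. [:- x, 1 :: 'a :: field:] ^ j x)"
proof (intro comax_prod comax_power)
  fix x assume "x \<in> A"
  then have "c \<noteq> x" using assms by auto
  then have "comax [:- x, 1:] ([:- c, 1:] ^ i)" by (intro comax_power comax_linear) auto
  then show "comax ([:- c, 1:] ^ i) [:- x, 1:]" by (rule comax_sym)
qed

lemma comax_dvd:
  assumes "comax p q" "p dvd u" "q dvd u"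
  shows "p * q dvd u"
proof -
  obtain r s where rs: "r * p + s * q = 1" using assms(1) by (auto simp: comax_def)
  obtain a where a: "u = p * a" using assms(2) by (rule dvdE)
  obtain b where b: "u = q * b" using assms(3) by (rule dvdE)
  have "u = (r * p + s * q) * u" by (simp add: rs)
  also have "\<dots> = r * p * (q * b) + s * q * (p * a)" using a b by (metis distrib_right)
  also have "\<dots> = p * q * (r * b + s * a)" by (simp add: algebra_simps)
  finally show ?thesis by (metis dvd_triv_left)
qed

lemma monic_dvd_eq:
  fixes p q :: "'a :: field poly"
  assumes "q dvd p" "degree p = degree q" "lead_coeff p = 1" "lead_coeff q = 1"
  shows "p = q"
proof -
  obtain r where r: "p = q * r" using assms(1) by (rule dvdE)
  have nz: "q \<noteq> 0" "r \<noteq> 0" using assms(3,4) r by auto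
  then have "degree r = 0" using assms(2) by (simp add: r degree_mult_eq)
  then obtain a where a: "r = [:a:]" by (rule degree_eq_zeroE)
  have "lead_coeff p = lead_coeff q * lead_coeff r" unfolding r by (rule lead_coeff_mult)
  then have "a = 1" using assms(3,4) a by simp
  then show ?thesis using r a by simp
qed

section \<open>Reduction\<close>

lemma red_at:
  fixes f :: "'a :: field mpoly"
  assumes g: "g \<noteq> 0" and m: "lm g + u \<in> keys f"
  defines "f' \<equiv> f - single u (lookup f (lm g + u) / lc g) * g"
  shows "lookup f' (lm g + u) = 0" "lm g + u < k \<Longrightarrow> lookup f' k = lookup f k"
proof -
  define a where "a = lookup f (lm g + u) / lc g"
  have "a \<noteq> 0" using m lc_nonzero[OF g] by (simp add: a_def in_keys_iff)
  note l = lm_mult_single[OF g this, of u]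
  have "lookup (g * single u a) (lm g + u) = lookup f (lm g + u)"
    unfolding lookup_mult_single using lc_nonzero[OF g] by (simp add: lc_def a_def)
  then show "lookup f' (lm g + u) = 0" by (simp add: f'_def lookup_minus mult.commute flip: a_def)
  assume "lm g + u < k"
  then have "k \<notin> keys (g * single u a)" using keys_le_lm[of k "g * single u a"] l(1) by auto
  then show "lookup f' k = lookup f k"
    by (simp add: f'_def lookup_minus mult.commute in_keys_iff flip: a_def)
qed

text \<open>Always reduce at the largest reducible monomial: it disappears and only smaller ones
  change, so the maximum of the reducible monomials \<open>R\<close> decreases, which must stop by
  \<open>wf_coords\<close>.\<close>

lemma ex_fully_reduces_to:
  assumes G: "G \<subseteq> polys n" and f: "f \<in> polys n"
  shows "\<exists>f'. fully_reduces_to G f f'"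
proof -
  define R where "R = (\<lambda>f :: 'a mpoly. {k \<in> keys f. \<exists>g\<in>G. g \<noteq> 0 \<and> (\<exists>u. k = lm g + u)})"
  have R_fin: "finite (R f)" for f by (simp add: R_def)
  have stop: "fully_reduces_to G f f" if "R f = {}" for f
    using that unfolding fully_reduces_to_def red_step_def R_def by fastforce
  have main: "\<forall>f\<in>polys n. m \<in> coords n \<longrightarrow> (\<forall>k\<in>R f. k \<le> m) \<longrightarrow> (\<exists>f'. fully_reduces_to G f f')" for m
  proof (induction m rule: wf_induct_rule[OF wf_coords[of n]])
    case (1 m)
    show ?case
    proof (intro ballI impI)
      fix f assume f: "f \<in> polys n" and m: "m \<in> coords n" and le: "\<forall>k\<in>R f. k \<le> m"
      show "\<exists>f'. fully_reduces_to G f f'"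
      proof (cases "R f = {}")
        case True
        then show ?thesis using stop by blast
      next
        case False
        define m0 where "m0 = Max (R f)"
        have m0: "m0 \<in> R f" unfolding m0_def using R_fin False by (rule Max_in)
        then obtain g u where g: "g \<in> G" "g \<noteq> 0" "m0 = lm g + u" "m0 \<in> keys f"
          by (auto simp: R_def)
        define f1 where "f1 = f - single u (lookup f (lm g + u) / lc g) * g"
        have step: "red_step G f f1"
          unfolding red_step_def f1_def using g by blast
        note r = red_at[OF g(2), of u f, folded g(3), OF g(4)]
        have "m0 \<in> coords n" using g(4) f polys_keys by blast
        then have "u \<in> coords n" using g(3) by simp
        then have f1: "f1 \<in> polys n"
          unfolding f1_def using G g(1) f by (intro polys_diff polys_mult polys_single) auto
        have small: "k < m0" if k: "k \<in> R f1" for k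
        proof (rule ccontr)
          assume "\<not> k < m0"
          then consider "k = m0" | "m0 < k" by fastforce
          then show False
          proof cases
            case 1
            then show False using k r(1) by (simp add: R_def f1_def g(3) in_keys_iff)
          next
            case 2
            then have "k \<in> R f" using k r(2)[OF 2] by (simp add: R_def f1_def g(3) in_keys_iff)
            then show False using Max_ge[OF R_fin] 2 by (fastforce simp: m0_def)
          qed
        qed
        have "\<exists>f'. fully_reduces_to G f1 f'"
        proof (cases "R f1 = {}")
          case True
          then show ?thesis using stop by blast
        next
          case False
          define m1 where "m1 = Max (R f1)"
          have "m1 \<in> R f1" unfolding m1_def using R_fin False by (rule Max_in)
          then have "m1 < m0" "m1 \<in> keys f1" using small by (auto simp: R_def)
          moreover have "m0 \<le> m" using le m0 by blast
          ultimately have "m1 < m" "m1 \<in> coords n" using polys_keys[OF f1] by auto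
          then show ?thesis
            using 1[of m1] m f1 Max_ge[OF R_fin] by (auto simp: m1_def)
        qed
        then show ?thesis
          using step unfolding fully_reduces_to_def by (meson converse_rtranclp_into_rtranclp)
      qed
    qed
  qed
  show ?thesis
  proof (cases "R f = {}")
    case False
    have "Max (R f) \<in> coords n"
      using Max_in[OF R_fin False] f polys_keys by (auto simp: R_def)
    then show ?thesis using main[of "Max (R f)"] f Max_ge[OF R_fin] by blast
  qed (use stop in blast)
qed

text \<open>No step touches \<open>t\<close>, since limiting exponents other than \<open>t\<close>
  do not divide it; so all steps happen below \<open>t\<close>, in whatever order. A remaining
  monomial below \<open>t\<close> outside \<open>D\<close> would be divisible by a limiting exponent
  below \<open>t\<close>, which \<open>G\<close> already realizes: this is where the increasing
  order of processing enters.\<close>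

lemma fully_reduces_to_tail:
  assumes I: "poly_ideal n I" and D: "lower_set n D" and t: "t \<in> limiting_set n D"
    and GI: "G \<subseteq> I" and G: "\<forall>g\<in>G. g \<noteq> 0 \<and> lm g \<in> limiting_set n D \<and> lm g \<noteq> t"
    and below: "\<forall>e\<in>limiting_set n D. e < t \<longrightarrow> e \<in> lm ` G"
    and f: "f \<in> I" "f \<noteq> 0" "lm f = t" "lc f = 1"
    and red: "fully_reduces_to G f f'"
  shows "f' \<in> I" "f' \<noteq> 0" "lm f' = t" "lc f' = 1" "keys f' - {t} \<subseteq> D"
proof -
  have "(red_step G)\<^sup>*\<^sup>* f f'" using red by (simp add: fully_reduces_to_def)
  then have inv: "f' \<in> I \<and> lookup f' t = 1 \<and> (\<forall>k\<in>keys f'. k \<le> t)"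
  proof (induction rule: rtranclp_induct)
    case base
    then show ?case using f keys_le_lm[of _ f] by (auto simp: lc_def)
  next
    case (step h h')
    obtain g u where g: "g \<in> G" "g \<noteq> 0" "lm g + u \<in> keys h"
      "h' = h - single u (lookup h (lm g + u) / lc g) * g"
      using step.hyps(2) by (auto simp: red_step_def)
    note r = red_at[OF g(2,3), folded g(4)]
    have "lm g + u \<noteq> t"
      using limiting_set_antichain[OF D, of "lm g" u] G g(1) t by fastforce
    then have lt: "lm g + u < t" using step.IH g(3) by fastforce
    have "h \<in> polys n" using step.IH poly_ideal_polys[OF I] by blast
    then have "u \<in> coords n" using polys_keys[OF _ g(3)] by simp
    then have "h' \<in> I"
      unfolding g(4) using step.IH GI g(1)
      by (intro poly_ideal_diff[OF I] poly_ideal_mult[OF I] polys_single) auto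
    moreover have "lookup h' t = 1" using r(2)[OF lt] step.IH by simp
    moreover have "k \<le> t" if "k \<in> keys h'" for k
    proof (rule ccontr)
      assume "\<not> k \<le> t"
      then have "lookup h' k = lookup h k" using lt by (intro r(2)) auto
      then show False using \<open>\<not> k \<le> t\<close> that step.IH by (auto simp: in_keys_iff)
    qed
    ultimately show ?case by blast
  qed
  then show fI: "f' \<in> I" and "f' \<noteq> 0" by auto
  show "lm f' = t" by (rule lm_eqI) (use inv in \<open>auto simp: in_keys_iff\<close>)
  then show "lc f' = 1" using inv by (simp add: lc_def)
  show "keys f' - {t} \<subseteq> D"
  proof (rule subsetI, rule ccontr)
    fix m assume m: "m \<in> keys f' - {t}" and mD: "m \<notin> D"
    have "m \<in> coords n" using m fI poly_ideal_polys[OF I] polys_keys by blast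
    then obtain e u where e: "e \<in> limiting_set n D" "m = e + u"
      using limiting_set_divides[of m n D] mD by blast
    have "m < t" using m inv by auto
    then have "e < t" using exps_le_add[of e u] e(2) by auto
    then obtain g where g: "g \<in> G" "lm g = e" using below e(1) by auto
    then have "red_step G f' (f' - single u (lookup f' (lm g + u) / lc g) * g)"
      unfolding red_step_def using G g(1) m e(2) by blast
    then show False using red by (auto simp: fully_reduces_to_def)
  qed
qed

section \<open>Merging points with different last coordinates\<close>

text \<open>What merging has to know about one level. The height bound keeps the exponents
  \<open>w + 1 - v\<close> from being truncated, and the last clause says that (X_n - c)^(w+1)
  satisfies all conditions of the level.\<close>

definition level_ok :: "nat \<Rightarrow> 'a::field mpoly set \<Rightarrow> 'a \<Rightarrow> nat \<Rightarrow> exps set \<Rightarrow> 'a mpoly set \<Rightarrow> bool" where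
  "level_ok n I c w D G \<longleftrightarrow> poly_ideal n I \<and> standard_pair n I D G \<and>
     col_dvd n I (\<lambda>d. [:- c, 1:] ^ height n D d) \<and> (\<forall>d. height n D d \<le> w + 1) \<and>
     (\<forall>f\<in>polys n. univ_poly n ([:- c, 1:] ^ (w + 1)) * f \<in> I)"

definition merged_ok :: "nat \<Rightarrow> 'a::field mpoly set \<Rightarrow> ('a \<Rightarrow> nat) \<Rightarrow> ('a \<Rightarrow> exps set) \<Rightarrow> 'a set \<Rightarrow>
    exps set \<Rightarrow> 'a mpoly set \<Rightarrow> bool" where
  "merged_ok n I w D' C D G \<longleftrightarrow> poly_ideal n I \<and> standard_pair n I D G \<and>
     col_dvd n I (\<lambda>d. \<Prod>x\<in>C. [:- x, 1:] ^ height n (D' x) d) \<and>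
     (\<forall>d\<in>coords n. height n D d = (\<Sum>x\<in>C. height n (D' x) d)) \<and>
     (\<forall>f\<in>polys n. univ_poly n (\<Prod>x\<in>C. [:- x, 1:] ^ (w x + 1)) * f \<in> I)"

lemma lead_coeff_linear_powers:
  "lead_coeff (\<Prod>x\<in>C. [:- x, 1 :: 'a :: field:] ^ k x) = 1"
  by (simp add: lead_coeff_prod lead_coeff_power)

lemma degree_linear_powers:
  "degree (\<Prod>x\<in>C. [:- x, 1 :: 'a :: field:] ^ k x) = (\<Sum>x\<in>C. k x)"
  by (subst degree_prod_eq_sum_degree) (auto simp: degree_linear_power)

lemma GLT_coords: "1 \<le> n \<Longrightarrow> t \<in> coords n \<Longrightarrow> finite D \<Longrightarrow> lower_set n D \<Longrightarrow> GLT n t D \<in> coords n"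
  by (simp add: GLT_height embed_in_coords)

lemma ex_GLP:
  assumes "1 \<le> n" "poly_ideal n I" and P: "standard_pair n I D G" and t: "t \<in> coords n"
  shows "\<exists>f. is_GLP n t D G f"
proof -
  note D = standard_pairD(1,2)[OF P]
  have "GLT n t D \<notin> D" by (simp add: GLT_height[OF assms(1) D] embed_in_iff[OF assms(1) D])
  then obtain g u where g: "g \<in> G" "GLT n t D = lm g + u"
    using standard_pair_multiple[OF assms(2) P] GLT_coords[OF assms(1) t D] by blast
  then show ?thesis
    unfolding is_GLP_def using standard_pairD(5,6)[OF P] by blast
qed

text \<open>\<open>lm f\<close> sits directly on top of the column over \<open>t\<close>, so its
  coefficient over k[X_n] is monic of degree the column height. It is divisible by the monic
  \<open>q t\<close> of the same degree, hence equal to it.\<close>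

lemma GLP_colpoly:
  assumes n: "1 \<le> n" and I: "poly_ideal n I" and P: "standard_pair n I D G" and t: "t \<in> coords n"
    and f: "is_GLP n t D G f"
    and q: "col_dvd n I q" "lead_coeff (q t) = 1" "degree (q t) = height n D t"
  shows "f \<in> I" "m \<in> keys f \<Longrightarrow> proj_hat n m \<le> proj_hat n t" "colpoly n f t = q t"
proof -
  note D = standard_pairD(1,2)[OF P]
  obtain g u where g: "g \<in> G" "g \<noteq> 0" "GLT n t D = lm g + u" "f = g * single u 1"
    using f by (auto simp: is_GLP_def)
  note l = lm_mult_single[OF g(2) one_neq_zero, of u, folded g(4)]
  have lmf: "lm f = embed_at n (height n D t) t" using l(1) g(3) GLT_height[OF n D] by simp
  have u: "u \<in> coords n" using GLT_coords[OF n t D] by (simp add: g(3))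
  have "g \<in> I" using g(1) standard_pairD(4)[OF P] by blast
  then show fI: "f \<in> I" using poly_ideal_mult[OF I polys_single[OF u]] by (simp add: g(4) mult.commute)
  note c = colpoly_lm[OF n poly_ideal_polys[OF I fI] l(3)]
  have h: "proj_hat n (lm f) = proj_hat n t" by (simp add: lmf hat_embed)
  show le: "m \<in> keys f \<Longrightarrow> proj_hat n m \<le> proj_hat n t" for m using c(3) h by simp
  have e: "colpoly n f (lm f) = colpoly n f t" using colpoly_hat[OF h] .
  show "colpoly n f t = q t"
  proof (rule monic_dvd_eq)
    show "q t dvd colpoly n f t" by (rule col_dvdD[OF q(1) fI t le])
    show "degree (colpoly n f t) = degree (q t)" using c(1) unfolding e q(3) by (simp add: lmf lookup_embed)
    show "lead_coeff (colpoly n f t) = 1" using c(2) l(2) standard_pairD(7)[OF P g(1)] unfolding e by simp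
    show "lead_coeff (q t) = 1" by (rule q(2))
  qed
qed

lemma keys_univ_mult:
  assumes "m \<in> keys (univ_poly n q * f)"
  shows "\<exists>m'\<in>keys f. proj_hat n m' = proj_hat n m"
proof -
  have "coeff (colpoly n (univ_poly n q * f) m) (lookup m n) \<noteq> 0"
    using assms unfolding coeff_colpoly embed_lookup by (simp add: in_keys_iff)
  then have "colpoly n f m \<noteq> 0" by (auto simp: colpoly_univ)
  then obtain j where "embed_at n j m \<in> keys f"
    by (auto simp: poly_eq_iff coeff_colpoly in_keys_iff)
  then show ?thesis using hat_embed by blast
qed

section \<open>Merging one further level\<close>

context
  fixes n :: nat and J :: "'a::field \<Rightarrow> 'a mpoly set" and w :: "'a \<Rightarrow> nat"
    and D' :: "'a \<Rightarrow> exps set" and G' :: "'a \<Rightarrow> 'a mpoly set" and S :: "'a set"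
  assumes n: "1 \<le> n" and L: "\<And>x. x \<in> S \<Longrightarrow> level_ok n (J x) x (w x) (D' x) (G' x)"
begin

lemma levelD:
  assumes "x \<in> S"
  shows "poly_ideal n (J x)" "standard_pair n (J x) (D' x) (G' x)"
    "col_dvd n (J x) (\<lambda>d. [:- x, 1:] ^ height n (D' x) d)" "height n (D' x) d \<le> w x + 1"
    "f \<in> polys n \<Longrightarrow> univ_poly n ([:- x, 1:] ^ (w x + 1)) * f \<in> J x"
    "finite (D' x)" "lower_set n (D' x)"
  using L[OF assms] standard_pairD(1,2)[of n "J x" "D' x" "G' x"] unfolding level_ok_def by blast+

context
  fixes cs :: "'a list" and c :: 'a and I :: "'a mpoly set" and Dold :: "exps set" and G :: "'a mpoly set"
  assumes cs: "set cs \<subseteq> S" "c \<in> S" "c \<notin> set cs" and M: "merged_ok n I w D' (set cs) Dold G"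
begin

lemma mergedD:
  shows "poly_ideal n I" "standard_pair n I Dold G"
    "col_dvd n I (\<lambda>d. \<Prod>x\<in>set cs. [:- x, 1:] ^ height n (D' x) d)"
    "d \<in> coords n \<Longrightarrow> height n Dold d = (\<Sum>x\<in>set cs. height n (D' x) d)"
    "f \<in> polys n \<Longrightarrow> univ_poly n (\<Prod>x\<in>set cs. [:- x, 1:] ^ (w x + 1)) * f \<in> I"
    "finite Dold" "lower_set n Dold"
  using M standard_pairD(1,2)[of n I Dold G] unfolding merged_ok_def by blast+

lemma IJ_ideal: "poly_ideal n (I \<inter> J c)"
  by (rule poly_ideal_Int[OF mergedD(1) levelD(1)[OF cs(2)]])

abbreviation "Dnew \<equiv> lower_add n Dold (D' c)"

lemma Dnew: "finite Dnew" "lower_set n Dnew"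
  "d \<in> coords n \<Longrightarrow> height n Dnew d = (\<Sum>x\<in>insert c (set cs). height n (D' x) d)"
  using lower_add_lower[OF n mergedD(6,7) levelD(6,7)[OF cs(2)]] mergedD(4)[of d] cs(3) by auto

lemma merged_col_dvd: "col_dvd n (I \<inter> J c) (\<lambda>d. \<Prod>x\<in>insert c (set cs). [:- x, 1:] ^ height n (D' x) d)"
  unfolding col_dvd_def
proof (intro ballI impI)
  fix f d assume f: "f \<in> I \<inter> J c" and d: "d \<in> coords n" and le: "\<forall>m\<in>keys f. proj_hat n m \<le> proj_hat n d"
  have "[:- c, 1:] ^ height n (D' c) d dvd colpoly n f d"
    using col_dvdD[OF levelD(3)[OF cs(2)], of f d] f d le by blast
  moreover have "(\<Prod>x\<in>set cs. [:- x, 1:] ^ height n (D' x) d) dvd colpoly n f d"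
    using col_dvdD[OF mergedD(3), of f d] f d le by blast
  ultimately show "(\<Prod>x\<in>insert c (set cs). [:- x, 1:] ^ height n (D' x) d) dvd colpoly n f d"
    using comax_dvd[OF comax_linear_powers[OF cs(3)]] cs(3) by simp
qed

lemma merged_lm: "f \<in> I \<inter> J c \<Longrightarrow> f \<noteq> 0 \<Longrightarrow> lm f \<notin> Dnew"
  by (rule col_dvd_lm[OF n IJ_ideal Dnew(1,2) merged_col_dvd])
    (simp_all add: degree_linear_powers Dnew(3) del: prod.insert sum.insert)

text \<open>The powers with exponent w + 1 put both \<open>q1\<close> and \<open>q2\<close> into
  both ideals. Over \<open>t\<close> their leading coefficients are A*a*b and B*a*b, in the notation
  of the proof; the Bezout identity for A and B leaves a*b, the product of lowest degree allowed by
  divisibility.\<close>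

lemma combination:
  assumes t: "t \<in> limiting_set n Dnew"
    and f1: "is_GLP n t Dold G f1" and f2: "is_GLP n t (D' c) (G' c) f2"
    and v: "v = (\<lambda>x. proj n (GLT n t (D' x)))"
    and q1: "q1 = f1 * (Var n - Const c) ^ (w c + 1)"
    and q2: "q2 = f2 * (\<Prod>x\<in>set cs. (Var n - Const x) ^ (w x + 1))"
    and pp1: "pp1 = (Var n - Const c) ^ (w c + 1 - v c)"
    and pp2: "pp2 = (\<Prod>x\<in>set cs. (Var n - Const x) ^ (w x + 1 - v x))"
    and r: "r1 \<in> polys_in_var n" "r2 \<in> polys_in_var n" "r1 * pp1 + r2 * pp2 = 1"
  defines "f \<equiv> r1 * q1 + r2 * q2"
  shows "f \<in> I \<inter> J c" "f \<noteq> 0" "lm f = t" "lc f = 1"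
proof -
  have tc: "t \<in> coords n" using t by (simp add: limiting_set_def)
  have vh: "v x = height n (D' x) t" if "x \<in> S" for x
    using that by (simp add: v GLT_height[OF n levelD(6,7)] proj_embed)
  obtain s1 s2 where s: "r1 = univ_poly n s1" "r2 = univ_poly n s2" using r(1,2) unfolding polys_in_var_eq by blast
  \<comment> \<open>\<open>a\<close> and \<open>b\<close> are the powers dictated by the columns
    over \<open>t\<close>; \<open>A\<close> and \<open>B\<close> are univariate forms of
    \<open>pp1\<close> and \<open>pp2\<close>, the surplus up to exponent w + 1.\<close>
  define A where "A = [:- c, 1:] ^ (w c + 1 - v c)"
  define B where "B = (\<Prod>x\<in>set cs. [:- x, 1:] ^ (w x + 1 - v x))"
  define a where "a = [:- c, 1:] ^ v c"
  define b where "b = (\<Prod>x\<in>set cs. [:- x, 1:] ^ v x)"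
  have bez: "s1 * A + s2 * B = 1"
  proof -
    have "univ_poly n (s1 * A + s2 * B) = univ_poly n 1"
      using r(3) unfolding pp1 pp2 s A_def B_def
      by (simp only: univ_poly_add univ_poly_mult univ_poly_prod univ_poly_power univ_poly_linear univ_poly_1)
    then show ?thesis by (simp only: univ_poly_inject)
  qed
  \<comment> \<open>The height bound makes the truncated difference \<open>w c + 1 - v c\<close>
    exact.\<close>
  have Aa: "[:- c, 1:] ^ (w c + 1) = A * a"
    using levelD(4)[OF cs(2), of t] vh[OF cs(2)] unfolding A_def a_def by (simp flip: power_add)
  have Bb: "(\<Prod>x\<in>set cs. [:- x, 1:] ^ (w x + 1)) = B * b"
    unfolding B_def b_def prod.distrib[symmetric] power_add[symmetric]
    using levelD(4)[of _ t] vh cs(1) by (intro prod.cong refl arg_cong[of _ _ "(^) _"]) fastforce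
  have bh: "b = (\<Prod>x\<in>set cs. [:- x, 1:] ^ height n (D' x) t)"
    unfolding b_def using vh cs(1) by (intro prod.cong) auto
  have q1': "q1 = univ_poly n (A * a) * f1"
    unfolding q1 Aa[symmetric] univ_poly_power univ_poly_linear by (rule mult.commute)
  have q2': "q2 = univ_poly n (B * b) * f2"
    unfolding q2 Bb[symmetric] univ_poly_prod univ_poly_power univ_poly_linear by (rule mult.commute)
  note g1 = GLP_colpoly[OF n mergedD(1,2) tc f1 mergedD(3) lead_coeff_linear_powers,
      unfolded degree_linear_powers, OF mergedD(4)[OF tc, symmetric]]
  have lc2: "lead_coeff ([:- c, 1:] ^ height n (D' c) t) = 1" by (simp add: lead_coeff_power)
  note g2 = GLP_colpoly[OF n levelD(1,2)[OF cs(2)] tc f2 levelD(3)[OF cs(2)] lc2 degree_linear_power]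
  have c1: "colpoly n f1 t = b" using g1(3) by (simp add: bh)
  have c2: "colpoly n f2 t = a" using g2(3) vh[OF cs(2)] by (simp add: a_def)
  have p1: "f1 \<in> polys n" "f2 \<in> polys n"
    using g1(1) g2(1) poly_ideal_polys mergedD(1) levelD(1)[OF cs(2)] by blast+
  have "q1 \<in> I" "q2 \<in> J c"
    unfolding q1' q2' using g1(1) g2(1)
    by (auto intro!: poly_ideal_mult[OF mergedD(1)] poly_ideal_mult[OF levelD(1)[OF cs(2)]] polys_univ n)
  moreover have "q1 \<in> J c" using levelD(5)[OF cs(2) p1(1)] unfolding q1' Aa .
  moreover have "q2 \<in> I" using mergedD(5)[OF p1(2)] unfolding q2' Bb .
  ultimately show fI: "f \<in> I \<inter> J c"
    unfolding f_def s
    by (intro poly_ideal_add[OF IJ_ideal] poly_ideal_mult[OF IJ_ideal] polys_univ n) auto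
  have f': "f = univ_poly n (s1 * A * a) * f1 + univ_poly n (s2 * B * b) * f2"
    by (simp add: f_def s q1' q2' univ_poly_mult algebra_simps)
  have "colpoly n f t = (s1 * A + s2 * B) * (a * b)"
    unfolding f' colpoly_add colpoly_univ c1 c2 by (simp add: algebra_simps)
  then have col: "colpoly n f t = (\<Prod>x\<in>insert c (set cs). [:- x, 1:] ^ height n (D' x) t)"
    using cs(3) vh[OF cs(2)] by (simp add: bez a_def bh)
  have le: "proj_hat n m \<le> proj_hat n t" if m: "m \<in> keys f" for m
  proof -
    have "m \<in> keys (univ_poly n (s1 * A * a) * f1) \<or> m \<in> keys (univ_poly n (s2 * B * b) * f2)"
      using m keys_add[of "univ_poly n (s1 * A * a) * f1" "univ_poly n (s2 * B * b) * f2"] unfolding f' by blast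
    then obtain m' where "m' \<in> keys f1 \<or> m' \<in> keys f2" "proj_hat n m' = proj_hat n m"
      using keys_univ_mult[of m n _ f1] keys_univ_mult[of m n _ f2] by blast
    then show ?thesis using g1(2)[of m'] g2(2)[of m'] by auto
  qed
  have nz: "colpoly n f t \<noteq> 0" unfolding col by auto
  note l = lm_by_colpoly[OF tc n poly_ideal_polys[OF IJ_ideal fI] le nz]
  show "f \<noteq> 0" by (rule l(1))
  have "lead_coeff (colpoly n f t) = 1" unfolding col by (rule lead_coeff_linear_powers)
  then show "lc f = 1" using l(3) by simp
  have "degree (colpoly n f t) = height n Dnew t"
    unfolding col degree_linear_powers by (rule Dnew(3)[OF tc, symmetric])
  also have "\<dots> = lookup t n" by (rule height_limiting_set[OF n Dnew(1,2) t])
  finally show "lm f = t" using l(2) by (simp only: embed_lookup)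
qed

text \<open>The possible states of the loop over the limiting exponents: downward closure records
  that everything below the next exponent has been processed.\<close>

definition initial_part :: "exps list \<Rightarrow> bool" where
  "initial_part lts \<longleftrightarrow> sorted_wrt (<) lts \<and> set lts \<subseteq> limiting_set n Dnew \<and>
     (\<forall>e\<in>limiting_set n Dnew. \<forall>t\<in>set lts. e < t \<longrightarrow> e \<in> set lts)"

lemma initial_part_snoc:
  assumes "initial_part (lts @ [t])"
  shows "initial_part lts" "t \<in> limiting_set n Dnew" "t \<notin> set lts"
    "e \<in> limiting_set n Dnew \<Longrightarrow> e < t \<Longrightarrow> e \<in> set lts"
proof -
  have s: "sorted_wrt (<) lts" "\<forall>x\<in>set lts. x < t" "set lts \<subseteq> limiting_set n Dnew"
    and t: "t \<in> limiting_set n Dnew"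
    and down: "\<And>e t'. e \<in> limiting_set n Dnew \<Longrightarrow> t' \<in> insert t (set lts) \<Longrightarrow> e < t' \<Longrightarrow>
      e \<in> insert t (set lts)"
    using assms unfolding initial_part_def sorted_wrt_append by auto
  show "t \<in> limiting_set n Dnew" by (rule t)
  show "t \<notin> set lts" using s(2) by auto
  show "e \<in> limiting_set n Dnew \<Longrightarrow> e < t \<Longrightarrow> e \<in> set lts" using down[of e t] by auto
  have "e \<in> set lts" if "e \<in> limiting_set n Dnew" "t' \<in> set lts" "e < t'" for e t'
    using down[of e t'] that s(2) by (auto dest: less_asym)
  then show "initial_part lts" using s unfolding initial_part_def by blast
qed

text \<open>The conditions of \<open>standard_pair\<close> on the basis, for the exponents processed
  so far.\<close>

definition partial_basis :: "exps list \<Rightarrow> 'a mpoly set \<Rightarrow> bool" where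
  "partial_basis lts Gh \<longleftrightarrow> Gh \<subseteq> I \<inter> J c \<and> lm ` Gh = set lts \<and>
     (\<forall>g\<in>Gh. g \<noteq> 0 \<and> lc g = 1 \<and> keys g - {lm g} \<subseteq> Dnew)"

lemma merge_basis_partial_basis:
  assumes "merge_basis n w D' G' cs c Dold G lts Gh" "initial_part lts"
  shows "partial_basis lts Gh"
  using assms
proof (induction rule: merge_basis.induct)
  case start
  then show ?case by (simp add: partial_basis_def)
next
  case (step lts Gh t f1 f2 v q1 q2 pp1 pp2 r1 r2 f')
  note ip = initial_part_snoc[OF step.prems]
  have IH: "partial_basis lts Gh" by (rule step.IH[OF ip(1)])
  note f = combination[OF ip(2) step.hyps(2-11)]
  have Gh: "Gh \<subseteq> I \<inter> J c" "\<forall>g\<in>Gh. g \<noteq> 0 \<and> lm g \<in> limiting_set n Dnew \<and> lm g \<noteq> t"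
    "\<forall>e\<in>limiting_set n Dnew. e < t \<longrightarrow> e \<in> lm ` Gh"
    using IH ip(1,3,4) unfolding partial_basis_def initial_part_def by blast+
  note f' = fully_reduces_to_tail[OF IJ_ideal Dnew(2) ip(2) Gh f step.hyps(12)]
  show ?case
    using IH f' unfolding partial_basis_def by simp
qed

text \<open>No iteration gets stuck: \<open>GLT\<close> is outside the lower set and so divisible by
  a leading monomial, Bezout coefficients exist by comaximality, and reduction can be
  completed.\<close>

lemma ex_merge_basis:
  assumes "initial_part lts"
  shows "\<exists>Gh. merge_basis n w D' G' cs c Dold G lts Gh"
  using assms
proof (induction lts rule: rev_induct)
  case Nil
  then show ?case using merge_basis.start by blast
next
  case (snoc t lts)
  note ip = initial_part_snoc[OF snoc.prems]
  obtain Gh where Gh: "merge_basis n w D' G' cs c Dold G lts Gh" using snoc.IH[OF ip(1)] by blast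
  have tc: "t \<in> coords n" using ip(2) by (simp add: limiting_set_def)
  obtain f1 where f1: "is_GLP n t Dold G f1" using ex_GLP[OF n mergedD(1,2) tc] by blast
  obtain f2 where f2: "is_GLP n t (D' c) (G' c) f2" using ex_GLP[OF n levelD(1,2)[OF cs(2)] tc] by blast
  define v where "v = (\<lambda>x. proj n (GLT n t (D' x)))"
  obtain s1 s2 where s: "s1 * [:- c, 1:] ^ (w c + 1 - v c) + s2 * (\<Prod>x\<in>set cs. [:- x, 1:] ^ (w x + 1 - v x)) = 1"
    using comax_linear_powers[OF cs(3), of "w c + 1 - v c" "\<lambda>x. w x + 1 - v x"]
    unfolding comax_def by blast
  have bez: "univ_poly n s1 * (Var n - Const c) ^ (w c + 1 - v c) +
      univ_poly n s2 * (\<Prod>x\<in>set cs. (Var n - Const x) ^ (w x + 1 - v x)) = 1"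
    using arg_cong[OF s, of "univ_poly n"] by (simp only: univ_poly_add univ_poly_mult univ_poly_prod univ_poly_power univ_poly_linear univ_poly_1)
  have r: "univ_poly n s1 \<in> polys_in_var n" "univ_poly n s2 \<in> polys_in_var n" by (auto simp: polys_in_var_eq)
  let ?f = "univ_poly n s1 * (f1 * (Var n - Const c) ^ (w c + 1)) +
    univ_poly n s2 * (f2 * (\<Prod>x\<in>set cs. (Var n - Const x) ^ (w x + 1)))"
  have "?f \<in> polys n"
    using combination(1)[OF ip(2) f1 f2 v_def refl refl refl refl r bez] poly_ideal_polys[OF IJ_ideal] by blast
  moreover have "Gh \<subseteq> polys n"
    using merge_basis_partial_basis[OF Gh ip(1)] poly_ideal_polys[OF IJ_ideal]
    unfolding partial_basis_def by blast
  ultimately obtain f' where "fully_reduces_to Gh ?f f'" using ex_fully_reduces_to by blast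
  from merge_basis.step[OF Gh f1 f2 v_def refl refl refl refl r bez this]
  show ?case by blast
qed

lemma initial_part_all: "initial_part (sorted_list_of_set (limiting_set n Dnew))"
  using finite_limiting_set[OF Dnew(1)] by (simp add: initial_part_def)

lemma merge_step_ok:
  assumes "merge_basis n w D' G' cs c Dold G (sorted_list_of_set (limiting_set n Dnew)) Gh"
  shows "merged_ok n (I \<inter> J c) w D' (insert c (set cs)) Dnew Gh"
proof -
  have P: "partial_basis (sorted_list_of_set (limiting_set n Dnew)) Gh"
    by (rule merge_basis_partial_basis[OF assms initial_part_all])
  then have "standard_pair n (I \<inter> J c) Dnew Gh"
    using Dnew(1,2) merged_lm finite_limiting_set[OF Dnew(1), of n]
    unfolding standard_pair_def partial_basis_def by simp
  moreover have "univ_poly n (\<Prod>x\<in>insert c (set cs). [:- x, 1:] ^ (w x + 1)) * f \<in> I \<inter> J c"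
    if f: "f \<in> polys n" for f
  proof
    let ?a = "univ_poly n ([:- c, 1:] ^ (w c + 1))" and ?b = "univ_poly n (\<Prod>x\<in>set cs. [:- x, 1:] ^ (w x + 1))"
    have e: "univ_poly n (\<Prod>x\<in>insert c (set cs). [:- x, 1:] ^ (w x + 1)) = ?a * ?b"
      using cs(3) by (simp add: univ_poly_mult del: power_Suc)
    have "?b * (?a * f) \<in> I" by (rule mergedD(5)[OF polys_mult[OF polys_univ[OF n] f]])
    then show "univ_poly n (\<Prod>x\<in>insert c (set cs). [:- x, 1:] ^ (w x + 1)) * f \<in> I"
      unfolding e by (simp only: ac_simps)
    have "?a * (?b * f) \<in> J c" by (rule levelD(5)[OF cs(2) polys_mult[OF polys_univ[OF n] f]])
    then show "univ_poly n (\<Prod>x\<in>insert c (set cs). [:- x, 1:] ^ (w x + 1)) * f \<in> J c"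
      unfolding e by (simp only: mult.assoc)
  qed
  ultimately show ?thesis
    unfolding merged_ok_def using IJ_ideal merged_col_dvd Dnew(3) by simp
qed

end

lemma level_merged_ok:
  assumes "c \<in> S"
  shows "merged_ok n (\<Inter>x\<in>set [c]. J x) w D' (set [c]) (D' c) (G' c)"
  using levelD[OF assms] unfolding merged_ok_def by simp

lemma merge_levels_ok:
  assumes "merge_levels n w D' G' cs D G" "distinct cs" "set cs \<subseteq> S"
  shows "cs \<noteq> [] \<and> merged_ok n (\<Inter>x\<in>set cs. J x) w D' (set cs) D G"
  using assms
proof (induction rule: merge_levels.induct)
  case (first c)
  then show ?case using level_merged_ok by auto
next
  case ("next" cs Dold G D c Gh)
  have cs: "set cs \<subseteq> S" "c \<in> S" "c \<notin> set cs" using "next.prems" by auto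
  have M: "merged_ok n (\<Inter>x\<in>set cs. J x) w D' (set cs) Dold G" using "next.IH" "next.prems" by auto
  have e: "(\<Inter>x\<in>set (cs @ [c]). J x) = (\<Inter>x\<in>set cs. J x) \<inter> J c" by auto
  show ?case
    using merge_step_ok[OF cs M] "next.hyps" unfolding e by auto
qed

lemma ex_merge_levels:
  assumes "cs \<noteq> []" "distinct cs" "set cs \<subseteq> S"
  shows "\<exists>D G. merge_levels n w D' G' cs D G"
  using assms
proof (induction cs rule: rev_nonempty_induct)
  case (single c)
  then show ?case using merge_levels.first by blast
next
  case (snoc c cs)
  then obtain Dold G where DG: "merge_levels n w D' G' cs Dold G" by auto
  have cs: "set cs \<subseteq> S" "c \<in> S" "c \<notin> set cs" using snoc.prems by auto
  have M: "merged_ok n (\<Inter>x\<in>set cs. J x) w D' (set cs) Dold G"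
    using merge_levels_ok[OF DG] snoc.prems by auto
  obtain Gh where "merge_basis n w D' G' cs c Dold G
      (sorted_list_of_set (limiting_set n (lower_add n Dold (D' c)))) Gh"
    using ex_merge_basis[OF cs M initial_part_all[OF cs M]] by blast
  then show ?case using merge_levels.next[OF DG refl] by blast
qed

end

section \<open>The univariate case\<close>

lemma coords_1_eq:
  assumes "d \<in> coords 1"
  shows "d = single 1 (lookup d 1)" "proj_hat 1 d = 0"
proof -
  have "lookup d i = 0" if "i \<noteq> 1" for i using assms that by (auto simp: in_coords_iff)
  then show "d = single 1 (lookup d 1)" "proj_hat 1 d = 0"
    by (auto intro!: poly_mapping_eqI simp: lookup_single lookup_hat when_def)
qed

lemma taylor_univariate:
  assumes "f \<in> polys 1"
  shows "taylor 1 p d f = coeff (pcompose (colpoly 1 f 0) [:lookup p 1, 1:]) (lookup d 1)"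
  using assms
proof (induction f rule: polys_induct)
  case (single m a)
  have "proj_hat 1 m = proj_hat 1 0" using coords_1_eq(2)[OF single] coords_1_eq(2)[OF coords_zero] by simp
  then show ?case by (simp add: taylor_single colpoly_single pcompose_monom)
qed (simp add: taylor_add colpoly_add pcompose_add)

lemma lower_set_univariate:
  assumes "finite D" "lower_set 1 D"
  shows "D = single 1 ` {..<card D}"
proof -
  have e: "embed_at 1 j 0 = single 1 j" for j :: nat
    by (rule poly_mapping_eqI) (auto simp: lookup_embed lookup_single when_def)
  have "d \<in> single 1 ` {j. single 1 j \<in> D}" if "d \<in> D" for d
    using coords_1_eq(1)[OF lower_set_coords[OF assms(2) that]] that
    by (intro image_eqI[of _ _ "lookup d 1"]) auto
  then have "D = single 1 ` column 1 D 0" unfolding e by blast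
  then have D: "D = single 1 ` {..<height 1 D 0}"
    unfolding column_height[OF order_refl assms] .
  have "card D = card (single 1 ` {..<height 1 D 0} :: exps set)" by (rule arg_cong[OF D])
  also have "\<dots> = height 1 D 0"
    using card_image[OF inj_on_subset[OF inj_single subset_UNIV], of "1 :: nat" "{..<height 1 D 0}"]
    by (simp only: card_lessThan)
  finally show ?thesis using D by (simp only:)
qed

lemma prod_dvd_if_comax:
  assumes "finite A" "\<And>x y. x \<in> A \<Longrightarrow> y \<in> A \<Longrightarrow> x \<noteq> y \<Longrightarrow> comax (q x) (q y)" "\<And>x. x \<in> A \<Longrightarrow> q x dvd u"
  shows "(\<Prod>x\<in>A. q x) dvd (u :: 'a :: comm_ring_1)"
  using assms
proof (induction A rule: finite_induct)
  case (insert x A)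
  have "comax (q x) (\<Prod>x\<in>A. q x)" using insert by (intro comax_prod) auto
  then show ?case using insert by (auto intro!: comax_dvd)
qed simp

text \<open>In one variable there is a single column, and the conditions at (p, D) say that (X_1 -
  p)^(card D) divides \<open>f\<close>. By comaximality the product \<open>Q\<close> divides every
  member of the ideal, and its degree is the number of exponents.\<close>

lemma univariate_std_pair:
  fixes H :: "'a::field mult_points"
  assumes H: "points_with_mult 1 H" and ch: "char_admissible 1 H"
  shows "standard_pair 1 (vanishing_ideal 1 H) (single 1 ` {..<\<Sum>(p, D)\<in>H. card D})
    {\<Prod>(p, D)\<in>H. (Var 1 - Const (lookup p 1)) ^ card D}"
proof -
  define Q where "Q = (\<Prod>x\<in>H. [:- lookup (fst x) 1, 1 :: 'a:] ^ card (snd x))"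
  define N where "N = (\<Sum>x\<in>H. card (snd x))"
  have D: "finite D" "lower_set 1 D" "p \<in> coords 1" if "(p, D) \<in> H" for p D
    using H that by (auto simp: points_with_mult_def)
  have I_iff: "f \<in> vanishing_ideal 1 H \<longleftrightarrow>
      f \<in> polys 1 \<and> (\<forall>(p, D)\<in>H. [:- lookup p 1, 1:] ^ card D dvd colpoly 1 f 0)" for f
  proof -
    have "(\<forall>d\<in>D. taylor 1 p d f = 0) \<longleftrightarrow> [:- lookup p 1, 1:] ^ card D dvd colpoly 1 f 0"
      if "(p, D) \<in> H" "f \<in> polys 1" for p D
      unfolding linear_power_dvd_iff taylor_univariate[OF that(2)]
      by (subst lower_set_univariate[OF D(1,2)[OF that(1)]]) auto
    then show ?thesis unfolding vanishing_ideal_iff[OF ch] by fastforce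
  qed
  have hat: "proj_hat 1 m = proj_hat 1 0" if "m \<in> coords 1" for m :: exps
    using coords_1_eq(2)[OF that] coords_1_eq(2)[OF coords_zero] by simp
  have degQ: "degree Q = N"
    unfolding Q_def N_def by (subst degree_prod_eq_sum_degree) (auto simp: degree_linear_power)
  have lcQ: "lead_coeff Q = 1"
    by (simp add: Q_def lead_coeff_prod lead_coeff_power)
  define g where "g = univ_poly 1 Q"
  have g: "g = (\<Prod>(p, D)\<in>H. (Var 1 - Const (lookup p 1)) ^ card D)"
    unfolding g_def Q_def univ_poly_prod univ_poly_power univ_poly_linear by (simp add: case_prod_beta)
  have gp: "g \<in> polys 1" unfolding g_def by (rule polys_univ) simp
  have colg: "colpoly 1 g 0 = Q" using colpoly_univ[of 1 Q 1 0] by (simp add: g_def colpoly_1)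
  have lmg: "g \<noteq> 0" "lm g = single 1 N" "lc g = 1"
  proof -
    have le: "proj_hat 1 m \<le> proj_hat 1 0" if "m \<in> keys g" for m
      using hat[OF polys_keys[OF gp that]] by simp
    have nz: "colpoly 1 g 0 \<noteq> 0" using lcQ unfolding colg by auto
    have "embed_at 1 N 0 = single 1 N"
      by (rule poly_mapping_eqI) (auto simp: lookup_embed lookup_single when_def)
    then show "g \<noteq> 0" "lm g = single 1 N" "lc g = 1"
      using lm_by_colpoly[OF coords_zero order_refl gp le nz] unfolding colg degQ lcQ[unfolded degQ] by simp_all
  qed
  have sd: "single 1 j - single 1 1 = (single 1 (j - 1) :: exps)" for j
    by (rule poly_mapping_eqI) (simp add: lookup_minus lookup_single when_def)
  have "standard_pair 1 (vanishing_ideal 1 H) (single 1 ` {..<N}) {g}"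
    unfolding standard_pair_def
  proof (intro conjI ballI impI)
    show "finite (single 1 ` {..<N})" by simp
    show "lower_set 1 (single 1 ` {..<N})"
      unfolding lower_set_def
    proof (intro conjI ballI impI)
      show "single 1 ` {..<N} \<subseteq> (coords 1 :: exps set)" by (auto intro!: coords_single)
      fix d :: exps and i :: nat assume "d \<in> single 1 ` {..<N}" "i \<in> {1..1}"
      then obtain j where "d = single 1 j" "j < N" "i = 1" by auto
      then show "d - single i 1 \<in> single 1 ` {..<N}"
        using sd[of j] by (intro image_eqI[of _ _ "j - 1"]) auto
    qed
    fix f assume f: "f \<in> vanishing_ideal 1 H" "f \<noteq> 0"
    then have fp: "f \<in> polys 1" by (simp add: vanishing_ideal_def)
    have co: "lm f \<in> coords 1" using polys_keys[OF fp lm_in_keys[OF f(2)]] .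
    have "Q dvd colpoly 1 f 0"
      unfolding Q_def
    proof (rule prod_dvd_if_comax)
      show "finite H" using H by (simp add: points_with_mult_def)
      show "[:- lookup (fst x) 1, 1:] ^ card (snd x) dvd colpoly 1 f 0" if "x \<in> H" for x
        using f(1) that unfolding I_iff by auto
      fix x y assume xy: "x \<in> H" "y \<in> H" "x \<noteq> y"
      then have "fst x \<noteq> fst y" using H by (auto simp: points_with_mult_def inj_on_def)
      moreover have "fst x \<in> coords 1" "fst y \<in> coords 1" using D(3) xy by (metis prod.collapse)+
      ultimately have "lookup (fst x) 1 \<noteq> lookup (fst y) 1" using coords_1_eq(1) by metis
      then show "comax ([:- lookup (fst x) 1, 1:] ^ card (snd x)) ([:- lookup (fst y) 1, 1:] ^ card (snd y))"
        by (meson comax_linear comax_power comax_sym)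
    qed
    then have "Q dvd colpoly 1 f (lm f)" using colpoly_hat[OF hat[OF co], of f] by simp
    moreover have "colpoly 1 f (lm f) \<noteq> 0"
      using colpoly_lm(2)[OF order_refl fp f(2)] lc_nonzero[OF f(2)] by auto
    ultimately have "N \<le> lookup (lm f) 1"
      using dvd_imp_degree_le[of Q "colpoly 1 f (lm f)"] colpoly_lm(1)[OF order_refl fp f(2)] degQ by simp
    then show "lm f \<notin> single 1 ` {..<N}" by auto
  next
    have "[:- lookup p 1, 1:] ^ card D dvd Q" if "(p, D) \<in> H" for p D
      using H that dvd_prod_eqI[of H "(p, D)" "[:- lookup p 1, 1:] ^ card D" "\<lambda>x. [:- lookup (fst x) 1, 1:] ^ card (snd x)"]
      by (simp add: Q_def points_with_mult_def)
    then show "{g} \<subseteq> vanishing_ideal 1 H" using gp by (auto simp: I_iff colg simp del: One_nat_def)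
    show "lm ` {g} = limiting_set 1 (single 1 ` {..<N})"
    proof (intro equalityI subsetI)
      fix e assume "e \<in> lm ` {g}"
      then have e: "e = single 1 N" using lmg by simp
      show "e \<in> limiting_set 1 (single 1 ` {..<N})"
        unfolding limiting_set_def e
      proof (intro CollectI conjI DiffI ballI impI)
        show "single 1 N \<in> coords 1" by (simp add: coords_single)
        show "single 1 N \<notin> single 1 ` {..<N}" using injD[OF inj_single, of 1 N] by blast
        fix i :: nat assume "i \<in> {1..1}" "lookup (single 1 N) i \<noteq> 0"
        then have "i = 1" "N \<noteq> 0" by auto
        then show "single 1 N - single i 1 \<in> single 1 ` {..<N}"
          using sd[of N] by (intro image_eqI[of _ _ "N - 1"]) auto
      qed
    next
      fix e assume e: "e \<in> limiting_set 1 (single 1 ` {..<N})"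
      then have es: "e = single 1 (lookup e 1)" by (intro coords_1_eq) (simp add: limiting_set_def)
      have "\<not> lookup e 1 < N" using e es by (auto simp: limiting_set_def)
      moreover have "lookup e 1 - 1 < N" if "lookup e 1 \<noteq> 0"
      proof -
        have "e - single 1 1 \<in> single 1 ` {..<N}" using e that by (auto simp: limiting_set_def)
        then have "lookup (e - single 1 1) 1 < N" by auto
        then show ?thesis by (simp add: lookup_minus)
      qed
      ultimately have "lookup e 1 = N" by (cases "lookup e 1") auto
      then show "e \<in> lm ` {g}" using es lmg by simp
    qed
    fix h assume "h \<in> {g}"
    then have h: "h = g" by simp
    show "h \<noteq> 0" "lc h = 1" using lmg h by auto
    show "keys h - {lm h} \<subseteq> single 1 ` {..<N}"
    proof
      fix m assume m: "m \<in> keys h - {lm h}"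
      then have co: "m \<in> coords 1" using polys_keys[OF gp] h by blast
      have "coeff (colpoly 1 g m) (lookup m 1) \<noteq> 0"
        using m h unfolding coeff_colpoly embed_lookup by (simp add: in_keys_iff)
      then have "lookup m 1 \<le> N" using le_degree degQ colg colpoly_hat[OF hat[OF co], of g] by metis
      moreover have "lookup m 1 \<noteq> N" using m h lmg coords_1_eq(1)[OF co] by auto
      ultimately show "m \<in> single 1 ` {..<N}" using coords_1_eq(1)[OF co] by auto
    qed
  qed
  then show ?thesis unfolding g N_def by (simp add: case_prod_beta)
qed

section \<open>The recursion\<close>

lemma special_case_level_ok:
  fixes H :: "'a::field mult_points"
  assumes H: "points_with_mult n H" and ch: "char_admissible n H"
    and c: "\<And>p D. (p, D) \<in> H \<Longrightarrow> proj n p = c"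
    and IH: "\<And>H' D G. points_with_mult (n - 1) H' \<Longrightarrow> char_admissible (n - 1) (H' :: 'a mult_points) \<Longrightarrow>
      construction (n - 1) H' D G \<Longrightarrow> standard_pair (n - 1) (vanishing_ideal (n - 1) H') D G"
    and S: "special_case n H D G"
  shows "level_ok n (vanishing_ideal n H) c (max_last n H) D G"
proof -
  obtain c' Dt Gt Gs where s: "2 \<le> n" "\<forall>(p, D)\<in>H. proj n p = c'"
    "\<And>i. i \<le> max_last n H \<Longrightarrow> construction (n - 1) (slice n i H) (Dt i) (Gt i)"
    "D = (\<Union>i\<le>max_last n H. embed_at n i ` Dt i)"
    "Gs = (\<Union>i\<le>max_last n H. (\<lambda>g. (Var n - Const c') ^ i * g) ` Gt i) \<union> {(Var n - Const c') ^ (max_last n H + 1)}"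
    "G = {g \<in> Gs. lm g \<in> limiting_set n D}"
    using S by (cases rule: special_case.cases) blast
  have n: "1 \<le> n" using s(1) by simp
  obtain p0 D0 where "(p0, D0) \<in> H" using H by (auto simp: points_with_mult_def)
  \<comment> \<open>The rule ties its constant down only through the points, and \<open>H\<close>
    has at least one.\<close>
  then have c': "c' = c" using c s(2) by fastforce
  have St: "standard_pair (n - 1) (vanishing_ideal (n - 1) (slice n i H)) (Dt i) (Gt i)" if "i \<le> max_last n H" for i
    by (rule IH[OF slice_points_with_mult[OF n H ch c that] slice_char_admissible[OF n H ch c] s(3)[OF that]])
  note a = n H ch c St s(4)
  have "standard_pair n (vanishing_ideal n H) D G"
    unfolding s(6) by (rule stack_std_pair[OF a]) (simp_all add: s(5) c')
  moreover have "col_dvd n (vanishing_ideal n H) (\<lambda>d. [:- c, 1:] ^ height n D d)"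
    by (rule stack_col_dvd[OF a])
  moreover have "height n D d \<le> max_last n H + 1" for d
    by (rule stack_height[OF a])
  moreover have I: "poly_ideal n (vanishing_ideal n H)"
    by (rule vanishing_ideal_ideal[OF ch]) (use H in \<open>auto simp: points_with_mult_def\<close>)
  moreover have "univ_poly n ([:- c, 1:] ^ (max_last n H + 1)) * f \<in> vanishing_ideal n H" if "f \<in> polys n" for f
  proof -
    \<comment> \<open>The exponent exceeds \<open>max_last n H\<close>, so the membership premise
      about the slice is vacuous.\<close>
    have "univ_poly n ([:- c, 1:] ^ (max_last n H + 1)) * 1 \<in> vanishing_ideal n H"
      by (rule vanishing_ideal_power_mult[OF n H ch c]) auto
    from poly_ideal_mult[OF I that this] show ?thesis by (simp add: mult.commute)
  qed
  ultimately show ?thesis unfolding level_ok_def by blast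
qed

lemma ex_special_case:
  fixes H :: "'a::field mult_points"
  assumes n: "2 \<le> n" and H: "points_with_mult n H" and ch: "char_admissible n H"
    and c: "\<And>p D. (p, D) \<in> H \<Longrightarrow> proj n p = c"
    and IH: "\<And>H' :: 'a mult_points. points_with_mult (n - 1) H' \<Longrightarrow> char_admissible (n - 1) H' \<Longrightarrow>
      \<exists>D G. construction (n - 1) H' D G"
  shows "\<exists>D G. special_case n H D G"
proof -
  have n1: "1 \<le> n" using n by simp
  have "\<exists>D G. construction (n - 1) (slice n i H) D G" if "i \<le> max_last n H" for i
    by (rule IH[OF slice_points_with_mult[OF n1 H ch c that] slice_char_admissible[OF n1 H ch c]])
  then have "\<forall>i. \<exists>D G. i \<le> max_last n H \<longrightarrow> construction (n - 1) (slice n i H) D G" by blast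
  then obtain Dt Gt where "\<And>i. i \<le> max_last n H \<Longrightarrow> construction (n - 1) (slice n i H) (Dt i) (Gt i)"
    by metis
  from special[OF n _ refl this refl refl, of c] c show ?thesis by blast
qed

text \<open>Existence and correctness go through one induction: a merge is known to have an output
  only when its inputs, the results for the levels, are already known to be correct.\<close>

lemma construction_correct:
  fixes H :: "'a::field mult_points"
  assumes "1 \<le> n" "points_with_mult n H" "char_admissible n H"
  shows "(\<exists>D G. construction n H D G) \<and>
    (\<forall>D G. construction n H D G \<longrightarrow> standard_pair n (vanishing_ideal n H) D G)"
  using assms
proof (induction n arbitrary: H rule: nat_induct_at_least)
  case base
  have "standard_pair 1 (vanishing_ideal 1 H) D G" if "construction 1 H D G" for D G
    using that univariate_std_pair[OF base] by (cases rule: construction.cases) auto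
  then show ?case using univariate by blast
next
  case (Suc n)
  define N where "N = Suc n"
  define J where "J = (\<lambda>c. vanishing_ideal N (level N c H))"
  define w where "w = (\<lambda>c. max_last N (level N c H))"
  define C where "C = (\<lambda>(p, D). proj N p) ` H"
  have H: "points_with_mult N H" and ch: "char_admissible N H" and N: "2 \<le> N" "1 \<le> N" "N - 1 = n"
    using Suc by (auto simp: N_def)
  have IH_ex: "\<exists>D G. construction (N - 1) H' D G"
    and IH_ok: "construction (N - 1) H' D G \<Longrightarrow> standard_pair (N - 1) (vanishing_ideal (N - 1) H') D G"
    if "points_with_mult (N - 1) H'" "char_admissible (N - 1) H'" for H' :: "'a mult_points" and D G
    using Suc.IH[of H'] that unfolding N(3) by blast+
  have lev: "points_with_mult N (level N c H)" "char_admissible N (level N c H)"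
    "\<And>p D. (p, D) \<in> level N c H \<Longrightarrow> proj N p = c" if "c \<in> C" for c
  proof -
    have "level N c H \<subseteq> H" by (auto simp: level_def)
    moreover have "level N c H \<noteq> {}" using that by (auto simp: level_def C_def)
    moreover have "finite (level N c H)" "inj_on fst (level N c H)"
      using H calculation(1) finite_subset[of "level N c H" H] inj_on_subset[of fst H "level N c H"]
      by (simp_all add: points_with_mult_def)
    ultimately show "points_with_mult N (level N c H)" "char_admissible N (level N c H)"
      using H ch unfolding points_with_mult_def char_admissible_def by blast+
  qed (auto simp: level_def)
  have L: "level_ok N (J c) c (w c) D G" if "c \<in> C" "special_case N (level N c H) D G" for c D G
    unfolding J_def w_def
    by (rule special_case_level_ok[OF lev[OF that(1)] IH_ok that(2)])
  have finH: "finite H" "H \<noteq> {}" using H by (auto simp: points_with_mult_def)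
  have meet: "(\<Inter>c\<in>C. J c) = vanishing_ideal N H"
    using finH(2) by (auto simp: J_def C_def vanishing_ideal_def level_def)
  have "standard_pair N (vanishing_ideal N H) D G" if "construction N H D G" for D G
    using that
  proof (cases rule: construction.cases)
    case (general cs D' G')
    have cs: "set cs = C" using general by (simp add: C_def)
    have "merged_ok N (\<Inter>c\<in>set cs. J c) w D' (set cs) D G"
      using merge_levels_ok[OF N(2) L, of "set cs" D' G' cs D G] general cs by (simp add: w_def)
    then show ?thesis unfolding cs meet merged_ok_def by blast
  qed (use N in auto)
  moreover have "\<exists>D G. construction N H D G"
  proof -
    have "finite C" using finH by (simp add: C_def)
    then obtain cs where cs: "set cs = C" "distinct cs" using finite_distinct_list by blast
    have ne: "cs \<noteq> []" using cs(1) finH(2) by (auto simp: C_def)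
    have "\<exists>D G. special_case N (level N c H) D G" if "c \<in> C" for c
      by (rule ex_special_case[OF N(1) lev[OF that] IH_ex])
    then have "\<forall>c. \<exists>D G. c \<in> C \<longrightarrow> special_case N (level N c H) D G" by blast
    then obtain D' G' where sp: "\<And>c. c \<in> C \<Longrightarrow> special_case N (level N c H) (D' c) (G' c)" by metis
    have lev_ok: "level_ok N (J x) x (w x) (D' x) (G' x)" if "x \<in> set cs" for x
      using L[of x "D' x" "G' x"] sp[of x] that cs(1) by blast
    have "\<exists>D G. merge_levels N w D' G' cs D G"
      by (rule ex_merge_levels[OF N(2) lev_ok ne cs(2) order_refl])
    then obtain D G where DG: "merge_levels N w D' G' cs D G" by blast
    have "construction N H D G"
    proof (rule general[OF N(1) cs(2)])
      show "set cs = (\<lambda>(p, D). proj N p) ` H" using cs(1) by (simp add: C_def)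
      show "special_case N (level N c H) (D' c) (G' c)" if "c \<in> set cs" for c
        using sp that cs(1) by blast
      show "merge_levels N (\<lambda>c. max_last N (level N c H)) D' G' cs D G"
        using DG by (simp add: w_def)
    qed
    then show ?thesis by blast
  qed
  ultimately show ?case unfolding N_def by blast
qed

text \<open>The first conjunct excludes that the second holds vacuously. As reduced Groebner bases
  are unique, the output does not depend on the choices made during the construction.\<close>

theorem theorem4:
  fixes n :: nat and H :: "'a::field mult_points"
  assumes "1 \<le> n" and "points_with_mult n H"
    and "CHAR('a) = 0 \<or> (\<forall>(p, D)\<in>H. \<forall>d\<in>D. \<forall>i\<in>{1..n}. Poly_Mapping.lookup d i < CHAR('a))"
  shows "(\<exists>D G. construction n H D G) \<and>
    (\<forall>D G. construction n H D G \<longrightarrow>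
       is_reduced_Groebner_basis n (vanishing_ideal n H) G \<and>
       D = quotient_basis n (vanishing_ideal n H))"
proof -
  have ch: "char_admissible n H" using assms(3) by (simp add: char_admissible_def)
  have I: "poly_ideal n (vanishing_ideal n H)"
    by (rule vanishing_ideal_ideal[OF ch]) (use assms(2) in \<open>auto simp: points_with_mult_def\<close>)
  show ?thesis
    using construction_correct[OF assms(1,2) ch]
      standard_pair_reduced_Groebner_basis[OF I] standard_pair_quotient_basis[OF I] by blast
qed

end
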